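(* Let $X=\mathbb D^3$, with test functions the coordinate functions $\Psi=\{z_1,z_2,z_3\}$, $\Lambda=\{e_1,e_2,e_3\}$, and let $H^\infty(X,\mathcal K_\Lambda)$ be the corresponding (classical) Agler algebra. Let $u_1,u_2,u_3\in\mathbb R^2$ be unit (row) vectors with $u_1+u_2+u_3=0$ (without loss of generality $u_1=\begin{pmatrix}0&1\end{pmatrix}$, $u_2=\begin{pmatrix}\sqrt3/2&-1/2\end{pmatrix}$, $u_3=\begin{pmatrix}-\sqrt3/2&-1/2\end{pmatrix}$). Define a representation $\pi:H^\infty(X,\mathcal K_\Lambda)\to M_4(\mathbb C)$ by $$\pi(z_j):=T_j=\begin{pmatrix}0&u_j&0\\0&0&u_j^*\\0&0&0\end{pmatrix},\qquad j=1,2,3$$ (blocks with respect to $\mathbb C^4=\mathbb C\oplus\mathbb C^2\oplus\mathbb C$). Then this is a (completely contractive) boundary representation of $H^\infty(X,\mathcal K_\Lambda)$.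
   Context: For $n\ge1$, let $\mathcal K_{\Lambda,\mathbb C^n}$ be the set of positive $M_n(\mathbb C)$-valued kernels $k$ on $\mathbb D^3$ (i.e. $\sum_{i,j}\langle k(x_i,x_j)h_j,h_i\rangle\ge0$ for all finite families) such that $(1-z_j\overline{w_j})k(z,w)$ is positive for $j=1,2,3$. $H^\infty(X,\mathcal K_{\Lambda,\mathbb C^n})$ is the algebra of functions $\varphi:\mathbb D^3\to M_n(\mathbb C)$ for which there is $c\ge0$ with $(c^21_n-\varphi(z)\varphi(w)^* )\otimes k(z,w)$ a positive kernel for all $k\in\mathcal K_{\Lambda,\mathbb C^n}$, normed by the smallest such $c$. $H^\infty(X,\mathcal K_\Lambda)$ is the case $n=1$, and $M_n(H^\infty(X,\mathcal K_\Lambda))$ is normed as $H^\infty(X,\mathcal K_{\Lambda,\mathbb C^n})$; all its elements are analytic. The representation determined by the commuting nilpotent tuple $T=(T_1,T_2,T_3)$ is $\varphi\mapsto\varphi(T)$, given by substituting $T$ in the Taylor series of $\varphi$ at $0$ (a finite sum). A boundary representation is an irreducible completely contractive unital representation with the property that any completely contractive dilation of it contains it as a direct summand; a representation $\tilde\pi$ dilates $\pi$ if $\pi$ is the compression of $\tilde\pi$ to a semi-invariant subspace (a difference of two invariant subspaces). *)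

theory Defs
  imports "HOL-Analysis.Analysis"
begin

section \<open>Complex Hilbert spaces\<close>

text \<open>
  HOL-Analysis only has real inner products. The inner product below is linear in its first argument.
\<close>

class chilbert_space = real_normed_vector + complete_space +
  fixes cscale :: "complex \<Rightarrow> 'a \<Rightarrow> 'a"
    and cinner :: "'a \<Rightarrow> 'a \<Rightarrow> complex"
  assumes cscale_add_right: "cscale c (x + y) = cscale c x + cscale c y"
    and cscale_add_left: "cscale (c + d) x = cscale c x + cscale d x"
    and cscale_cscale: "cscale c (cscale d x) = cscale (c * d) x"
    and scaleR_cscale: "r *\<^sub>R x = cscale (complex_of_real r) x"
    and cinner_commute: "cinner x y = cnj (cinner y x)"
    and cinner_add_left: "cinner (x + y) z = cinner x z + cinner y z"
    and cinner_cscale_left: "cinner (cscale c x) y = c * cinner x y"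
    and norm_eq_sqrt_cinner: "norm x = sqrt (Re (cinner x x))"

instantiation complex :: chilbert_space
begin

definition cscale_complex :: "complex \<Rightarrow> complex \<Rightarrow> complex" where
  "cscale_complex c x = c * x"

definition cinner_complex :: "complex \<Rightarrow> complex \<Rightarrow> complex" where
  "cinner_complex x y = x * cnj y"

instance
  by standard
    (auto simp: cscale_complex_def cinner_complex_def algebra_simps scaleR_conv_of_real
      cmod_def power2_eq_square)

end

instantiation vec :: (chilbert_space, finite) chilbert_space
begin

definition cscale_vec :: "complex \<Rightarrow> 'a ^ 'b \<Rightarrow> 'a ^ 'b" where
  "cscale_vec c x = (\<chi> i. cscale c (x $ i))"

definition cinner_vec :: "'a ^ 'b \<Rightarrow> 'a ^ 'b \<Rightarrow> complex" where
  "cinner_vec x y = (\<Sum>i\<in>UNIV. cinner (x $ i) (y $ i))"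

instance
proof
  fix x y z :: "'a ^ 'b" and c d :: complex and r :: real
  show "cscale c (x + y) = cscale c x + cscale c y"
    by (simp add: cscale_vec_def vec_eq_iff cscale_add_right)
  show "cscale (c + d) x = cscale c x + cscale d x"
    by (simp add: cscale_vec_def vec_eq_iff cscale_add_left)
  show "cscale c (cscale d x) = cscale (c * d) x"
    by (simp add: cscale_vec_def vec_eq_iff cscale_cscale)
  show "r *\<^sub>R x = cscale (complex_of_real r) x"
    by (simp add: cscale_vec_def vec_eq_iff scaleR_cscale)
  show "cinner x y = cnj (cinner y x)"
    unfolding cinner_vec_def cnj_sum by (intro sum.cong refl cinner_commute)
  show "cinner (x + y) z = cinner x z + cinner y z"
    by (simp add: cinner_vec_def cinner_add_left sum.distrib)
  show "cinner (cscale c x) y = c * cinner x y"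
    by (simp add: cinner_vec_def cscale_vec_def cinner_cscale_left sum_distrib_left)
  have "(norm (x $ i))\<^sup>2 = Re (cinner (x $ i) (x $ i))" for i
  proof -
    have "Re (cinner (x $ i) (x $ i)) \<ge> 0"
      using norm_ge_zero[of "x $ i"] unfolding norm_eq_sqrt_cinner by simp
    then show ?thesis
      by (simp add: norm_eq_sqrt_cinner)
  qed
  then show "norm x = sqrt (Re (cinner x x))"
    by (simp add: norm_vec_def L2_set_def cinner_vec_def)
qed

end

definition bounded_clinear :: "('a::chilbert_space \<Rightarrow> 'b::chilbert_space) \<Rightarrow> bool" where
  "bounded_clinear f \<longleftrightarrow> bounded_linear f \<and> (\<forall>c x. f (cscale c x) = cscale c (f x))"

definition closed_csubspace :: "'a::chilbert_space set \<Rightarrow> bool" where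
  "closed_csubspace M \<longleftrightarrow> closed M \<and> 0 \<in> M \<and> (\<forall>x\<in>M. \<forall>y\<in>M. x + y \<in> M) \<and>
     (\<forall>c. \<forall>x\<in>M. cscale c x \<in> M)"

definition ortho_compl :: "'a::chilbert_space set \<Rightarrow> 'a set" where
  "ortho_compl M = {x. \<forall>y\<in>M. cinner x y = 0}"

section \<open>The Agler algebra of the tridisc\<close>

definition tridisc :: "(complex ^ 3) set" where
  "tridisc = {z. \<forall>j. cmod (z $ j) < 1}"

text \<open>
  Complex matrices are functions of two indices, of which only the values on an index set \<open>I\<close> matter;
  \<open>M_n\<close> is the case of the index set \<open>{..<n}\<close>, and tensor products are indexed by pairs.
  Functions and kernels on the tridisc are total, but only their values on \<open>tridisc\<close> matter.
\<close>

type_synonym 'i cmatrix = "'i \<Rightarrow> 'i \<Rightarrow> complex"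

definition tensor :: "'i cmatrix \<Rightarrow> 'j cmatrix \<Rightarrow> ('i \<times> 'j) cmatrix" where
  "tensor A B = (\<lambda>(p, r) (q, s). A p q * B r s)"

definition positive_kernel ::
  "'i set \<Rightarrow> (complex ^ 3 \<Rightarrow> complex ^ 3 \<Rightarrow> 'i cmatrix) \<Rightarrow> bool" where
  "positive_kernel I k \<longleftrightarrow>
     (\<forall>(m::nat) x h. (\<forall>i<m. x i \<in> tridisc) \<longrightarrow>
        (\<Sum>i<m. \<Sum>j<m. \<Sum>p\<in>I. (\<Sum>q\<in>I. k (x i) (x j) p q * h j q) * cnj (h i p)) \<in> \<real>\<^sub>\<ge>\<^sub>0)"

definition admissible_kernels :: "nat \<Rightarrow> (complex ^ 3 \<Rightarrow> complex ^ 3 \<Rightarrow> nat cmatrix) set" where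
  "admissible_kernels n =
     {k. positive_kernel {..<n} k \<and>
         (\<forall>j. positive_kernel {..<n} (\<lambda>z w p q. (1 - z $ j * cnj (w $ j)) * k z w p q))}"

definition agler_bound :: "nat \<Rightarrow> (complex ^ 3 \<Rightarrow> nat cmatrix) \<Rightarrow> real \<Rightarrow> bool" where
  "agler_bound n \<phi> c \<longleftrightarrow> 0 \<le> c \<and>
     (\<forall>k\<in>admissible_kernels n. positive_kernel ({..<n} \<times> {..<n})
        (\<lambda>z w. tensor
           (\<lambda>p q. (if p = q then (complex_of_real c)\<^sup>2 else 0) - (\<Sum>l<n. \<phi> z p l * cnj (\<phi> w q l)))
           (k z w)))"

definition H_inf_mat :: "nat \<Rightarrow> (complex ^ 3 \<Rightarrow> nat cmatrix) set" where
  "H_inf_mat n = {\<phi>. \<exists>c. agler_bound n \<phi> c}"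

definition agler_norm :: "nat \<Rightarrow> (complex ^ 3 \<Rightarrow> nat cmatrix) \<Rightarrow> real" where
  "agler_norm n \<phi> = Inf {c. agler_bound n \<phi> c}"

definition H_inf :: "(complex ^ 3 \<Rightarrow> complex) set" where
  "H_inf = {\<phi>. (\<lambda>z p q. \<phi> z) \<in> H_inf_mat 1}"

section \<open>Representations\<close>

text \<open>
  The second condition says that the value of a representation depends only on the restriction
  of its argument to the tridisc. Representations need not be unital.
\<close>

definition representation :: "((complex ^ 3 \<Rightarrow> complex) \<Rightarrow> 'a::chilbert_space \<Rightarrow> 'a) \<Rightarrow> bool" where
  "representation \<pi> \<longleftrightarrow>
     (\<forall>\<phi>\<in>H_inf. bounded_clinear (\<pi> \<phi>)) \<and>
     (\<forall>\<phi>\<in>H_inf. \<forall>\<psi>\<in>H_inf. (\<forall>z\<in>tridisc. \<phi> z = \<psi> z) \<longrightarrow> \<pi> \<phi> = \<pi> \<psi>) \<and>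
     (\<forall>\<phi>\<in>H_inf. \<forall>\<psi>\<in>H_inf. \<pi> (\<lambda>z. \<phi> z + \<psi> z) = (\<lambda>x. \<pi> \<phi> x + \<pi> \<psi> x)) \<and>
     (\<forall>c. \<forall>\<phi>\<in>H_inf. \<pi> (\<lambda>z. c * \<phi> z) = (\<lambda>x. cscale c (\<pi> \<phi> x))) \<and>
     (\<forall>\<phi>\<in>H_inf. \<forall>\<psi>\<in>H_inf. \<pi> (\<lambda>z. \<phi> z * \<psi> z) = \<pi> \<phi> \<circ> \<pi> \<psi>)"

definition unital :: "((complex ^ 3 \<Rightarrow> complex) \<Rightarrow> 'a::chilbert_space \<Rightarrow> 'a) \<Rightarrow> bool" where
  "unital \<pi> \<longleftrightarrow> \<pi> (\<lambda>z. 1) = id"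

text \<open>
  The operator matrix \<open>(\<pi> \<phi>\<^sub>i\<^sub>j)\<close> acts on the \<open>n\<close>-fold Hilbert space direct sum, whose norm is \<open>L2_set\<close>
  of the norms of the components.
\<close>

definition completely_contractive ::
  "((complex ^ 3 \<Rightarrow> complex) \<Rightarrow> 'a::chilbert_space \<Rightarrow> 'a) \<Rightarrow> bool" where
  "completely_contractive \<pi> \<longleftrightarrow>
     (\<forall>n\<ge>1. \<forall>\<phi>\<in>H_inf_mat n. \<forall>h.
        L2_set (\<lambda>i. norm (\<Sum>j<n. \<pi> (\<lambda>z. \<phi> z i j) (h j))) {..<n}
          \<le> agler_norm n \<phi> * L2_set (\<lambda>j. norm (h j)) {..<n})"

definition invariant_subspace ::
  "((complex ^ 3 \<Rightarrow> complex) \<Rightarrow> 'a::chilbert_space \<Rightarrow> 'a) \<Rightarrow> 'a set \<Rightarrow> bool" where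
  "invariant_subspace \<pi> M \<longleftrightarrow> closed_csubspace M \<and> (\<forall>\<phi>\<in>H_inf. \<forall>x\<in>M. \<pi> \<phi> x \<in> M)"

definition reducing_subspace ::
  "((complex ^ 3 \<Rightarrow> complex) \<Rightarrow> 'a::chilbert_space \<Rightarrow> 'a) \<Rightarrow> 'a set \<Rightarrow> bool" where
  "reducing_subspace \<pi> M \<longleftrightarrow> invariant_subspace \<pi> M \<and> invariant_subspace \<pi> (ortho_compl M)"

definition irreducible_rep ::
  "((complex ^ 3 \<Rightarrow> complex) \<Rightarrow> 'a::chilbert_space \<Rightarrow> 'a) \<Rightarrow> bool" where
  "irreducible_rep \<pi> \<longleftrightarrow>
     (UNIV :: 'a set) \<noteq> {0} \<and> (\<forall>M. reducing_subspace \<pi> M \<longrightarrow> M = {0} \<or> M = UNIV)"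

text \<open>
  The space of \<open>\<pi>\<close> is identified with a subspace of the space of \<open>\<rho>\<close> through the isometry \<open>V\<close>;
  the compression of \<open>\<rho> \<phi>\<close> to that subspace is then \<open>V\<^sup>* (\<rho> \<phi>) V\<close>. The semi-invariant subspace is
  the difference, that is, the orthogonal complement of \<open>N\<close> in \<open>M\<close>.
\<close>

definition isometric_embedding :: "('a::chilbert_space \<Rightarrow> 'b::chilbert_space) \<Rightarrow> bool" where
  "isometric_embedding V \<longleftrightarrow> bounded_clinear V \<and> (\<forall>x. norm (V x) = norm x)"

definition semi_invariant ::
  "((complex ^ 3 \<Rightarrow> complex) \<Rightarrow> 'a::chilbert_space \<Rightarrow> 'a) \<Rightarrow> 'a set \<Rightarrow> bool" where
  "semi_invariant \<rho> L \<longleftrightarrow>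
     (\<exists>M N. invariant_subspace \<rho> M \<and> invariant_subspace \<rho> N \<and> N \<subseteq> M \<and> L = M \<inter> ortho_compl N)"

definition dilates ::
  "((complex ^ 3 \<Rightarrow> complex) \<Rightarrow> 'b::chilbert_space \<Rightarrow> 'b) \<Rightarrow> ('a::chilbert_space \<Rightarrow> 'b) \<Rightarrow>
   ((complex ^ 3 \<Rightarrow> complex) \<Rightarrow> 'a \<Rightarrow> 'a) \<Rightarrow> bool" where
  "dilates \<rho> V \<pi> \<longleftrightarrow> isometric_embedding V \<and> semi_invariant \<rho> (range V) \<and>
     (\<forall>\<phi>\<in>H_inf. \<forall>x y. cinner (\<pi> \<phi> x) y = cinner (\<rho> \<phi> (V x)) (V y))"

definition direct_summand ::
  "((complex ^ 3 \<Rightarrow> complex) \<Rightarrow> 'b::chilbert_space \<Rightarrow> 'b) \<Rightarrow> ('a::chilbert_space \<Rightarrow> 'b) \<Rightarrow>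
   ((complex ^ 3 \<Rightarrow> complex) \<Rightarrow> 'a \<Rightarrow> 'a) \<Rightarrow> bool" where
  "direct_summand \<rho> V \<pi> \<longleftrightarrow> isometric_embedding V \<and> reducing_subspace \<rho> (range V) \<and>
     (\<forall>\<phi>\<in>H_inf. \<forall>x. \<rho> \<phi> (V x) = V (\<pi> \<phi> x))"

text \<open>
  HOL cannot quantify over types inside a formula, so the type \<open>'h\<close> of the dilation space is a
  parameter. A theorem in which \<open>'h\<close> is a type variable covers dilations to all Hilbert spaces.
\<close>

definition boundary_representation ::
  "'h::chilbert_space itself \<Rightarrow> ((complex ^ 3 \<Rightarrow> complex) \<Rightarrow> 'a::chilbert_space \<Rightarrow> 'a) \<Rightarrow> bool" where
  "boundary_representation (_ :: 'h itself) \<pi> \<longleftrightarrow>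
     representation \<pi> \<and> unital \<pi> \<and> completely_contractive \<pi> \<and> irreducible_rep \<pi> \<and>
     (\<forall>(\<rho> :: (complex ^ 3 \<Rightarrow> complex) \<Rightarrow> 'h \<Rightarrow> 'h) V.
        representation \<rho> \<and> completely_contractive \<rho> \<and> dilates \<rho> V \<pi> \<longrightarrow> direct_summand \<rho> V \<pi>)"

section \<open>Substitution of a nilpotent tuple in the Taylor series\<close>

definition taylor_coeff :: "(complex ^ 3 \<Rightarrow> complex) \<Rightarrow> nat \<times> nat \<times> nat \<Rightarrow> complex" where
  "taylor_coeff \<phi> = (\<lambda>(a, b, c).
     (deriv ^^ a) (\<lambda>x. (deriv ^^ b) (\<lambda>y. (deriv ^^ c) (\<lambda>w. \<phi> (vector [x, y, w])) 0) 0) 0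
       / (fact a * fact b * fact c))"

definition op_monomial :: "(3 \<Rightarrow> 'a \<Rightarrow> 'a) \<Rightarrow> nat \<times> nat \<times> nat \<Rightarrow> 'a \<Rightarrow> 'a" where
  "op_monomial S = (\<lambda>(a, b, c). (S 1 ^^ a) \<circ> (S 2 ^^ b) \<circ> (S 3 ^^ c))"

text \<open>For commuting nilpotent operators only finitely many monomials are nonzero.\<close>

definition eval_tuple ::
  "(3 \<Rightarrow> 'a::chilbert_space \<Rightarrow> 'a) \<Rightarrow> (complex ^ 3 \<Rightarrow> complex) \<Rightarrow> 'a \<Rightarrow> 'a" where
  "eval_tuple S \<phi> x =
     (\<Sum>\<alpha> | op_monomial S \<alpha> \<noteq> (\<lambda>_. 0). cscale (taylor_coeff \<phi> \<alpha>) (op_monomial S \<alpha> x))"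

definition T_mat :: "real ^ 2 \<Rightarrow> complex ^ 4 ^ 4" where
  "T_mat v = vector
     [vector [0, complex_of_real (v $ 1), complex_of_real (v $ 2), 0],
      vector [0, 0, 0, complex_of_real (v $ 1)],
      vector [0, 0, 0, complex_of_real (v $ 2)],
      vector [0, 0, 0, 0]]"

end

theory Submission
  imports Defs "HOL-Complex_Analysis.Cauchy_Integral_Formula"
begin

text \<open>
  Every \<open>\<phi>\<close> in the Agler algebra can be divided: \<open>\<phi> = \<phi> 0 + z\<^sub>1 g\<^sub>1 + z\<^sub>2 g\<^sub>2 + z\<^sub>3 g\<^sub>3\<close> with all \<open>g\<^sub>j\<close> again
  in the algebra, because an admissible kernel tensored with a suitable two-point kernel stays
  admissible. In particular the Taylor coefficients up to order two are values at \<open>0\<close> of elements of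
  the algebra.

  The tuple \<open>T\<close> is, up to transposition, a limit of commuting contractions that have a joint eigenbasis with
  eigenvalues in the tridisc. For these the Agler inequality on the four eigenvalues is precisely
  complete contractivity, which therefore passes to the limit \<open>\<pi>\<close>, as does multiplicativity.

  Let \<open>\<rho>\<close> be a completely contractive dilation through the isometry \<open>V\<close>, and let \<open>R\<^sub>j = \<rho> z\<^sub>j\<close>, a contraction. If
  \<open>T\<^sub>j\<close> attains its norm at \<open>x\<close>, then \<open>R\<^sub>j V x = V T\<^sub>j x\<close>; this applies to \<open>e\<^sub>4\<close> and to \<open>m\<^sub>j = T\<^sub>j e\<^sub>4\<close>. The matrix
  \<open>R\<^sub>i V m\<^sub>j = R\<^sub>i R\<^sub>j V e\<^sub>4\<close> is symmetric with constant diagonal \<open>V e\<^sub>1\<close>, and its rows sum to \<open>0\<close> since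
  \<open>u\<^sub>1 + u\<^sub>2 + u\<^sub>3 = 0\<close>, so its other entries are \<open>- V e\<^sub>1 / 2\<close>. Hence \<open>R\<^sub>i V e\<^sub>1 = R\<^sub>i R\<^sub>j V m\<^sub>j = - R\<^sub>j V e\<^sub>1 / 2\<close> for
  \<open>i \<noteq> j\<close>, which forces \<open>R\<^sub>j V e\<^sub>1 = 0\<close>. So \<open>R\<^sub>j V = V T\<^sub>j\<close>, the same argument works for the adjoints, and
  dividing an arbitrary \<open>\<phi>\<close> three times extends this from the coordinates to \<open>\<phi>\<close>, as \<open>T\<close> is nilpotent of order three.
\<close>

section \<open>Positive semidefinite matrices\<close>

text \<open>Elements of the algebra need not be norm limits of polynomials, and a dilation \<rho> is
  not assumed continuous in any weaker topology, so its values on the coordinates do not settle the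
  rest by density. Division replaces such an argument: it is an identity inside the algebra, to
  which \<rho> applies term by term. As \<rho> may fail to be unital, the image of the constant 1 is
  treated as one more contraction. The Agler inequality speaks about points, but the nilpotent tuple
  T has 0 as its only joint eigenvalue; hence the approximation. Its origin is the group Z/4:
  conjugated by diag(d^2, d, d, 1), \<open>shift_mat u d j\<close> becomes d / (1 + d^2) times
  \<open>u j $ 1\<close> P + \<open>u j $ 2\<close> P^-1 with P a cyclic shift of four basis
  vectors. So the matrices commute, and the characters of Z/4 give their eigenvectors. The
  transposition comes from the order of the factors in the kernel condition: it bounds the block
  matrix of \<phi> with rows and columns exchanged. Transposing the operators as well turns this
  into the transpose of the whole matrix, which has the same norm.\<close>

lemma nonneg_Reals_mult_cnj: "z * cnj z \<in> \<real>\<^sub>\<ge>\<^sub>0"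
  by (simp add: complex_nonneg_Reals_iff)

definition psd :: "'i set \<Rightarrow> 'i cmatrix \<Rightarrow> bool" where
  "psd I K \<longleftrightarrow> (\<forall>h. (\<Sum>i\<in>I. \<Sum>j\<in>I. K i j * h j * cnj (h i)) \<in> \<real>\<^sub>\<ge>\<^sub>0)"

lemma psdI:
  assumes "\<And>h. (\<Sum>i\<in>I. \<Sum>j\<in>I. K i j * h j * cnj (h i)) \<in> \<real>\<^sub>\<ge>\<^sub>0"
  shows "psd I K"
  using assms by (simp add: psd_def)

lemma psdD: "psd I K \<Longrightarrow> (\<Sum>i\<in>I. \<Sum>j\<in>I. K i j * h j * cnj (h i)) \<in> \<real>\<^sub>\<ge>\<^sub>0"
  by (simp add: psd_def)

lemma psd_cong:
  assumes "psd I K" "\<And>i j. i \<in> I \<Longrightarrow> j \<in> I \<Longrightarrow> K i j = L i j"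
  shows "psd I L"
proof (rule psdI)
  fix h
  have "(\<Sum>i\<in>I. \<Sum>j\<in>I. L i j * h j * cnj (h i)) = (\<Sum>i\<in>I. \<Sum>j\<in>I. K i j * h j * cnj (h i))"
    by (intro sum.cong) (simp_all add: assms(2))
  then show "(\<Sum>i\<in>I. \<Sum>j\<in>I. L i j * h j * cnj (h i)) \<in> \<real>\<^sub>\<ge>\<^sub>0"
    using psdD[OF assms(1)] by simp
qed

lemma psd_zero: "psd I (\<lambda>i j. 0)"
  by (simp add: psd_def)

lemma psd_add: "psd I K \<Longrightarrow> psd I L \<Longrightarrow> psd I (\<lambda>i j. K i j + L i j)"
  unfolding psd_def by (simp add: distrib_right sum.distrib)

lemma psd_sum: "(\<And>l. l \<in> A \<Longrightarrow> psd I (K l)) \<Longrightarrow> psd I (\<lambda>i j. \<Sum>l\<in>A. K l i j)"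
  by (induction A rule: infinite_finite_induct) (auto intro!: psd_zero psd_add)

lemma psd_scale:
  assumes "psd I K" "r \<in> \<real>\<^sub>\<ge>\<^sub>0"
  shows "psd I (\<lambda>i j. r * K i j)"
proof (rule psdI)
  fix h
  have "(\<Sum>i\<in>I. \<Sum>j\<in>I. r * K i j * h j * cnj (h i)) = r * (\<Sum>i\<in>I. \<Sum>j\<in>I. K i j * h j * cnj (h i))"
    by (simp add: sum_distrib_left mult.assoc)
  then show "(\<Sum>i\<in>I. \<Sum>j\<in>I. r * K i j * h j * cnj (h i)) \<in> \<real>\<^sub>\<ge>\<^sub>0"
    using psdD[OF assms(1)] assms(2) by simp
qed

lemma psd_congruence:
  assumes "psd I K"
  shows "psd I (\<lambda>i j. f i * cnj (f j) * K i j)"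
proof (rule psdI)
  fix h
  have "(\<Sum>i\<in>I. \<Sum>j\<in>I. f i * cnj (f j) * K i j * h j * cnj (h i)) =
        (\<Sum>i\<in>I. \<Sum>j\<in>I. K i j * (cnj (f j) * h j) * cnj (cnj (f i) * h i))"
    by (simp add: ac_simps)
  then show "(\<Sum>i\<in>I. \<Sum>j\<in>I. f i * cnj (f j) * K i j * h j * cnj (h i)) \<in> \<real>\<^sub>\<ge>\<^sub>0"
    using psdD[OF assms, of "\<lambda>j. cnj (f j) * h j"] by simp
qed

lemma psd_pullback:
  assumes "psd I K" "finite I" "finite J" "\<sigma> ` J \<subseteq> I"
  shows "psd J (\<lambda>i j. K (\<sigma> i) (\<sigma> j))"
proof (rule psdI)
  fix h
  \<comment> \<open>The map \<sigma> may identify indices, so coefficients with the same image are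
    added up.\<close>
  define H :: "'a \<Rightarrow> complex" where "H = (\<lambda>i. \<Sum>a\<in>{a\<in>J. \<sigma> a = i}. h a)"
  have row: "(\<Sum>j\<in>I. K i j * H j) = (\<Sum>b\<in>J. K i (\<sigma> b) * h b)" for i
  proof -
    have "(\<Sum>b\<in>J. K i (\<sigma> b) * h b) = (\<Sum>j\<in>I. \<Sum>b\<in>{b\<in>J. \<sigma> b = j}. K i (\<sigma> b) * h b)"
      by (rule sum.group[symmetric, OF assms(3,2,4)])
    also have "\<dots> = (\<Sum>j\<in>I. K i j * H j)"
      by (intro sum.cong) (auto simp: H_def sum_distrib_left)
    finally show ?thesis ..
  qed
  have "(\<Sum>i\<in>I. \<Sum>j\<in>I. K i j * H j * cnj (H i)) = (\<Sum>i\<in>I. (\<Sum>b\<in>J. K i (\<sigma> b) * h b) * cnj (H i))"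
    by (simp add: row[symmetric] sum_distrib_right)
  also have "\<dots> = (\<Sum>i\<in>I. \<Sum>a\<in>{a\<in>J. \<sigma> a = i}. (\<Sum>b\<in>J. K (\<sigma> a) (\<sigma> b) * h b) * cnj (h a))"
    by (intro sum.cong) (auto simp: H_def sum_distrib_left)
  also have "\<dots> = (\<Sum>a\<in>J. (\<Sum>b\<in>J. K (\<sigma> a) (\<sigma> b) * h b) * cnj (h a))"
    by (rule sum.group[OF assms(3,2,4)])
  also have "\<dots> = (\<Sum>a\<in>J. \<Sum>b\<in>J. K (\<sigma> a) (\<sigma> b) * h b * cnj (h a))"
    by (simp add: sum_distrib_right)
  finally show "(\<Sum>i\<in>J. \<Sum>j\<in>J. K (\<sigma> i) (\<sigma> j) * h j * cnj (h i)) \<in> \<real>\<^sub>\<ge>\<^sub>0"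
    using psdD[OF assms(1), of H] by simp
qed

lemma psd_rank_one: "psd I (\<lambda>i j. f i * cnj (f j))"
proof (rule psdI)
  fix h
  have "(\<Sum>i\<in>I. \<Sum>j\<in>I. f i * cnj (f j) * h j * cnj (h i)) =
        (\<Sum>i\<in>I. f i * cnj (h i)) * cnj (\<Sum>i\<in>I. f i * cnj (h i))"
    unfolding cnj_sum sum_product by (intro sum.cong) (auto simp: ac_simps)
  then show "(\<Sum>i\<in>I. \<Sum>j\<in>I. f i * cnj (f j) * h j * cnj (h i)) \<in> \<real>\<^sub>\<ge>\<^sub>0"
    using nonneg_Reals_mult_cnj[of "\<Sum>i\<in>I. f i * cnj (h i)"] by presburger
qed

lemma psd_limit:
  assumes "\<forall>\<^sub>F n in F. psd I (K n)" "F \<noteq> bot"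
    and "\<And>i j. i \<in> I \<Longrightarrow> j \<in> I \<Longrightarrow> ((\<lambda>n. K n i j) \<longlongrightarrow> L i j) F"
  shows "psd I L"
proof (rule psdI)
  fix h
  have "((\<lambda>n. \<Sum>i\<in>I. \<Sum>j\<in>I. K n i j * h j * cnj (h i)) \<longlongrightarrow> (\<Sum>i\<in>I. \<Sum>j\<in>I. L i j * h j * cnj (h i))) F"
    by (intro tendsto_intros assms)
  moreover have "\<forall>\<^sub>F n in F. (\<Sum>i\<in>I. \<Sum>j\<in>I. K n i j * h j * cnj (h i)) \<in> \<real>\<^sub>\<ge>\<^sub>0"
    using assms(1) by eventually_elim (rule psdD)
  ultimately show "(\<Sum>i\<in>I. \<Sum>j\<in>I. L i j * h j * cnj (h i)) \<in> \<real>\<^sub>\<ge>\<^sub>0"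
    by (intro Lim_in_closed_set[OF closed_nonneg_Reals_complex _ assms(2)])
qed

lemma one_minus_mult_cnj_nonzero:
  assumes "cmod a < 1" "cmod b < 1"
  shows "1 - a * cnj b \<noteq> 0"
proof
  assume "1 - a * cnj b = 0"
  then have "cmod (a * cnj b) = 1"
    by simp
  moreover have "cmod (a * cnj b) < 1"
    using assms mult_strict_mono'[of "cmod a" 1 "cmod b" 1] by (simp add: norm_mult)
  ultimately show False
    by simp
qed

text \<open>Geometric series: every partial sum is a sum of rank-one matrices.\<close>

lemma psd_szego:
  assumes "\<And>i. i \<in> I \<Longrightarrow> cmod (z i) < 1"
  shows "psd I (\<lambda>i j. 1 / (1 - z i * cnj (z j)))"
proof (rule psd_limit[where F = sequentially and K = "\<lambda>N i j. \<Sum>n<N. z i ^ n * cnj (z j ^ n)"])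
  show "\<forall>\<^sub>F N in sequentially. psd I (\<lambda>i j. \<Sum>n<N. z i ^ n * cnj (z j ^ n))"
    by (intro always_eventually allI psd_sum psd_rank_one)
  fix i j assume "i \<in> I" "j \<in> I"
  then have "cmod (z i * cnj (z j)) < 1"
    using assms mult_strict_mono'[of "cmod (z i)" 1 "cmod (z j)" 1] by (simp add: norm_mult)
  from geometric_sums[OF this]
  show "(\<lambda>N. \<Sum>n<N. z i ^ n * cnj (z j ^ n)) \<longlonglongrightarrow> 1 / (1 - z i * cnj (z j))"
    by (simp add: sums_def power_mult_distrib)
qed simp

lemma psd_two_points:
  assumes "psd {False, True} K"
  shows "(cmod (K False True))\<^sup>2 \<le> Re (K False False) * Re (K True True)"
proof -
  have form: "K False False * a * cnj a + K False True * b * cnj a + K True False * a * cnj b + K True True * b * cnj b \<in> \<real>\<^sub>\<ge>\<^sub>0" for a b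
    using psdD[OF assms, of "\<lambda>i. if i then b else a"] by (simp add: add.assoc)
  have A: "Re (K False False) \<ge> 0" "Im (K False False) = 0"
    using form[of 1 0] by (simp_all add: complex_nonneg_Reals_iff)
  have B: "Re (K True True) \<ge> 0" "Im (K True True) = 0"
    using form[of 0 1] by (simp_all add: complex_nonneg_Reals_iff)
  have h: "K True False = cnj (K False True)"
    using form[of 1 1] form[of 1 \<i>] A B by (simp add: complex_nonneg_Reals_iff complex_eq_iff)
  define C where "C = K False True"
  \<comment> \<open>\<open>q t\<close> is the form at the vector (1, t * cnj C). This phase makes
    both cross terms real and leaves a real polynomial in t.\<close>
  define q where "q = (\<lambda>t. Re (K False False) + 2 * t * (cmod C)\<^sup>2 + t\<^sup>2 * (cmod C)\<^sup>2 * Re (K True True))"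
  have q: "q t \<ge> 0" for t
  proof -
    have "K False False * 1 * cnj 1 + C * (t * cnj C) * cnj 1 + cnj C * 1 * cnj (t * cnj C)
      + K True True * (t * cnj C) * cnj (t * cnj C) = of_real (q t)"
      unfolding q_def cmod_power2 using A B
      by (simp add: complex_eq_iff power2_eq_square algebra_simps)
    then show ?thesis
      using form[of 1 "t * cnj C"] h by (simp add: C_def)
  qed
  show ?thesis
  proof (cases "Re (K True True) = 0")
    case True
    have "C = 0"
    proof (rule ccontr)
      assume "C \<noteq> 0"
      \<comment> \<open>Here \<open>q\<close> is affine with non-zero slope, and at this t it takes
        the negative value - Re (K False False) - 2.\<close>
      then have "2 * (- (Re (K False False) + 1) / (cmod C)\<^sup>2) * (cmod C)\<^sup>2 = - 2 * (Re (K False False) + 1)"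
        by simp
      then show False
        using q[of "- (Re (K False False) + 1) / (cmod C)\<^sup>2"] A(1) True by (simp add: q_def)
    qed
    then show ?thesis
      using True by (simp add: C_def power2_eq_square)
  next
    case False
    then have pos: "Re (K True True) > 0"
      using B by simp
    \<comment> \<open>This t minimizes \<open>q\<close>.\<close>
    have "q (- 1 / Re (K True True)) = Re (K False False) - (cmod C)\<^sup>2 / Re (K True True)"
      using pos by (simp add: q_def power2_eq_square field_simps)
    then have "(cmod C)\<^sup>2 / Re (K True True) \<le> Re (K False False)"
      using q[of "- 1 / Re (K True True)"] by simp
    then show ?thesis
      using pos by (simp add: C_def field_simps)
  qed
qed

section \<open>The Agler inequality on finite families of points\<close>

lemma sum_Times: "sum g (A \<times> B) = (\<Sum>a\<in>A. \<Sum>b\<in>B. g (a, b))"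
  by (simp add: sum.cartesian_product)

lemma sum_swap_pairs:
  "(\<Sum>a\<in>A. \<Sum>b\<in>B. \<Sum>c\<in>C. \<Sum>d\<in>D. f a b c d) = (\<Sum>c\<in>C. \<Sum>d\<in>D. \<Sum>a\<in>A. \<Sum>b\<in>B. f a b c d)"
proof -
  have "(\<Sum>u\<in>A \<times> B. \<Sum>v\<in>C \<times> D. f (fst u) (snd u) (fst v) (snd v)) =
        (\<Sum>v\<in>C \<times> D. \<Sum>u\<in>A \<times> B. f (fst u) (snd u) (fst v) (snd v))"
    by (rule sum.swap)
  then show ?thesis
    by (simp only: sum_Times fst_conv snd_conv)
qed

definition admissible_gram :: "'i set \<Rightarrow> ('i \<Rightarrow> complex ^ 3) \<Rightarrow> 'i cmatrix \<Rightarrow> bool" where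
  "admissible_gram I x K \<longleftrightarrow> x ` I \<subseteq> tridisc \<and> psd I K \<and>
     (\<forall>j. psd I (\<lambda>i k. (1 - x i $ j * cnj (x k $ j)) * K i k))"

lemma admissible_gram_pullback:
  assumes "admissible_gram I x K" "finite I" "finite J" "\<sigma> ` J \<subseteq> I"
  shows "admissible_gram J (\<lambda>i. x (\<sigma> i)) (\<lambda>i k. K (\<sigma> i) (\<sigma> k))"
  using assms psd_pullback[of I _ J \<sigma>]
  unfolding admissible_gram_def by fastforce

text \<open>
  Points of a family may coincide, so a Gram matrix \<open>K\<close> need not come from a kernel. For a fixed
  vector \<open>a\<close>, summing the entries of \<open>K\<close> weighted by \<open>a\<close> over equal points gives one.
\<close>

definition grouped_kernel ::
  "'i set \<Rightarrow> ('i \<Rightarrow> complex ^ 3) \<Rightarrow> ('i \<Rightarrow> nat \<Rightarrow> complex) \<Rightarrow> 'i cmatrix \<Rightarrow>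
     complex ^ 3 \<Rightarrow> complex ^ 3 \<Rightarrow> nat cmatrix" where
  "grouped_kernel I x a K = (\<lambda>z w p q.
     \<Sum>i\<in>I. \<Sum>k\<in>I. if x i = z \<and> x k = w then K i k * a k q * cnj (a i p) else 0)"

text \<open>Testing the grouped kernel amounts to evaluating the form of K at one vector
  \<open>H\<close>, which collects all coefficients attached to an index.\<close>

lemma positive_grouped_kernel:
  assumes "psd I K"
  shows "positive_kernel {..<n} (grouped_kernel I x a K)"
  unfolding positive_kernel_def
proof (intro allI impI)
  fix m :: nat and y :: "nat \<Rightarrow> complex ^ 3" and h :: "nat \<Rightarrow> nat \<Rightarrow> complex"
  define A where "A = (\<lambda>k t q. if x k = y t then a k q * h t q else 0)"
  define H where "H = (\<lambda>k. \<Sum>t<m. \<Sum>q<n. A k t q)"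
  have "(\<Sum>s<m. \<Sum>t<m. \<Sum>p<n. (\<Sum>q<n. grouped_kernel I x a K (y s) (y t) p q * h t q) * cnj (h s p)) =
        (\<Sum>s<m. \<Sum>t<m. \<Sum>p<n. \<Sum>q<n. \<Sum>i\<in>I. \<Sum>k\<in>I. K i k * A k t q * cnj (A i s p))"
    unfolding grouped_kernel_def A_def sum_distrib_right by (intro sum.cong) auto
  also have "\<dots> = (\<Sum>s<m. \<Sum>t<m. \<Sum>i\<in>I. \<Sum>k\<in>I. \<Sum>p<n. \<Sum>q<n. K i k * A k t q * cnj (A i s p))"
    by (intro sum.cong refl sum_swap_pairs)
  also have "\<dots> = (\<Sum>i\<in>I. \<Sum>k\<in>I. \<Sum>s<m. \<Sum>t<m. \<Sum>p<n. \<Sum>q<n. K i k * A k t q * cnj (A i s p))"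
    by (rule sum_swap_pairs)
  also have "\<dots> = (\<Sum>i\<in>I. \<Sum>k\<in>I. K i k * H k * cnj (H i))"
  proof (intro sum.cong refl)
    fix i k
    have "(\<Sum>s<m. \<Sum>t<m. \<Sum>p<n. \<Sum>q<n. K i k * A k t q * cnj (A i s p)) =
          (\<Sum>s<m. \<Sum>t<m. K i k * (\<Sum>q<n. A k t q) * cnj (\<Sum>p<n. A i s p))"
      unfolding cnj_sum sum_distrib_left sum_distrib_right by simp
    also have "\<dots> = (\<Sum>s<m. K i k * (\<Sum>t<m. \<Sum>q<n. A k t q) * cnj (\<Sum>p<n. A i s p))"
      by (simp only: sum_distrib_left sum_distrib_right)
    also have "\<dots> = K i k * H k * cnj (H i)"
      unfolding H_def cnj_sum by (simp only: sum_distrib_left)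
    finally show "(\<Sum>s<m. \<Sum>t<m. \<Sum>p<n. \<Sum>q<n. K i k * A k t q * cnj (A i s p)) = K i k * H k * cnj (H i)" .
  qed
  finally show "(\<Sum>s<m. \<Sum>t<m. \<Sum>p<n. (\<Sum>q<n. grouped_kernel I x a K (y s) (y t) p q * h t q) * cnj (h s p))
      \<in> \<real>\<^sub>\<ge>\<^sub>0"
    using psdD[OF assms, of H] by simp
qed

text \<open>The factor 1 - z_j cnj(w_j) depends on the two points only, so it can be moved inside
  the grouping.\<close>

lemma grouped_kernel_admissible:
  assumes "admissible_gram I x K"
  shows "grouped_kernel I x a K \<in> admissible_kernels n"
proof -
  have "(\<lambda>z w p q. (1 - z $ j * cnj (w $ j)) * grouped_kernel I x a K z w p q) =
        grouped_kernel I x a (\<lambda>i k. (1 - x i $ j * cnj (x k $ j)) * K i k)" for j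
    unfolding grouped_kernel_def sum_distrib_left by (intro ext sum.cong) auto
  then show ?thesis
    using assms by (simp add: admissible_kernels_def admissible_gram_def positive_grouped_kernel)
qed

text \<open>The bridge from kernels on the tridisc to finite Gram matrices, on which the later
  arguments rest. The kernel has to be matrix valued because the weights \<open>a\<close> couple the
  indices of the family with those of \<phi>.\<close>

lemma agler_bound_finite_family:
  assumes bound: "agler_bound n \<phi> c" and gram: "admissible_gram I x K" and fin: "finite I"
  shows "(\<Sum>i\<in>I. \<Sum>k\<in>I. \<Sum>p<n. \<Sum>q<n. ((if p = q then (complex_of_real c)\<^sup>2 else 0)
      - (\<Sum>l<n. \<phi> (x i) p l * cnj (\<phi> (x k) q l))) * (K i k * a k q * cnj (a i p))) \<in> \<real>\<^sub>\<ge>\<^sub>0"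
proof -
  define M where "M = (\<lambda>z w p q. (if p = q then (complex_of_real c)\<^sup>2 else 0)
      - (\<Sum>l<n. \<phi> z p l * cnj (\<phi> w q l)))"
  define G where "G = grouped_kernel I x a K"
  \<comment> \<open>Each distinct point is listed once; a repetition would count its group
    twice.\<close>
  obtain e where e: "bij_betw e {..<card (x ` I)} (x ` I)"
    using ex_bij_betw_nat_finite[of "x ` I"] fin by (auto simp: atLeast0LessThan)
  define m where "m = card (x ` I)"
  \<comment> \<open>The sum of e_p \<otimes> e_p over p. Testing with it turns the tensor product
    into the entrywise product.\<close>
  define h where "h = (\<lambda>(s::nat) (p::nat, r::nat). if p = r then 1 else 0 :: complex)"
  have "positive_kernel ({..<n} \<times> {..<n}) (\<lambda>z w. tensor (M z w) (G z w))"
    using bound grouped_kernel_admissible[OF gram] unfolding agler_bound_def M_def G_def by blast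
  moreover have "\<forall>s<m. e s \<in> tridisc"
    using e gram by (auto simp: bij_betw_def m_def admissible_gram_def)
  ultimately have pos: "(\<Sum>s<m. \<Sum>t<m. \<Sum>P\<in>{..<n} \<times> {..<n}.
      (\<Sum>Q\<in>{..<n} \<times> {..<n}. tensor (M (e s) (e t)) (G (e s) (e t)) P Q * h t Q) * cnj (h s P)) \<in> \<real>\<^sub>\<ge>\<^sub>0"
    unfolding positive_kernel_def by blast
  have diag: "(\<Sum>P\<in>{..<n} \<times> {..<n}.
      (\<Sum>Q\<in>{..<n} \<times> {..<n}. tensor A B P Q * h t Q) * cnj (h s P)) = (\<Sum>p<n. \<Sum>q<n. A p q * B p q)" for A B s t
  proof -
    have row: "(\<Sum>q<n. \<Sum>r'<n. A p q * B r r' * (if q = r' then 1 else 0)) = (\<Sum>q<n. A p q * B r q)" for p r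
      by (intro sum.cong refl) (simp add: if_distrib[of "\<lambda>y. _ * y"] cong: if_cong)
    have "(\<Sum>P\<in>{..<n} \<times> {..<n}. (\<Sum>Q\<in>{..<n} \<times> {..<n}. tensor A B P Q * h t Q) * cnj (h s P)) =
      (\<Sum>p<n. \<Sum>r<n. (\<Sum>q<n. \<Sum>r'<n. A p q * B r r' * (if q = r' then 1 else 0)) * cnj (if p = r then 1 else 0))"
      by (simp only: sum_Times tensor_def h_def split)
    also have "\<dots> = (\<Sum>p<n. \<Sum>r<n. if p = r then (\<Sum>q<n. A p q * B r q) else 0)"
      unfolding row by (intro sum.cong) auto
    also have "\<dots> = (\<Sum>p<n. \<Sum>q<n. A p q * B p q)"
      by simp
    finally show ?thesis .
  qed
  define F where "F = (\<lambda>z w i k. \<Sum>p<n. \<Sum>q<n. M z w p q * (K i k * a k q * cnj (a i p)))"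
  have "(\<Sum>s<m. \<Sum>t<m. \<Sum>p<n. \<Sum>q<n. M (e s) (e t) p q * G (e s) (e t) p q) =
        (\<Sum>s<m. \<Sum>t<m. \<Sum>i\<in>I. \<Sum>k\<in>I. if x i = e s \<and> x k = e t then F (e s) (e t) i k else 0)"
  proof (intro sum.cong refl)
    fix s t
    have "(\<Sum>p<n. \<Sum>q<n. M (e s) (e t) p q * G (e s) (e t) p q) = (\<Sum>p<n. \<Sum>q<n. \<Sum>i\<in>I. \<Sum>k\<in>I.
        if x i = e s \<and> x k = e t then M (e s) (e t) p q * (K i k * a k q * cnj (a i p)) else 0)"
      unfolding G_def grouped_kernel_def sum_distrib_left by (intro sum.cong) auto
    also have "\<dots> = (\<Sum>i\<in>I. \<Sum>k\<in>I. \<Sum>p<n. \<Sum>q<n.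
        if x i = e s \<and> x k = e t then M (e s) (e t) p q * (K i k * a k q * cnj (a i p)) else 0)"
      by (rule sum_swap_pairs)
    also have "\<dots> = (\<Sum>i\<in>I. \<Sum>k\<in>I. if x i = e s \<and> x k = e t then F (e s) (e t) i k else 0)"
      unfolding F_def by (intro sum.cong) auto
    finally show "(\<Sum>p<n. \<Sum>q<n. M (e s) (e t) p q * G (e s) (e t) p q) =
        (\<Sum>i\<in>I. \<Sum>k\<in>I. if x i = e s \<and> x k = e t then F (e s) (e t) i k else 0)" .
  qed
  also have "\<dots> = (\<Sum>i\<in>I. \<Sum>k\<in>I. \<Sum>s<m. \<Sum>t<m. if x i = e s \<and> x k = e t then F (e s) (e t) i k else 0)"
    by (rule sum_swap_pairs)
  also have "\<dots> = (\<Sum>i\<in>I. \<Sum>k\<in>I. F (x i) (x k) i k)"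
  proof (intro sum.cong refl)
    fix i k assume "i \<in> I" "k \<in> I"
    have "(\<Sum>s<m. \<Sum>t<m. if x i = e s \<and> x k = e t then F (e s) (e t) i k else 0) =
          (\<Sum>s<m. \<Sum>w\<in>x ` I. if x i = e s \<and> x k = w then F (e s) w i k else 0)"
      using e unfolding m_def by (intro sum.cong refl sum.reindex_bij_betw)
    also have "\<dots> = (\<Sum>z\<in>x ` I. \<Sum>w\<in>x ` I. if x i = z \<and> x k = w then F z w i k else 0)"
      using e unfolding m_def by (rule sum.reindex_bij_betw)
    also have "\<dots> = (\<Sum>z\<in>x ` I. if z = x i then (\<Sum>w\<in>x ` I. if w = x k then F z w i k else 0) else 0)"
      by (intro sum.cong refl) (auto intro!: sum.cong)
    also have "\<dots> = F (x i) (x k) i k"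
      using fin \<open>i \<in> I\<close> \<open>k \<in> I\<close> by (simp add: sum.delta)
    finally show "(\<Sum>s<m. \<Sum>t<m. if x i = e s \<and> x k = e t then F (e s) (e t) i k else 0) = F (x i) (x k) i k" .
  qed
  finally show ?thesis
    using pos unfolding diag F_def M_def by simp
qed

text \<open>The scalar condition over Gram matrices instead of kernels. The parameter X lets a
  quotient by a coordinate be estimated first where that coordinate is non-zero.\<close>

definition agler_ineq :: "(complex ^ 3) set \<Rightarrow> (complex ^ 3 \<Rightarrow> complex) \<Rightarrow> real \<Rightarrow> bool" where
  "agler_ineq X \<phi> c \<longleftrightarrow> 0 \<le> c \<and>
     (\<forall>(m::nat) x K. x ` {..<m} \<subseteq> X \<longrightarrow> admissible_gram {..<m} x K \<longrightarrow>
        psd {..<m} (\<lambda>i k. ((complex_of_real c)\<^sup>2 - \<phi> (x i) * cnj (\<phi> (x k))) * K i k))"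

lemma agler_ineq_nonneg: "agler_ineq X \<phi> c \<Longrightarrow> 0 \<le> c"
  by (simp add: agler_ineq_def)

lemma agler_ineqI:
  assumes "0 \<le> c"
    and "\<And>(m::nat) x K. x ` {..<m} \<subseteq> X \<Longrightarrow> admissible_gram {..<m} x K \<Longrightarrow>
        psd {..<m} (\<lambda>i k. ((complex_of_real c)\<^sup>2 - \<phi> (x i) * cnj (\<phi> (x k))) * K i k)"
  shows "agler_ineq X \<phi> c"
  using assms by (auto simp: agler_ineq_def)

text \<open>The definition fixes one index type, but later families are indexed by pairs and by
  booleans; an enumeration transfers the inequality to them.\<close>

lemma agler_ineqD:
  assumes "agler_ineq X \<phi> c" "finite I" "x ` I \<subseteq> X" "admissible_gram I x K"
  shows "psd I (\<lambda>i k. ((complex_of_real c)\<^sup>2 - \<phi> (x i) * cnj (\<phi> (x k))) * K i k)"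
proof -
  obtain e where e: "bij_betw e {..<card I} I"
    using ex_bij_betw_nat_finite[OF assms(2)] by (auto simp: atLeast0LessThan)
  have "admissible_gram {..<card I} (\<lambda>s. x (e s)) (\<lambda>s t. K (e s) (e t))"
    using e by (intro admissible_gram_pullback[OF assms(4,2)]) (auto simp: bij_betw_def)
  moreover have "(\<lambda>s. x (e s)) ` {..<card I} \<subseteq> X"
    using e assms(3) by (auto simp: bij_betw_def)
  ultimately have "psd {..<card I}
      (\<lambda>s t. ((complex_of_real c)\<^sup>2 - \<phi> (x (e s)) * cnj (\<phi> (x (e t)))) * K (e s) (e t))"
    using assms(1) by (simp add: agler_ineq_def)
  from psd_pullback[OF this _ assms(2), of "inv_into {..<card I} e"]
  have "psd I (\<lambda>i k. ((complex_of_real c)\<^sup>2 - \<phi> (x (e (inv_into {..<card I} e i)))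
      * cnj (\<phi> (x (e (inv_into {..<card I} e k))))) * K (e (inv_into {..<card I} e i)) (e (inv_into {..<card I} e k)))"
    using bij_betw_inv_into[OF e] by (auto simp: bij_betw_def)
  then show ?thesis
    by (rule psd_cong) (use e in \<open>simp add: bij_betw_inv_into_right\<close>)
qed

lemma agler_ineq_cong:
  assumes "agler_ineq X \<phi> c" "\<And>z. z \<in> X \<Longrightarrow> \<phi> z = \<psi> z"
  shows "agler_ineq X \<psi> c"
proof (rule agler_ineqI)
  fix m :: nat and x K assume x: "x ` {..<m} \<subseteq> X" and K: "admissible_gram {..<m} x K"
  show "psd {..<m} (\<lambda>i k. ((complex_of_real c)\<^sup>2 - \<psi> (x i) * cnj (\<psi> (x k))) * K i k)"
    by (rule psd_cong[OF agler_ineqD[OF assms(1) _ x K]]) (use x assms(2) in \<open>auto simp: image_subset_iff\<close>)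
qed (rule agler_ineq_nonneg[OF assms(1)])

text \<open>The other entries of the row contribute a positive term, which can be added back.\<close>

lemma agler_ineq_entry:
  assumes bound: "agler_bound n \<phi> c" and "p0 < n" "l0 < n"
  shows "agler_ineq tridisc (\<lambda>z. \<phi> z p0 l0) c"
proof (rule agler_ineqI)
  show "0 \<le> c"
    using bound by (simp add: agler_bound_def)
  fix m :: nat and x K assume K: "admissible_gram {..<m} x K"
  have row: "psd {..<m} (\<lambda>i k. ((complex_of_real c)\<^sup>2 - (\<Sum>l<n. \<phi> (x i) p0 l * cnj (\<phi> (x k) p0 l))) * K i k)"
  proof (rule psdI)
    fix h
    define N where "N = (\<lambda>i k p q. (if p = q then (complex_of_real c)\<^sup>2 else 0)
      - (\<Sum>l<n. \<phi> (x i) p l * cnj (\<phi> (x k) q l)))"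
    have "(\<Sum>p<n. \<Sum>q<n. N i k p q * (K i k * (if q = p0 then h k else 0) * cnj (if p = p0 then h i else 0))) =
          N i k p0 p0 * K i k * h k * cnj (h i)" for i k
    proof -
      have "(\<Sum>q<n. N i k p q * (K i k * (if q = p0 then h k else 0) * cnj (if p = p0 then h i else 0))) =
            (if p = p0 then N i k p0 p0 * K i k * h k * cnj (h i) else 0)" for p
        using \<open>p0 < n\<close> by (simp add: if_distrib[of "\<lambda>y. _ * y"] if_distrib[of "\<lambda>y. y * _"] cong: if_cong)
      then show ?thesis
        using \<open>p0 < n\<close> by simp
    qed
    then show "(\<Sum>i<m. \<Sum>k<m. ((complex_of_real c)\<^sup>2 - (\<Sum>l<n. \<phi> (x i) p0 l * cnj (\<phi> (x k) p0 l))) * K i k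
        * h k * cnj (h i)) \<in> \<real>\<^sub>\<ge>\<^sub>0"
      using agler_bound_finite_family[OF bound K, of "\<lambda>i p. if p = p0 then h i else 0"]
      by (simp add: N_def)
  qed
  have rest: "psd {..<m} (\<lambda>i k. \<Sum>l\<in>{..<n} - {l0}. \<phi> (x i) p0 l * cnj (\<phi> (x k) p0 l) * K i k)"
    using K by (intro psd_sum psd_congruence) (simp add: admissible_gram_def)
  show "psd {..<m} (\<lambda>i k. ((complex_of_real c)\<^sup>2 - \<phi> (x i) p0 l0 * cnj (\<phi> (x k) p0 l0)) * K i k)"
    by (rule psd_cong[OF psd_add[OF row rest]])
      (use \<open>l0 < n\<close> in \<open>simp add: sum.remove[of "{..<n}" l0] sum_distrib_left algebra_simps\<close>)
qed

lemma agler_bound_oneI: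
  assumes "agler_ineq tridisc \<phi> c"
  shows "agler_bound 1 (\<lambda>z p q. \<phi> z) c"
  unfolding agler_bound_def
proof (intro conjI ballI)
  show "0 \<le> c"
    by (rule agler_ineq_nonneg[OF assms])
  fix k :: "complex ^ 3 \<Rightarrow> complex ^ 3 \<Rightarrow> nat cmatrix" assume k: "k \<in> admissible_kernels 1"
  have psd: "psd {..<m} (\<lambda>i j. K (x i) (x j) 0 0)"
    if "positive_kernel {..<1} K" "x ` {..<m} \<subseteq> tridisc" for m :: nat and x and K :: "complex ^ 3 \<Rightarrow> complex ^ 3 \<Rightarrow> nat cmatrix"
  proof (rule psdI)
    fix h :: "nat \<Rightarrow> complex"
    show "(\<Sum>i<m. \<Sum>j<m. K (x i) (x j) 0 0 * h j * cnj (h i)) \<in> \<real>\<^sub>\<ge>\<^sub>0"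
      using that(1)[unfolded positive_kernel_def, rule_format, of m x "\<lambda>i p. h i"] that(2)
      by (simp add: image_subset_iff)
  qed
  show "positive_kernel ({..<1::nat} \<times> {..<1::nat}) (\<lambda>z w. tensor
           (\<lambda>p q. (if p = q then (complex_of_real c)\<^sup>2 else 0) - (\<Sum>l<1::nat. \<phi> z * cnj (\<phi> w))) (k z w))"
    unfolding positive_kernel_def
  proof (intro allI impI)
    fix m :: nat and x :: "nat \<Rightarrow> complex ^ 3" and h :: "nat \<Rightarrow> nat \<times> nat \<Rightarrow> complex"
    assume "\<forall>i<m. x i \<in> tridisc"
    then have x: "x ` {..<m} \<subseteq> tridisc"
      by auto
    have "admissible_gram {..<m} x (\<lambda>i j. k (x i) (x j) 0 0)"
      unfolding admissible_gram_def
    proof (intro conjI allI)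
      fix j
      show "psd {..<m} (\<lambda>i l. (1 - x i $ j * cnj (x l $ j)) * k (x i) (x l) 0 0)"
        using psd[of "\<lambda>z w p q. (1 - z $ j * cnj (w $ j)) * k z w p q" x m] k x
        by (simp add: admissible_kernels_def)
    qed (use psd[of k x m] k x in \<open>simp_all add: admissible_kernels_def\<close>)
    from psdD[OF agler_ineqD[OF assms finite_lessThan x this], of "\<lambda>i. h i (0, 0)"]
    show "(\<Sum>i<m. \<Sum>j<m. \<Sum>p\<in>{..<1} \<times> {..<1}. (\<Sum>q\<in>{..<1} \<times> {..<1}.
        tensor (\<lambda>p q. (if p = q then (complex_of_real c)\<^sup>2 else 0) - (\<Sum>l<1::nat. \<phi> (x i) * cnj (\<phi> (x j))))
          (k (x i) (x j)) p q * h j q) * cnj (h i p)) \<in> \<real>\<^sub>\<ge>\<^sub>0"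
      by (simp add: tensor_def lessThan_Suc sum.cartesian_product[symmetric])
  qed
qed

lemma H_inf_iff: "\<phi> \<in> H_inf \<longleftrightarrow> (\<exists>c. agler_ineq tridisc \<phi> c)"
proof
  assume "\<phi> \<in> H_inf"
  then obtain c where "agler_bound 1 (\<lambda>z p q. \<phi> z) c"
    by (auto simp: H_inf_def H_inf_mat_def)
  from agler_ineq_entry[OF this, of 0 0] show "\<exists>c. agler_ineq tridisc \<phi> c"
    by auto
next
  assume "\<exists>c. agler_ineq tridisc \<phi> c"
  then show "\<phi> \<in> H_inf"
    using agler_bound_oneI by (auto simp: H_inf_def H_inf_mat_def)
qed

text \<open>Parallelogram identity: the positive term of \<phi> - \<psi> is added to twice both
  inequalities. The constant is at least c + d, but membership only asks for some finite
  constant.\<close>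

lemma agler_ineq_add:
  assumes \<phi>: "agler_ineq X \<phi> c" and \<psi>: "agler_ineq X \<psi> d"
  shows "agler_ineq X (\<lambda>z. \<phi> z + \<psi> z) (sqrt (2 * (c\<^sup>2 + d\<^sup>2)))"
proof (rule agler_ineqI)
  fix m :: nat and x K assume x: "x ` {..<m} \<subseteq> X" and K: "admissible_gram {..<m} x K"
  have "psd {..<m} K"
    using K by (simp add: admissible_gram_def)
  then have "psd {..<m} (\<lambda>i k. (\<phi> (x i) - \<psi> (x i)) * cnj (\<phi> (x k) - \<psi> (x k)) * K i k)"
    by (rule psd_congruence)
  from psd_add[OF psd_scale[OF psd_add[OF agler_ineqD[OF \<phi> _ x K] agler_ineqD[OF \<psi> _ x K]], of 2] this]
  show "psd {..<m} (\<lambda>i k. ((complex_of_real (sqrt (2 * (c\<^sup>2 + d\<^sup>2))))\<^sup>2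
      - (\<phi> (x i) + \<psi> (x i)) * cnj (\<phi> (x k) + \<psi> (x k))) * K i k)"
    by (rule psd_cong, simp_all flip: of_real_power add: algebra_simps)
qed simp

text \<open>With primes for conjugates at the second point, c^2 d^2 - \<phi> \<psi> \<psi>' \<phi>'
  = d^2 (c^2 - \<phi> \<phi>') + \<phi> (d^2 - \<psi> \<psi>') \<phi>'.\<close>

lemma agler_ineq_mult:
  assumes \<phi>: "agler_ineq X \<phi> c" and \<psi>: "agler_ineq X \<psi> d"
  shows "agler_ineq X (\<lambda>z. \<phi> z * \<psi> z) (c * d)"
proof (rule agler_ineqI)
  show "0 \<le> c * d"
    using assms by (simp add: agler_ineq_nonneg)
  fix m :: nat and x K assume x: "x ` {..<m} \<subseteq> X" and K: "admissible_gram {..<m} x K"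
  have d: "(complex_of_real d)\<^sup>2 \<in> \<real>\<^sub>\<ge>\<^sub>0"
    by (simp flip: of_real_power)
  show "psd {..<m} (\<lambda>i k. ((complex_of_real (c * d))\<^sup>2 - \<phi> (x i) * \<psi> (x i) * cnj (\<phi> (x k) * \<psi> (x k))) * K i k)"
    by (rule psd_cong[OF psd_add[OF psd_scale[OF agler_ineqD[OF \<phi> _ x K] d]
          psd_congruence[OF agler_ineqD[OF \<psi> _ x K], of "\<lambda>i. \<phi> (x i)"]]])
      (simp_all add: algebra_simps power_mult_distrib)
qed

lemma agler_ineq_const: "agler_ineq X (\<lambda>z. a) (cmod a)"
  by (rule agler_ineqI) (simp_all add: complex_norm_square psd_zero flip: of_real_power)

lemma agler_ineq_coord: "agler_ineq X (\<lambda>z. z $ j) 1"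
  by (rule agler_ineqI) (simp_all add: admissible_gram_def)

section \<open>Closure properties of the algebra\<close>

lemma H_inf_cong: "\<phi> \<in> H_inf \<Longrightarrow> (\<And>z. z \<in> tridisc \<Longrightarrow> \<phi> z = \<psi> z) \<Longrightarrow> \<psi> \<in> H_inf"
  using agler_ineq_cong unfolding H_inf_iff by blast

lemma H_inf_add: "\<phi> \<in> H_inf \<Longrightarrow> \<psi> \<in> H_inf \<Longrightarrow> (\<lambda>z. \<phi> z + \<psi> z) \<in> H_inf"
  using agler_ineq_add unfolding H_inf_iff by blast

lemma H_inf_mult: "\<phi> \<in> H_inf \<Longrightarrow> \<psi> \<in> H_inf \<Longrightarrow> (\<lambda>z. \<phi> z * \<psi> z) \<in> H_inf"
  using agler_ineq_mult unfolding H_inf_iff by blast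

lemma H_inf_const: "(\<lambda>z. a) \<in> H_inf"
  using agler_ineq_const unfolding H_inf_iff by blast

lemma H_inf_coord: "(\<lambda>z. z $ j) \<in> H_inf"
  using agler_ineq_coord unfolding H_inf_iff by blast

section \<open>Division by a coordinate\<close>

definition upd :: "complex ^ 3 \<Rightarrow> 3 \<Rightarrow> complex \<Rightarrow> complex ^ 3" where
  "upd z j \<zeta> = (\<chi> i. if i = j then \<zeta> else z $ i)"

lemma upd_nth [simp]: "upd z j \<zeta> $ i = (if i = j then \<zeta> else z $ i)"
  by (simp add: upd_def)

lemma upd_upd_same [simp]: "upd (upd z j a) j b = upd z j b"
  by (simp add: upd_def vec_eq_iff)

lemma upd_self [simp]: "upd z j (z $ j) = z"
  by (simp add: vec_eq_iff)

lemma upd_commute: "i \<noteq> j \<Longrightarrow> upd (upd z i a) j b = upd (upd z j b) i a"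
  by (simp add: vec_eq_iff)

lemma upd_in_tridisc: "z \<in> tridisc \<Longrightarrow> cmod \<zeta> < 1 \<Longrightarrow> upd z j \<zeta> \<in> tridisc"
  by (simp add: tridisc_def)

lemma zero_in_tridisc [simp]: "0 \<in> tridisc"
  by (simp add: tridisc_def)

definition quot :: "3 \<Rightarrow> (complex ^ 3 \<Rightarrow> complex) \<Rightarrow> complex ^ 3 \<Rightarrow> complex" where
  "quot j \<phi> z = (if z $ j = 0 then deriv (\<lambda>\<zeta>. \<phi> (upd z j \<zeta>)) 0 else (\<phi> z - \<phi> (upd z j 0)) / z $ j)"

text \<open>The form of M is tested with coefficients that are constant along each fibre.\<close>

lemma psd_fibre_sum:
  assumes "psd (I \<times> B) M"
  shows "psd I (\<lambda>i k. \<Sum>s\<in>B. \<Sum>t\<in>B. M (i, s) (k, t))"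
proof (rule psdI)
  fix h
  have "(\<Sum>i\<in>I. \<Sum>k\<in>I. (\<Sum>s\<in>B. \<Sum>t\<in>B. M (i, s) (k, t)) * h k * cnj (h i)) =
        (\<Sum>i\<in>I. \<Sum>s\<in>B. \<Sum>k\<in>I. \<Sum>t\<in>B. M (i, s) (k, t) * h k * cnj (h i))"
    unfolding sum_distrib_right by (intro sum.cong refl sum.swap)
  then show "(\<Sum>i\<in>I. \<Sum>k\<in>I. (\<Sum>s\<in>B. \<Sum>t\<in>B. M (i, s) (k, t)) * h k * cnj (h i)) \<in> \<real>\<^sub>\<ge>\<^sub>0"
    using psdD[OF assms, of "\<lambda>(k, t). h k"] by (simp add: sum_Times)
qed

text \<open>
  Double every point \<open>x\<close> by its projection \<open>upd x j 0\<close>, and multiply the given Gram matrix by that of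
  the vectors \<open>(x $ j, 1)\<close> and \<open>(x $ j, -1)\<close>. The result is again admissible, and the combination of
  the two vectors with coefficients \<open>1 / (2 * x $ j)\<close> turns \<open>\<phi>\<close> into its difference quotient.
\<close>

lemma agler_ineq_quot_nonzero:
  assumes \<phi>: "agler_ineq tridisc \<phi> c"
  shows "agler_ineq {z \<in> tridisc. z $ j \<noteq> 0} (quot j \<phi>) (2 * c)"
proof (rule agler_ineqI)
  show "0 \<le> 2 * c"
    using agler_ineq_nonneg[OF \<phi>] by simp
  fix m :: nat and x K
  assume x: "x ` {..<m} \<subseteq> {z \<in> tridisc. z $ j \<noteq> 0}" and K: "admissible_gram {..<m} x K"
  define J where "J = {..<m} \<times> (UNIV :: bool set)"
  define y where "y = (\<lambda>(i, s). if s then x i else upd (x i) j 0)"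
  define z where "z = (\<lambda>i. x i $ j)"
  define \<sigma> :: "bool \<Rightarrow> complex" where "\<sigma> = (\<lambda>s. if s then 1 else -1)"
  define \<mu> where "\<mu> = (\<lambda>(i, s). if s then z i else 0)"
  define L where "L = (\<lambda>a b. (z (fst a) * cnj (z (fst b)) + \<sigma> (snd a) * cnj (\<sigma> (snd b))) * K (fst a) (fst b))"
  have pull: "psd J (\<lambda>a b. M (fst a) (fst b))" if "psd {..<m} M" for M
    using that by (rule psd_pullback) (auto simp: J_def)
  have psd_mult: "psd J (\<lambda>a b. (z (fst a) * cnj (z (fst b)) + \<sigma> (snd a) * cnj (\<sigma> (snd b))) * M (fst a) (fst b))"
    if "psd {..<m} M" for M
    using psd_add[OF psd_congruence[OF pull[OF that], of "\<lambda>a. z (fst a)"]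
        psd_congruence[OF pull[OF that], of "\<lambda>a. \<sigma> (snd a)"]]
    by (rule psd_cong) (simp add: algebra_simps)
  have K0: "psd {..<m} K" and Kj: "\<And>l. psd {..<m} (\<lambda>i k. (1 - x i $ l * cnj (x k $ l)) * K i k)"
    using K by (auto simp: admissible_gram_def)
  have "admissible_gram J y L"
    unfolding admissible_gram_def
  proof (intro conjI allI)
    show "y ` J \<subseteq> tridisc"
      using x by (auto simp: J_def y_def image_subset_iff intro!: upd_in_tridisc)
    show "psd J L"
      unfolding L_def by (rule psd_mult[OF K0])
    fix l
    show "psd J (\<lambda>a b. (1 - y a $ l * cnj (y b $ l)) * L a b)"
    proof (cases "l = j")
      case False
      show ?thesis
        by (rule psd_cong[OF psd_mult[OF Kj[of l]]]) (use False in \<open>auto simp: J_def y_def L_def split: if_splits\<close>)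
    next
      case True
      define M where "M = (\<lambda>(a :: nat \<times> bool) (b :: nat \<times> bool). (1 - z (fst a) * cnj (z (fst b))) * K (fst a) (fst b))"
      have M: "psd J M"
        unfolding M_def z_def by (rule pull[OF Kj[of j]])
      \<comment> \<open>The three terms add up to the wanted matrix for each of the four pairs of
        signs. The last one lives on the projected points only, where 1 - \<sigma> = 2; there it
        supplies the missing 2 z cnj(z').\<close>
      have "psd J (\<lambda>a b. \<mu> a * cnj (\<mu> b) * M a b + \<sigma> (snd a) * cnj (\<sigma> (snd b)) * M a b
          + 1 / 2 * (z (fst a) * (1 - \<sigma> (snd a)) * cnj (z (fst b) * (1 - \<sigma> (snd b))) * K (fst a) (fst b)))"
        by (intro psd_add psd_congruence M psd_scale psd_congruence[OF pull[OF K0]]) simp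
      then show ?thesis
        by (rule psd_cong)
          (auto simp: J_def M_def L_def y_def \<mu>_def \<sigma>_def z_def True algebra_simps split: if_splits)
    qed
  qed
  moreover have "finite J" "y ` J \<subseteq> tridisc"
    using calculation by (simp_all add: J_def admissible_gram_def)
  ultimately have "psd J (\<lambda>a b. ((complex_of_real c)\<^sup>2 - \<phi> (y a) * cnj (\<phi> (y b))) * L a b)"
    by (intro agler_ineqD[OF \<phi>])
  from psd_fibre_sum[OF psd_congruence[OF this, of "\<lambda>a. 1 / z (fst a)", unfolded J_def]]
  have *: "psd {..<m} (\<lambda>i k. \<Sum>s\<in>UNIV. \<Sum>t\<in>UNIV. 1 / z i * cnj (1 / z k) *
      (((complex_of_real c)\<^sup>2 - \<phi> (y (i, s)) * cnj (\<phi> (y (k, t)))) * L (i, s) (k, t)))"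
    by simp
  \<comment> \<open>The four pairs of signs contribute 4 c^2, which explains the bound 2 c. Besides
    the square of the quotient, the fibre sum also subtracts the square of \<phi> (x i) + \<phi>
    (upd (x i) j 0), so that positive term is added back.\<close>
  have **: "psd {..<m} (\<lambda>i k. (\<phi> (x i) + \<phi> (upd (x i) j 0)) * cnj (\<phi> (x k) + \<phi> (upd (x k) j 0)) * K i k)"
    by (rule psd_congruence[OF K0])
  show "psd {..<m} (\<lambda>i k. ((complex_of_real (2 * c))\<^sup>2 - quot j \<phi> (x i) * cnj (quot j \<phi> (x k))) * K i k)"
  proof (rule psd_cong[OF psd_add[OF * **]])
    fix i k assume "i \<in> {..<m}" "k \<in> {..<m}"
    then have nz: "z i \<noteq> 0" "z k \<noteq> 0"
      using x by (auto simp: z_def)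
    define p q p' q' where "p = \<phi> (x i)" "q = \<phi> (upd (x i) j 0)" "p' = \<phi> (x k)" "q' = \<phi> (upd (x k) j 0)"
    have "(\<Sum>s\<in>UNIV. \<Sum>t\<in>UNIV. 1 / z i * cnj (1 / z k) *
        (((complex_of_real c)\<^sup>2 - \<phi> (y (i, s)) * cnj (\<phi> (y (k, t)))) * L (i, s) (k, t)))
      + (p + q) * cnj (p' + q') * K i k =
      ((complex_of_real (2 * c))\<^sup>2 - (p - q) / z i * cnj ((p' - q') / z k)) * K i k"
      using nz
      by (simp add: UNIV_bool y_def L_def \<sigma>_def field_simps flip: p_q_p'_q'_def)
    then show "(\<Sum>s\<in>UNIV. \<Sum>t\<in>UNIV. 1 / z i * cnj (1 / z k) *
        (((complex_of_real c)\<^sup>2 - \<phi> (y (i, s)) * cnj (\<phi> (y (k, t)))) * L (i, s) (k, t)))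
      + (\<phi> (x i) + \<phi> (upd (x i) j 0)) * cnj (\<phi> (x k) + \<phi> (upd (x k) j 0)) * K i k =
      ((complex_of_real (2 * c))\<^sup>2 - quot j \<phi> (x i) * cnj (quot j \<phi> (x k))) * K i k"
      using nz by (simp add: quot_def z_def p_q_p'_q'_def)
  qed
qed

text \<open>A Schwarz-Pick estimate along a slice. The Gram matrix is the Szego kernel of a and b;
  the remaining coordinates agree at the two points, so their factors are non-negative constants.
  The claim is then read off from the 2x2 determinant.\<close>

lemma agler_ineq_pick:
  assumes \<psi>: "agler_ineq X \<psi> c"
    and X: "upd x j a \<in> X" "upd x j b \<in> X" and D: "x \<in> tridisc" "cmod a < 1" "cmod b < 1"
  shows "(cmod (\<psi> (upd x j a) - \<psi> (upd x j b)))\<^sup>2 * ((1 - (cmod a)\<^sup>2) * (1 - (cmod b)\<^sup>2)) \<le> c\<^sup>2 * (cmod (a - b))\<^sup>2"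
proof -
  define z where "z = (\<lambda>s. if s then b else a)"
  define y where "y = (\<lambda>s. upd x j (z s))"
  define K where "K = (\<lambda>s t. 1 / (1 - z s * cnj (z t)))"
  define A B where "A = \<psi> (upd x j a)" "B = \<psi> (upd x j b)"
  have z: "cmod (z s) < 1" for s
    using D by (simp add: z_def)
  have K: "psd {False, True} K"
    unfolding K_def by (rule psd_szego) (rule z)
  have "admissible_gram {False, True} y K"
    unfolding admissible_gram_def
  proof (intro conjI allI)
    show "y ` {False, True} \<subseteq> tridisc"
      using D z by (auto simp: y_def intro!: upd_in_tridisc)
    fix l
    show "psd {False, True} (\<lambda>s t. (1 - y s $ l * cnj (y t $ l)) * K s t)"
    proof (cases "l = j")
      case True
      have "(1 - y s $ l * cnj (y t $ l)) * K s t = 1 * cnj 1" for s t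
        using one_minus_mult_cnj_nonzero[OF z z] by (simp add: y_def K_def True)
      then show ?thesis
        by (simp only: psd_rank_one)
    next
      case False
      have "cmod (x $ l) < 1"
        using D by (simp add: tridisc_def)
      then have "(cmod (x $ l))\<^sup>2 \<le> 1"
        by (simp add: power_le_one)
      then have "complex_of_real (1 - (cmod (x $ l))\<^sup>2) \<in> \<real>\<^sub>\<ge>\<^sub>0"
        by (simp only: nonneg_Reals_of_real_iff)
      then have "1 - x $ l * cnj (x $ l) \<in> \<real>\<^sub>\<ge>\<^sub>0"
        by (simp only: of_real_diff of_real_1 complex_norm_square)
      from psd_scale[OF K this] show ?thesis
        using False by (simp add: y_def)
    qed
  qed (rule K)
  moreover have "y ` {False, True} \<subseteq> X"
    using X by (auto simp: y_def z_def)
  ultimately have P: "psd {False, True} (\<lambda>s t. ((complex_of_real c)\<^sup>2 - \<psi> (y s) * cnj (\<psi> (y t))) * K s t)"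
    by (intro agler_ineqD[OF \<psi>]) auto
  define n0 n1 where "n0 = 1 - (cmod a)\<^sup>2" "n1 = 1 - (cmod b)\<^sup>2"
  have n: "n0 > 0" "n1 > 0"
    using D by (simp_all add: n0_n1_def power_less_one_iff)
  have KA: "((complex_of_real c)\<^sup>2 - A * cnj A) / (1 - a * cnj a) = of_real ((c\<^sup>2 - (cmod A)\<^sup>2) / n0)"
    by (simp only: n0_n1_def of_real_divide of_real_diff of_real_1 of_real_power[of c 2] complex_norm_square)
  have KB: "((complex_of_real c)\<^sup>2 - B * cnj B) / (1 - b * cnj b) = of_real ((c\<^sup>2 - (cmod B)\<^sup>2) / n1)"
    by (simp only: n0_n1_def of_real_divide of_real_diff of_real_1 of_real_power[of c 2] complex_norm_square)
  have dA: "(cmod A)\<^sup>2 \<le> c\<^sup>2"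
  proof -
    have "((complex_of_real c)\<^sup>2 - A * cnj A) / (1 - a * cnj a) \<in> \<real>\<^sub>\<ge>\<^sub>0"
      using psdD[OF P, of "\<lambda>s. if s then 0 else 1"] by (simp add: y_def z_def K_def flip: A_B_def)
    then show ?thesis
      using n unfolding KA nonneg_Reals_of_real_iff by (simp add: zero_le_divide_iff)
  qed
  have dB: "(cmod B)\<^sup>2 \<le> c\<^sup>2"
  proof -
    have "((complex_of_real c)\<^sup>2 - B * cnj B) / (1 - b * cnj b) \<in> \<real>\<^sub>\<ge>\<^sub>0"
      using psdD[OF P, of "\<lambda>s. if s then 1 else 0"] by (simp add: y_def z_def K_def flip: A_B_def)
    then show ?thesis
      using n unfolding KB nonneg_Reals_of_real_iff by (simp add: zero_le_divide_iff)
  qed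
  define Q where "Q = (c\<^sup>2 - (cmod A)\<^sup>2) * (c\<^sup>2 - (cmod B)\<^sup>2)"
  define N where "N = (cmod (1 - a * cnj b))\<^sup>2"
  have det: "(cmod ((complex_of_real c)\<^sup>2 - A * cnj B))\<^sup>2 / N \<le> Q / (n0 * n1)"
  proof -
    have "(cmod (((complex_of_real c)\<^sup>2 - A * cnj B) / (1 - a * cnj b)))\<^sup>2 \<le>
        Re (((complex_of_real c)\<^sup>2 - A * cnj A) / (1 - a * cnj a)) * Re (((complex_of_real c)\<^sup>2 - B * cnj B) / (1 - b * cnj b))"
      using psd_two_points[OF P] by (simp add: y_def z_def K_def flip: A_B_def)
    then show ?thesis
      unfolding KA KB by (simp add: Q_def N_def norm_divide power_divide)
  qed
  \<comment> \<open>The classical identity behind the pseudohyperbolic distance; \<open>E\<close> is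
    its homogeneous form with c in place of 1.\<close>
  have N: "N = n0 * n1 + (cmod (a - b))\<^sup>2"
    unfolding N_def n0_n1_def cmod_power2 by (simp add: power2_eq_square algebra_simps)
  have E: "(cmod ((complex_of_real c)\<^sup>2 - A * cnj B))\<^sup>2 = Q + c\<^sup>2 * (cmod (A - B))\<^sup>2"
    unfolding Q_def cmod_power2 by (simp add: power2_eq_square algebra_simps)
  have n01: "n0 * n1 > 0"
    using n by simp
  then have "N > 0"
    unfolding N by (simp add: add_pos_nonneg)
  then have "(Q + c\<^sup>2 * (cmod (A - B))\<^sup>2) * (n0 * n1) \<le> Q * N"
    using det n01 by (simp add: E field_simps)
  then have "c\<^sup>2 * ((cmod (A - B))\<^sup>2 * (n0 * n1)) \<le> Q * (cmod (a - b))\<^sup>2"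
    by (simp add: N algebra_simps)
  moreover have "Q \<le> c\<^sup>2 * c\<^sup>2"
    unfolding Q_def using dA dB by (intro mult_mono) auto
  ultimately have le: "c\<^sup>2 * ((cmod (A - B))\<^sup>2 * (n0 * n1)) \<le> c\<^sup>2 * (c\<^sup>2 * (cmod (a - b))\<^sup>2)"
    by (smt (verit) mult.assoc mult_right_mono zero_le_power2)
  show ?thesis
  \<comment> \<open>Both sides of \<open>le\<close> carry the factor c^2. When it cannot be
    cancelled, \<open>dA\<close> and \<open>dB\<close> force both values to be 0.\<close>
  proof (cases "c = 0")
    case True
    then show ?thesis
      using dA dB by (simp flip: A_B_def)
  next
    case False
    then have "(cmod (A - B))\<^sup>2 * (n0 * n1) \<le> c\<^sup>2 * (cmod (a - b))\<^sup>2"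
      using mult_le_cancel_left_pos[of "c\<^sup>2"] le by (metis zero_less_power2)
    then show ?thesis
      by (simp add: A_B_def n0_n1_def)
  qed
qed

section \<open>Analyticity in each coordinate\<close>

text \<open>The disc automorphisms move the statements at the origin to any other point.\<close>

definition disc_shift :: "complex \<Rightarrow> complex \<Rightarrow> complex" where
  "disc_shift w z = (z + w) / (1 + cnj w * z)"

lemma disc_shift_denominator:
  assumes "cmod w < 1" "cmod z < 1"
  shows "1 + cnj w * z \<noteq> 0"
  using one_minus_mult_cnj_nonzero[of "- z" w] assms by (simp add: mult.commute)

text \<open>A positive constant and a rank-one factor in front of 1 - a cnj(b): this shape lets a
  Gram matrix stay admissible, itself unchanged, when the points are shifted.\<close>

lemma disc_shift_kernel:
  assumes "cmod w < 1" "cmod a < 1" "cmod b < 1"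
  shows "1 - disc_shift w a * cnj (disc_shift w b) =
         of_real (1 - (cmod w)\<^sup>2) * ((1 / (1 + cnj w * a)) * cnj (1 / (1 + cnj w * b)) * (1 - a * cnj b))"
proof -
  have r: "complex_of_real (1 - (cmod w)\<^sup>2) = 1 - w * cnj w"
    by (simp only: of_real_diff of_real_1 complex_norm_square)
  have "1 + cnj w * a \<noteq> 0" "1 + w * cnj b \<noteq> 0"
    using disc_shift_denominator[OF assms(1,2)] disc_shift_denominator[OF assms(1,3)]
      complex_cnj_cancel_iff[of "1 + cnj w * b" 0] by simp_all
  then show ?thesis
    unfolding r by (simp add: disc_shift_def divide_simps) (simp add: algebra_simps)
qed

lemma norm_disc_shift:
  assumes "cmod w < 1" "cmod z < 1"
  shows "cmod (disc_shift w z) < 1"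
proof -
  have "complex_of_real (1 - (cmod (disc_shift w z))\<^sup>2) =
      of_real ((1 - (cmod w)\<^sup>2) * ((cmod (1 / (1 + cnj w * z)))\<^sup>2 * (1 - (cmod z)\<^sup>2)))"
    using disc_shift_kernel[OF assms(1,2,2)] by (simp only: of_real_mult of_real_diff complex_norm_square of_real_1)
  moreover have "(1 - (cmod w)\<^sup>2) * ((cmod (1 / (1 + cnj w * z)))\<^sup>2 * (1 - (cmod z)\<^sup>2)) > 0"
    using assms disc_shift_denominator[OF assms] by (intro mult_pos_pos) (auto simp: power_less_one_iff)
  ultimately have "1 - (cmod (disc_shift w z))\<^sup>2 > 0"
    by (simp only: of_real_eq_iff)
  then show ?thesis
    by (simp add: power_less_one_iff)
qed

lemma disc_shift_inverse:
  assumes "cmod w < 1" "cmod z < 1"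
  shows "disc_shift w (disc_shift (- w) z) = z"
proof -
  have w: "1 - w * cnj w \<noteq> 0"
    using one_minus_mult_cnj_nonzero assms(1) by blast
  have "1 - cnj w * z \<noteq> 0"
    using disc_shift_denominator[of "- w" z] assms by simp
  then have "disc_shift w (disc_shift (- w) z) = (z * (1 - w * cnj w)) / (1 - w * cnj w)"
    by (simp add: disc_shift_def divide_simps) (simp add: algebra_simps)
  then show ?thesis
    using w by simp
qed

lemma admissible_gram_disc_shift:
  assumes K: "admissible_gram I x K" and w: "cmod w < 1"
  shows "admissible_gram I (\<lambda>i. upd (x i) j (disc_shift w (x i $ j))) K"
  unfolding admissible_gram_def
proof (intro conjI allI)
  have x: "x i \<in> tridisc" if "i \<in> I" for i
    using that K by (auto simp: admissible_gram_def)
  then have lt: "cmod (x i $ j) < 1" if "i \<in> I" for i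
    using that by (simp add: tridisc_def)
  show "(\<lambda>i. upd (x i) j (disc_shift w (x i $ j))) ` I \<subseteq> tridisc"
    using x lt w by (auto intro!: upd_in_tridisc norm_disc_shift)
  show "psd I K"
    using K by (simp add: admissible_gram_def)
  have Kl: "psd I (\<lambda>i k. (1 - x i $ l * cnj (x k $ l)) * K i k)" for l
    using K by (simp add: admissible_gram_def)
  have r: "complex_of_real (1 - (cmod w)\<^sup>2) \<in> \<real>\<^sub>\<ge>\<^sub>0"
    using w by (simp only: nonneg_Reals_of_real_iff) (simp add: power_le_one)
  fix l
  show "psd I (\<lambda>i k. (1 - upd (x i) j (disc_shift w (x i $ j)) $ l
      * cnj (upd (x k) j (disc_shift w (x k $ j)) $ l)) * K i k)"
  proof (cases "l = j")
    case False
    then show ?thesis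
      using Kl by simp
  next
    case True
    show ?thesis
      by (rule psd_cong[OF psd_scale[OF psd_congruence[OF Kl[of j], of "\<lambda>i. 1 / (1 + cnj w * x i $ j)"] r]])
        (simp only: True upd_nth refl if_True disc_shift_kernel[OF w lt lt] mult.assoc)
  qed
qed

lemma agler_ineq_disc_shift:
  assumes \<phi>: "agler_ineq tridisc \<phi> c" and w: "cmod w < 1"
  shows "agler_ineq tridisc (\<lambda>z. \<phi> (upd z j (disc_shift w (z $ j)))) c"
proof (rule agler_ineqI)
  fix m :: nat and x K assume "admissible_gram {..<m} x K"
  then have K: "admissible_gram {..<m} (\<lambda>i. upd (x i) j (disc_shift w (x i $ j))) K"
    using w by (rule admissible_gram_disc_shift)
  show "psd {..<m} (\<lambda>i k. ((complex_of_real c)\<^sup>2 - \<phi> (upd (x i) j (disc_shift w (x i $ j)))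
      * cnj (\<phi> (upd (x k) j (disc_shift w (x k $ j))))) * K i k)"
    by (rule agler_ineqD[OF \<phi> _ _ K]) (use K in \<open>auto simp: admissible_gram_def\<close>)
qed (rule agler_ineq_nonneg[OF \<phi>])

text \<open>The difference quotient satisfies the Agler inequality away from 0, so the Pick estimate
  makes it Lipschitz near 0. It therefore extends continuously to 0, and the value there is the
  derivative.\<close>

lemma slice_differentiable_at_0:
  assumes \<phi>: "agler_ineq tridisc \<phi> c" and x: "x \<in> tridisc"
  shows "(\<lambda>\<zeta>. \<phi> (upd x j \<zeta>)) field_differentiable at 0"
proof -
  define f where "f = (\<lambda>\<zeta>. \<phi> (upd x j \<zeta>))"
  define q where "q = (\<lambda>\<zeta>. (f \<zeta> - f 0) / \<zeta>)"
  define U where "U = ball 0 (1/2) - {0 :: complex}"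
  have c: "0 \<le> c"
    by (rule agler_ineq_nonneg[OF \<phi>])
  have "(4 * c)-lipschitz_on U q"
  proof (rule lipschitz_onI)
    fix a b assume ab: "a \<in> U" "b \<in> U"
    then have D: "cmod a < 1" "cmod b < 1"
      by (auto simp: U_def)
    have mem: "upd x j a \<in> {z \<in> tridisc. z $ j \<noteq> 0}" "upd x j b \<in> {z \<in> tridisc. z $ j \<noteq> 0}"
      using D x ab by (auto simp: U_def upd_in_tridisc)
    have "(cmod a)\<^sup>2 \<le> (1/2)\<^sup>2" "(cmod b)\<^sup>2 \<le> (1/2)\<^sup>2"
      using ab by (auto simp: U_def intro!: power_mono)
    \<comment> \<open>On the disc of radius 1/2 the Pick factor is at least 1/4; its square root
      turns the bound 2 c of the quotient into the Lipschitz constant 4 c.\<close>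
    then have n: "(1 - (cmod a)\<^sup>2) * (1 - (cmod b)\<^sup>2) \<ge> (1/2) * (1/2)"
      by (intro mult_mono) (auto simp: power2_eq_square)
    have "(cmod (q a - q b))\<^sup>2 * ((1/2) * (1/2)) \<le> (cmod (q a - q b))\<^sup>2 * ((1 - (cmod a)\<^sup>2) * (1 - (cmod b)\<^sup>2))"
      using n by (intro mult_left_mono) auto
    also have "\<dots> \<le> (2 * c)\<^sup>2 * (cmod (a - b))\<^sup>2"
      using agler_ineq_pick[OF agler_ineq_quot_nonzero[OF \<phi>] mem x D] ab
      by (simp add: quot_def q_def f_def U_def)
    finally have "(cmod (q a - q b))\<^sup>2 \<le> (4 * c * cmod (a - b))\<^sup>2"
      by (simp add: power_mult_distrib)
    then show "dist (q a) (q b) \<le> 4 * c * dist a b"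
      using c by (simp add: dist_norm power2_le_iff_abs_le)
  qed (use c in simp)
  from lipschitz_extend_closure[OF this] obtain g
    where g: "(4 * c)-lipschitz_on (closure U) g" "\<And>\<zeta>. \<zeta> \<in> U \<Longrightarrow> g \<zeta> = q \<zeta>"
    by blast
  have at_U: "at 0 within U = at (0 :: complex)"
    using at_within_open[of 0 "ball (0 :: complex) (1/2)"] by (simp add: U_def at_within_def)
  then have "0 islimpt U"
    by (metis at_neq_bot trivial_limit_within)
  then have "(g \<longlongrightarrow> g 0) (at 0 within closure U)"
    using lipschitz_on_continuous_on[OF g(1)] by (simp add: continuous_on closure_def)
  then have "(g \<longlongrightarrow> g 0) (at 0 within U)"
    by (rule tendsto_within_subset[OF _ closure_subset])
  moreover have "\<forall>\<^sub>F \<zeta> in at 0 within U. g \<zeta> = q \<zeta>"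
    using g(2) by (auto simp: eventually_at_filter)
  ultimately have "(q \<longlongrightarrow> g 0) (at 0)"
    unfolding at_U by (rule Lim_transform_eventually)
  then have "(f has_field_derivative g 0) (at 0)"
    by (simp add: q_def has_field_derivative_iff)
  then show ?thesis
    by (auto simp: f_def field_differentiable_def)
qed

text \<open>Replacing \<phi> by its shift moves w to 0; composition with the inverse shift recovers
  the slice.\<close>

lemma slice_holomorphic:
  assumes \<phi>: "agler_ineq tridisc \<phi> c" and x: "x \<in> tridisc"
  shows "(\<lambda>\<zeta>. \<phi> (upd x j \<zeta>)) holomorphic_on ball 0 1"
proof (subst holomorphic_on_open[OF open_ball], intro ballI)
  fix w :: complex assume "w \<in> ball 0 1"
  then have w: "cmod w < 1" and w': "cmod (- w) < 1"
    by simp_all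
  have dw: "1 + cnj (- w) * w \<noteq> 0"
    by (rule disc_shift_denominator[OF w' w])
  define f where "f = (\<lambda>\<zeta>. \<phi> (upd x j (disc_shift w \<zeta>)))"
  have "f field_differentiable at (disc_shift (- w) w)"
    using slice_differentiable_at_0[OF agler_ineq_disc_shift[OF \<phi> w, of j] x, of j]
    by (simp add: f_def disc_shift_def)
  moreover have "disc_shift (- w) field_differentiable at w"
    unfolding disc_shift_def using dw by (intro derivative_intros) auto
  ultimately have "(f \<circ> disc_shift (- w)) field_differentiable at w"
    by (intro field_differentiable_compose)
  then obtain D where "((f \<circ> disc_shift (- w)) has_field_derivative D) (at w)"
    by (auto simp: field_differentiable_def)
  then have "((\<lambda>\<zeta>. \<phi> (upd x j \<zeta>)) has_field_derivative D) (at w)"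
  proof (rule has_field_derivative_transform_within_open)
    show "w \<in> ball 0 1"
      by fact
    fix \<zeta> :: complex assume "\<zeta> \<in> ball 0 1"
    then show "(f \<circ> disc_shift (- w)) \<zeta> = \<phi> (upd x j \<zeta>)"
      using disc_shift_inverse[OF w, of \<zeta>] by (simp add: f_def)
  qed simp
  then show "\<exists>f'. ((\<lambda>\<zeta>. \<phi> (upd x j \<zeta>)) has_field_derivative f') (at w)"
    by blast
qed

text \<open>Written with \<zeta> - 0 to match \<open>pole_lemma_open\<close>, which makes the
  quotient holomorphic across 0.\<close>

lemma quot_slice:
  "quot j \<phi> (upd x j \<zeta>) =
     (if \<zeta> = 0 then deriv (\<lambda>\<zeta>. \<phi> (upd x j \<zeta>)) 0 else (\<phi> (upd x j \<zeta>) - \<phi> (upd x j 0)) / (\<zeta> - 0))"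
  by (simp add: quot_def)

text \<open>Points with vanishing j-th coordinate are pushed off the hyperplane by a small shift.
  The Gram matrix remains admissible for the shifted points, and the inequality survives the limit w
  \<rightarrow> 0 by continuity of the quotient along slices.\<close>

lemma agler_ineq_quot:
  assumes \<phi>: "agler_ineq tridisc \<phi> c"
  shows "agler_ineq tridisc (quot j \<phi>) (2 * c)"
proof (rule agler_ineqI)
  show "0 \<le> 2 * c"
    using agler_ineq_nonneg[OF \<phi>] by simp
  fix m :: nat and x K assume K: "admissible_gram {..<m} x K"
  then have x: "x i \<in> tridisc" if "i < m" for i
    using that by (auto simp: admissible_gram_def)
  define y where "y = (\<lambda>w i. upd (x i) j (disc_shift w (x i $ j)))"
  have K': "admissible_gram {..<m} (y w) K" if "cmod w < 1" for w
    unfolding y_def using K that by (rule admissible_gram_disc_shift)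
  have lim: "((\<lambda>w. quot j \<phi> (y w i)) \<longlongrightarrow> quot j \<phi> (x i)) (at 0)" if "i < m" for i
  proof -
    have "(\<lambda>\<zeta>. quot j \<phi> (upd (x i) j \<zeta>)) holomorphic_on ball 0 1"
      unfolding quot_slice by (rule pole_lemma_open[OF slice_holomorphic[OF \<phi> x[OF that]] open_ball])
    then have "continuous_on (ball 0 1) (\<lambda>\<zeta>. quot j \<phi> (upd (x i) j \<zeta>))"
      by (rule holomorphic_on_imp_continuous_on)
    moreover have "x i $ j \<in> ball 0 1"
      using x[OF that] by (simp add: tridisc_def)
    ultimately have "isCont (\<lambda>\<zeta>. quot j \<phi> (upd (x i) j \<zeta>)) (x i $ j)"
      using continuous_on_eq_continuous_at[OF open_ball] by blast
    moreover have "((\<lambda>w. disc_shift w (x i $ j)) \<longlongrightarrow> disc_shift 0 (x i $ j)) (at 0)"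
      unfolding disc_shift_def by (intro tendsto_intros) auto
    ultimately show ?thesis
      using isCont_tendsto_compose[of "x i $ j" "\<lambda>\<zeta>. quot j \<phi> (upd (x i) j \<zeta>)"]
      by (simp add: y_def disc_shift_def)
  qed
  show "psd {..<m} (\<lambda>i k. ((complex_of_real (2 * c))\<^sup>2 - quot j \<phi> (x i) * cnj (quot j \<phi> (x k))) * K i k)"
  proof (rule psd_limit[where F = "at 0"])
    \<comment> \<open>A shift by w sends x i $ j to 0 only for w = - x i $ j. The value 0 is exempt
      here, since w tends to 0 without reaching it.\<close>
    have "finite ((\<lambda>i. - x i $ j) ` {..<m})"
      by simp
    then have "open (- ((\<lambda>i. - x i $ j) ` {..<m} - {0}))"
      by (intro open_Compl finite_imp_closed finite_Diff)
    then have "\<forall>\<^sub>F w in at 0. w \<in> - ((\<lambda>i. - x i $ j) ` {..<m} - {0})"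
      by (intro eventually_at_in_open') auto
    moreover have "\<forall>\<^sub>F w in at 0. w \<in> ball (0 :: complex) 1 - {0}"
      by (intro eventually_at_in_open) auto
    ultimately show "\<forall>\<^sub>F w in at 0. psd {..<m} (\<lambda>i k.
        ((complex_of_real (2 * c))\<^sup>2 - quot j \<phi> (y w i) * cnj (quot j \<phi> (y w k))) * K i k)"
    proof eventually_elim
      case (elim w)
      then have w: "cmod w < 1"
        by simp
      have "disc_shift w (x i $ j) \<noteq> 0" if "i < m" for i
      proof -
        have "x i $ j + w \<noteq> 0"
          using elim that by (auto simp: add_eq_0_iff)
        moreover have "cmod (x i $ j) < 1"
          using x[OF that] by (simp add: tridisc_def)
        ultimately show ?thesis
          using disc_shift_denominator[OF w] by (simp add: disc_shift_def)
      qed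
      then have "y w ` {..<m} \<subseteq> {z \<in> tridisc. z $ j \<noteq> 0}"
        using K'[OF w] by (auto simp: admissible_gram_def y_def)
      then show ?case
        by (intro agler_ineqD[OF agler_ineq_quot_nonzero[OF \<phi>] _ _ K'[OF w]]) auto
    qed
  qed (auto intro!: tendsto_intros lim)
qed

lemma H_inf_quot: "\<phi> \<in> H_inf \<Longrightarrow> quot j \<phi> \<in> H_inf"
  using agler_ineq_quot unfolding H_inf_iff by blast

lemma H_inf_slice_holomorphic:
  "\<phi> \<in> H_inf \<Longrightarrow> x \<in> tridisc \<Longrightarrow> (\<lambda>\<zeta>. \<phi> (upd x j \<zeta>)) holomorphic_on ball 0 1"
  using slice_holomorphic unfolding H_inf_iff by blast

lemma quot_mult: "\<phi> z = \<phi> (upd z j 0) + z $ j * quot j \<phi> z"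
  using upd_self[of z j] by (cases "z $ j = 0") (simp_all add: quot_def)

lemma H_inf_diff: "\<phi> \<in> H_inf \<Longrightarrow> \<psi> \<in> H_inf \<Longrightarrow> (\<lambda>z. \<phi> z - \<psi> z) \<in> H_inf"
  using H_inf_add[of \<phi> "\<lambda>z. -1 * \<psi> z"] H_inf_mult[OF H_inf_const[of "-1"]] by simp

text \<open>The projection is the remainder of a division, hence a difference of two
  members.\<close>

lemma H_inf_upd_zero:
  assumes "\<phi> \<in> H_inf"
  shows "(\<lambda>z. \<phi> (upd z j 0)) \<in> H_inf"
proof -
  have "(\<lambda>z. \<phi> z - z $ j * quot j \<phi> z) \<in> H_inf"
    by (intro H_inf_diff H_inf_mult H_inf_coord H_inf_quot assms)
  then show ?thesis
    by (rule H_inf_cong) (metis add_diff_cancel_right' quot_mult)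
qed

section \<open>Gleason components and Taylor coefficients\<close>

text \<open>In the index type \<open>3\<close> the numeral \<open>3\<close> equals \<open>0\<close>, so its order is not that of the coordinates.\<close>

definition gleason :: "3 \<Rightarrow> (complex ^ 3 \<Rightarrow> complex) \<Rightarrow> complex ^ 3 \<Rightarrow> complex" where
  "gleason j \<phi> =
     (if j = 3 then quot 3 \<phi>
      else if j = 2 then quot 2 (\<lambda>z. \<phi> (upd z 3 0))
      else quot 1 (\<lambda>z. \<phi> (upd (upd z 2 0) 3 0)))"

lemma H_inf_gleason: "\<phi> \<in> H_inf \<Longrightarrow> gleason j \<phi> \<in> H_inf"
  unfolding gleason_def
  using H_inf_quot H_inf_upd_zero[of "\<lambda>z. \<phi> (upd z 3 0)" 2] H_inf_upd_zero[of \<phi> 3] by auto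

lemma upd_all_zero: "upd (upd (upd z 1 0) 2 0) 3 0 = 0"
  by (simp add: vec_eq_iff forall_3)

lemma gleason_decomposition: "\<phi> z = \<phi> 0 + (\<Sum>j\<in>UNIV. z $ j * gleason j \<phi> z)"
proof -
  have "\<phi> z = \<phi> (upd z 3 0) + z $ 3 * quot 3 \<phi> z"
    by (rule quot_mult)
  moreover have "\<phi> (upd z 3 0) = \<phi> (upd (upd z 2 0) 3 0) + z $ 2 * quot 2 (\<lambda>z. \<phi> (upd z 3 0)) z"
    by (rule quot_mult)
  moreover have "\<phi> (upd (upd z 2 0) 3 0) = \<phi> 0 + z $ 1 * quot 1 (\<lambda>z. \<phi> (upd (upd z 2 0) 3 0)) z"
    using quot_mult[of "\<lambda>z. \<phi> (upd (upd z 2 0) 3 0)" z 1] by (simp only: upd_all_zero)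
  ultimately show ?thesis
    by (simp add: sum_3 gleason_def)
qed

lemma quot_upd:
  assumes "i \<noteq> j"
  shows "quot i \<phi> (upd z j a) = quot i (\<lambda>z. \<phi> (upd z j a)) z"
  using assms by (simp add: quot_def upd_commute[OF assms])

lemma quot_independent:
  assumes "\<And>z. \<phi> (upd z i 0) = \<phi> z"
  shows "quot i \<phi> z = 0"
proof -
  have "(\<lambda>\<zeta>. \<phi> (upd z i \<zeta>)) = (\<lambda>\<zeta>. \<phi> (upd z i 0))"
    using assms by (metis upd_upd_same)
  then show ?thesis
    using assms by (simp add: quot_def)
qed

lemma upd_zero_idem: "upd (upd (upd z 2 0) 3 0) 2 0 = upd (upd z 2 0) 3 0"
  by (simp add: vec_eq_iff)

lemma gleason_2_upd: "gleason 2 \<phi> (upd z 3 0) = gleason 2 \<phi> z"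
  by (simp add: gleason_def quot_upd)

lemma gleason_1_upd: "gleason 1 \<phi> (upd z 3 0) = gleason 1 \<phi> z" "gleason 1 \<phi> (upd z 2 0) = gleason 1 \<phi> z"
  by (simp_all add: gleason_def quot_upd upd_commute[of 3 2] upd_zero_idem)

text \<open>\<open>gleason 2 \<phi>\<close> is independent of the third coordinate, and
  \<open>gleason 1 \<phi>\<close> of the second and third. So in the twofold expansion each mixed
  monomial occurs once, carrying its full Taylor coefficient.\<close>

lemma gleason_gleason_zero:
  "gleason 3 (gleason 2 \<phi>) z = 0" "gleason 3 (gleason 1 \<phi>) z = 0" "gleason 2 (gleason 1 \<phi>) z = 0"
  using quot_independent[of "gleason 2 \<phi>" 3] quot_independent[of "gleason 1 \<phi>" 3]
    quot_independent[of "gleason 1 \<phi>" 2]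
  by (simp_all add: gleason_2_upd gleason_1_upd gleason_def[of 3] gleason_def[of 2 "gleason 1 \<phi>"])

lemma higher_deriv_divided_difference:
  fixes f :: "complex \<Rightarrow> complex"
  assumes f: "f holomorphic_on ball 0 1"
  defines "q \<equiv> (\<lambda>\<zeta>. if \<zeta> = 0 then deriv f 0 else (f \<zeta> - f 0) / (\<zeta> - 0))"
  shows "(deriv ^^ Suc n) f 0 = of_nat (Suc n) * (deriv ^^ n) q 0"
proof -
  have q: "q holomorphic_on ball 0 1"
    unfolding q_def by (rule pole_lemma_open[OF f open_ball])
  have "f = (\<lambda>\<zeta>. f 0 + \<zeta> * q \<zeta>)"
    by (auto simp: q_def)
  then have "(deriv ^^ Suc n) f 0 = (deriv ^^ Suc n) (\<lambda>\<zeta>. f 0 + \<zeta> * q \<zeta>) 0"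
    by simp
  also have "\<dots> = (deriv ^^ Suc n) (\<lambda>\<zeta>. f 0) 0 + (deriv ^^ Suc n) (\<lambda>\<zeta>. \<zeta> * q \<zeta>) 0"
    by (rule higher_deriv_add[where S = "ball 0 1"]) (auto intro!: holomorphic_intros q)
  also have "(deriv ^^ Suc n) (\<lambda>\<zeta>. \<zeta> * q \<zeta>) 0 = (\<Sum>i = 0..Suc n.
      of_nat (Suc n choose i) * (deriv ^^ i) (\<lambda>\<zeta>. \<zeta>) 0 * (deriv ^^ (Suc n - i)) q 0)"
    by (rule higher_deriv_mult[where S = "ball 0 1"]) (auto intro!: holomorphic_intros q)
  \<comment> \<open>At 0 the identity function has only its first derivative non-zero.\<close>
  also have "\<dots> = (\<Sum>i\<in>{1}. of_nat (Suc n choose i) * (deriv ^^ i) (\<lambda>\<zeta>. \<zeta>) 0 * (deriv ^^ (Suc n - i)) q 0)"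
    by (rule sum.mono_neutral_right) auto
  finally show ?thesis
    by simp
qed

lemma funpow_closed: "x \<in> A \<Longrightarrow> (\<And>x. x \<in> A \<Longrightarrow> f x \<in> A) \<Longrightarrow> (f ^^ n) x \<in> A"
  by (induction n) auto

lemma higher_deriv_slice:
  assumes "\<phi> \<in> H_inf" "z \<in> tridisc"
  shows "(deriv ^^ n) (\<lambda>\<zeta>. \<phi> (upd z j \<zeta>)) 0 = fact n * ((quot j ^^ n) \<phi>) (upd z j 0)"
  using assms(1)
proof (induction n arbitrary: \<phi>)
  case (Suc n)
  have "(deriv ^^ Suc n) (\<lambda>\<zeta>. \<phi> (upd z j \<zeta>)) 0 =
      of_nat (Suc n) * (deriv ^^ n) (\<lambda>\<zeta>. quot j \<phi> (upd z j \<zeta>)) 0"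
    unfolding quot_slice
    by (rule higher_deriv_divided_difference[OF H_inf_slice_holomorphic[OF Suc.prems assms(2)]])
  also have "\<dots> = of_nat (Suc n) * (fact n * ((quot j ^^ n) (quot j \<phi>)) (upd z j 0))"
    by (simp only: Suc.IH[OF H_inf_quot[OF Suc.prems]])
  finally show ?case
    by (simp add: funpow_swap1 algebra_simps)
qed simp

text \<open>Nested derivatives become nested iterated quotients, the third coordinate innermost; the
  factorials cancel those of the Taylor coefficient.\<close>

lemma taylor_coeff_quot:
  assumes \<phi>: "\<phi> \<in> H_inf"
  shows "taylor_coeff \<phi> (a, b, c) =
    ((quot 1 ^^ a) (\<lambda>z. ((quot 2 ^^ b) (\<lambda>z. ((quot 3 ^^ c) \<phi>) (upd z 3 0))) (upd z 2 0))) 0"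
proof -
  define \<alpha> where "\<alpha> = (\<lambda>z. ((quot 3 ^^ c) \<phi>) (upd z 3 0))"
  define \<beta> where "\<beta> = (\<lambda>z. ((quot 2 ^^ b) \<alpha>) (upd z 2 0))"
  have \<alpha>: "\<alpha> \<in> H_inf"
    unfolding \<alpha>_def by (intro H_inf_upd_zero funpow_closed[OF \<phi>] H_inf_quot)
  have \<beta>: "\<beta> \<in> H_inf"
    unfolding \<beta>_def by (intro H_inf_upd_zero funpow_closed[OF \<alpha>] H_inf_quot)
  define v :: "complex \<Rightarrow> complex \<Rightarrow> complex ^ 3" where "v = (\<lambda>x y. vector [x, y, 0])"
  have v: "v x y \<in> tridisc" if "cmod x < 1" "cmod y < 1" for x y
    using that by (simp add: v_def tridisc_def forall_3)
  have v3: "vector [x, y, w] = upd (v x y) 3 w" for x y w :: complex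
    by (simp add: v_def vec_eq_iff forall_3)
  have v2: "v x y = upd (v x 0) 2 y" for x y
    by (simp add: v_def vec_eq_iff forall_3)
  have v1: "v x 0 = upd 0 1 x" for x
    by (simp add: v_def vec_eq_iff forall_3)
  have inner: "(deriv ^^ c) (\<lambda>w. \<phi> (vector [x, y, w])) 0 = fact c * \<alpha> (v x y)"
    if "cmod x < 1" "cmod y < 1" for x y
    unfolding v3 \<alpha>_def by (rule higher_deriv_slice[OF \<phi> v[OF that]])
  \<comment> \<open>The inner derivatives are computed only inside the disc. That is enough, as
    derivatives at 0 depend on germs.\<close>
  have ev: "\<forall>\<^sub>F y in nhds 0. cmod y < 1"
    using eventually_nhds_in_open[OF open_ball, of "0 :: complex" 0 1] by (simp add: dist_norm)
  have middle: "(deriv ^^ b) (\<lambda>y. (deriv ^^ c) (\<lambda>w. \<phi> (vector [x, y, w])) 0) 0 = fact b * fact c * \<beta> (v x 0)"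
    if x: "cmod x < 1" for x
  proof -
    have "(deriv ^^ b) (\<lambda>y. (deriv ^^ c) (\<lambda>w. \<phi> (vector [x, y, w])) 0) 0 =
          (deriv ^^ b) (\<lambda>y. fact c * \<alpha> (upd (v x 0) 2 y)) 0"
      using ev by (intro higher_deriv_cong_ev) (auto elim!: eventually_mono simp: inner[OF x] simp flip: v2)
    also have "\<dots> = fact c * (deriv ^^ b) (\<lambda>y. \<alpha> (upd (v x 0) 2 y)) 0"
      using H_inf_slice_holomorphic[OF \<alpha> v[OF x, of 0], of 2]
      by (intro higher_deriv_cmult[where A = "ball 0 1"]) auto
    also have "\<dots> = fact c * (fact b * \<beta> (v x 0))"
      unfolding \<beta>_def by (subst higher_deriv_slice[OF \<alpha> v[OF x]]) simp_all
    finally show ?thesis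
      by simp
  qed
  have "(deriv ^^ a) (\<lambda>x. (deriv ^^ b) (\<lambda>y. (deriv ^^ c) (\<lambda>w. \<phi> (vector [x, y, w])) 0) 0) 0 =
        (deriv ^^ a) (\<lambda>x. fact b * fact c * \<beta> (upd 0 1 x)) 0"
    using ev by (intro higher_deriv_cong_ev) (auto elim!: eventually_mono simp: middle simp flip: v1)
  also have "\<dots> = fact b * fact c * (deriv ^^ a) (\<lambda>x. \<beta> (upd 0 1 x)) 0"
    using H_inf_slice_holomorphic[OF \<beta> zero_in_tridisc, of 1]
    by (intro higher_deriv_cmult[where A = "ball 0 1"]) auto
  also have "\<dots> = fact b * fact c * (fact a * ((quot 1 ^^ a) \<beta>) (upd 0 1 0))"
    by (simp only: higher_deriv_slice[OF \<beta> zero_in_tridisc])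
  also have "upd 0 1 0 = 0"
    by (simp add: vec_eq_iff)
  finally show ?thesis
    by (simp add: taylor_coeff_def \<beta>_def \<alpha>_def)
qed

lemma taylor_coeff_gleason:
  assumes "\<phi> \<in> H_inf"
  shows "taylor_coeff \<phi> (0, 0, 0) = \<phi> 0"
    "taylor_coeff \<phi> (1, 0, 0) = gleason 1 \<phi> 0"
    "taylor_coeff \<phi> (0, 1, 0) = gleason 2 \<phi> 0"
    "taylor_coeff \<phi> (0, 0, 1) = gleason 3 \<phi> 0"
    "taylor_coeff \<phi> (2, 0, 0) = gleason 1 (gleason 1 \<phi>) 0"
    "taylor_coeff \<phi> (0, 2, 0) = gleason 2 (gleason 2 \<phi>) 0"
    "taylor_coeff \<phi> (0, 0, 2) = gleason 3 (gleason 3 \<phi>) 0"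
    "taylor_coeff \<phi> (1, 1, 0) = gleason 1 (gleason 2 \<phi>) 0"
    "taylor_coeff \<phi> (1, 0, 1) = gleason 1 (gleason 3 \<phi>) 0"
    "taylor_coeff \<phi> (0, 1, 1) = gleason 2 (gleason 3 \<phi>) 0"
proof -
  have upd0: "upd 0 j 0 = 0" for j
    by (simp add: vec_eq_iff)
  have g11: "gleason 1 (gleason 1 \<phi>) = quot 1 (gleason 1 \<phi>)"
    unfolding gleason_def[of 1 "gleason 1 \<phi>"] by (simp add: gleason_1_upd)
  have g22: "gleason 2 (gleason 2 \<phi>) = quot 2 (gleason 2 \<phi>)"
    unfolding gleason_def[of 2 "gleason 2 \<phi>"] by (simp add: gleason_2_upd)
  have g12: "gleason 1 (gleason 2 \<phi>) = quot 1 (\<lambda>z. gleason 2 \<phi> (upd z 2 0))"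
    unfolding gleason_def[of 1 "gleason 2 \<phi>"] by (simp add: gleason_2_upd)
  note [simp] = taylor_coeff_quot[OF assms] upd0 numeral_2_eq_2
  show "taylor_coeff \<phi> (0, 0, 0) = \<phi> 0" by simp
  show "taylor_coeff \<phi> (1, 0, 0) = gleason 1 \<phi> 0" by (simp add: gleason_def)
  show "taylor_coeff \<phi> (0, 1, 0) = gleason 2 \<phi> 0" by (simp add: gleason_def)
  show "taylor_coeff \<phi> (0, 0, 1) = gleason 3 \<phi> 0" by (simp add: gleason_def)
  show "taylor_coeff \<phi> (2, 0, 0) = gleason 1 (gleason 1 \<phi>) 0"
    unfolding g11 by (simp add: gleason_def)
  show "taylor_coeff \<phi> (0, 2, 0) = gleason 2 (gleason 2 \<phi>) 0"
    unfolding g22 by (simp add: gleason_def)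
  show "taylor_coeff \<phi> (0, 0, 2) = gleason 3 (gleason 3 \<phi>) 0" by (simp add: gleason_def)
  show "taylor_coeff \<phi> (1, 1, 0) = gleason 1 (gleason 2 \<phi>) 0"
    unfolding g12 by (simp add: gleason_def)
  show "taylor_coeff \<phi> (1, 0, 1) = gleason 1 (gleason 3 \<phi>) 0" by (simp add: gleason_def)
  show "taylor_coeff \<phi> (0, 1, 1) = gleason 2 (gleason 3 \<phi>) 0" by (simp add: gleason_def)
qed

section \<open>Approximation by diagonalizable tuples\<close>

lemma vector_4 [simp]:
  "(vector [x, y, z, w] :: 'a::zero ^ 4) $ 1 = x"
  "(vector [x, y, z, w] :: 'a::zero ^ 4) $ 2 = y"
  "(vector [x, y, z, w] :: 'a::zero ^ 4) $ 3 = z"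
  "(vector [x, y, z, w] :: 'a::zero ^ 4) $ 4 = w"
  unfolding vector_def by simp_all

lemma norm_power2_vec: "(norm (v :: complex ^ 'n))\<^sup>2 = (\<Sum>b\<in>UNIV. (cmod (v $ b))\<^sup>2)"
  by (simp add: norm_vec_def L2_set_def sum_nonneg)

lemma of_real_norm_power2_vec: "complex_of_real ((norm (v :: complex ^ 'n))\<^sup>2) = (\<Sum>b\<in>UNIV. v $ b * cnj (v $ b))"
  by (simp add: norm_power2_vec complex_norm_square flip: of_real_power)

lemma cmod_bilinear_le: "cmod (\<Sum>b\<in>UNIV. v $ b * w $ b) \<le> norm (v :: complex ^ 'n) * norm (w :: complex ^ 'n)"
proof -
  have "cmod (\<Sum>b\<in>UNIV. v $ b * w $ b) \<le> (\<Sum>b\<in>UNIV. \<bar>cmod (v $ b)\<bar> * \<bar>cmod (w $ b)\<bar>)"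
    by (rule sum_norm_le) (simp add: norm_mult)
  also have "\<dots> \<le> norm v * norm w"
    unfolding norm_vec_def by (rule L2_set_mult_ineq)
  finally show ?thesis .
qed

lemma tendsto_nth_nth:
  fixes A :: "'x \<Rightarrow> complex ^ 'n ^ 'm"
  assumes "(A \<longlongrightarrow> L) F"
  shows "((\<lambda>d. A d $ a $ b) \<longlongrightarrow> L $ a $ b) F"
  by (rule tendsto_vec_nth[OF tendsto_vec_nth[OF assms]])

lemma tendsto_matrix_mult:
  fixes A :: "'x \<Rightarrow> complex ^ 'n ^ 'm" and B :: "'x \<Rightarrow> complex ^ 'k ^ 'n"
  assumes "(A \<longlongrightarrow> L) F" "(B \<longlongrightarrow> M) F"
  shows "((\<lambda>d. A d ** B d) \<longlongrightarrow> L ** M) F"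
proof (rule vec_tendstoI, rule vec_tendstoI)
  fix a b
  have "((\<lambda>d. \<Sum>c\<in>UNIV. A d $ a $ c * B d $ c $ b) \<longlongrightarrow> (\<Sum>c\<in>UNIV. L $ a $ c * M $ c $ b)) F"
    by (intro tendsto_sum tendsto_mult tendsto_nth_nth assms)
  then show "((\<lambda>d. (A d ** B d) $ a $ b) \<longlongrightarrow> (L ** M) $ a $ b) F"
    by (simp add: matrix_matrix_mult_def)
qed

lemma tendsto_matrix_vector:
  fixes A :: "'x \<Rightarrow> complex ^ 'n ^ 'm"
  assumes "(A \<longlongrightarrow> L) F"
  shows "((\<lambda>d. A d *v x) \<longlongrightarrow> L *v x) F"
proof (rule vec_tendstoI)
  fix a
  have "((\<lambda>d. \<Sum>c\<in>UNIV. A d $ a $ c * x $ c) \<longlongrightarrow> (\<Sum>c\<in>UNIV. L $ a $ c * x $ c)) F"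
    by (intro tendsto_sum tendsto_mult_right tendsto_nth_nth assms)
  then show "((\<lambda>d. (A d *v x) $ a) \<longlongrightarrow> (L *v x) $ a) F"
    by (simp add: matrix_vector_mult_def)
qed

text \<open>Meant for the remainder of the third division, whose last factor is known to be bounded
  but not yet to converge.\<close>

lemma tendsto_zero_matrix_mult_bounded:
  fixes A :: "'x \<Rightarrow> complex ^ 'n ^ 'm" and B :: "'x \<Rightarrow> complex ^ 'k ^ 'n"
  assumes A: "(A \<longlongrightarrow> 0) F" and B: "\<forall>\<^sub>F d in F. \<forall>a b. cmod (B d $ a $ b) \<le> C"
  shows "((\<lambda>d. A d ** B d) \<longlongrightarrow> 0) F"
proof (intro vec_tendstoI)
  fix a b
  have "((\<lambda>d. \<Sum>c\<in>UNIV. A d $ a $ c * B d $ c $ b) \<longlongrightarrow> (\<Sum>c\<in>(UNIV :: 'n set). 0)) F"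
  proof (intro tendsto_sum)
    fix c
    have "((\<lambda>d. A d $ a $ c) \<longlongrightarrow> 0) F"
      using tendsto_nth_nth[OF A, of a c] by simp
    moreover have "Bfun (\<lambda>d. B d $ c $ b) F"
      using B by (intro BfunI[of _ C]) (auto elim: eventually_mono)
    ultimately show "((\<lambda>d. A d $ a $ c * B d $ c $ b) \<longlongrightarrow> 0) F"
      unfolding tendsto_Zfun_iff by (simp add: bounded_bilinear.Zfun_prod_Bfun[OF bounded_bilinear_mult])
  qed
  then show "((\<lambda>d. (A d ** B d) $ a $ b) \<longlongrightarrow> 0 $ a $ b) F"
    by (simp add: matrix_matrix_mult_def)
qed

lemma matrix_mult_sum_right: "A ** (\<Sum>i\<in>I. B i) = (\<Sum>i\<in>I. A ** (B i :: complex ^ 'k ^ 'n))"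
  by (induction I rule: infinite_finite_induct) (simp_all add: matrix_add_ldistrib)

section \<open>Contractivity of the nilpotent matrices\<close>

lemma T_mat_mult:
  "T_mat v *v x = vector
     [complex_of_real (v $ 1) * x $ 2 + complex_of_real (v $ 2) * x $ 3,
      complex_of_real (v $ 1) * x $ 4, complex_of_real (v $ 2) * x $ 4, 0]"
  unfolding vec_eq_iff forall_4 T_mat_def matrix_vector_mult_def sum_4 vec_lambda_beta vector_4 by simp

lemma T_mat_transpose_mult:
  "transpose (T_mat v) *v x = vector
     [0, complex_of_real (v $ 1) * x $ 1, complex_of_real (v $ 2) * x $ 1,
      complex_of_real (v $ 1) * x $ 2 + complex_of_real (v $ 2) * x $ 3]"
  unfolding vec_eq_iff forall_4 T_mat_def transpose_def matrix_vector_mult_def sum_4 vec_lambda_beta vector_4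
  by simp

lemma unit_vector_2:
  assumes "norm (v :: real ^ 2) = 1"
  shows "(v $ 1)\<^sup>2 + (v $ 2)\<^sup>2 = 1"
  using assms by (simp add: norm_vec_def L2_set_def sum_2)

text \<open>The row (a, b) is completed to an orthogonal matrix, which preserves the sum of
  squares.\<close>

lemma cmod_combination_le:
  assumes "a\<^sup>2 + b\<^sup>2 = (1 :: real)"
  shows "(cmod (of_real a * x + of_real b * y))\<^sup>2 \<le> (cmod x)\<^sup>2 + (cmod y)\<^sup>2"
proof -
  have "(cmod (of_real a * x + of_real b * y))\<^sup>2 + (cmod (of_real b * x - of_real a * y))\<^sup>2 =
      (a\<^sup>2 + b\<^sup>2) * ((cmod x)\<^sup>2 + (cmod y)\<^sup>2)"
    unfolding cmod_power2 by (simp add: power2_eq_square algebra_simps)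
  then show ?thesis
    using zero_le_power2[of "cmod (of_real b * x - of_real a * y)"] unfolding assms mult_1 by linarith
qed

lemma cmod_multiples:
  assumes "a\<^sup>2 + b\<^sup>2 = (1 :: real)"
  shows "(cmod (of_real a * x))\<^sup>2 + (cmod (of_real b * x))\<^sup>2 = (cmod x)\<^sup>2"
proof -
  have "(cmod (of_real a * x))\<^sup>2 + (cmod (of_real b * x))\<^sup>2 = (a\<^sup>2 + b\<^sup>2) * (cmod x)\<^sup>2"
    by (simp add: norm_mult power_mult_distrib distrib_right)
  then show ?thesis
    using assms by simp
qed

lemma norm_T_mat_mult_le:
  assumes "norm v = 1"
  shows "norm (T_mat v *v x) \<le> norm x"
proof -
  have "(norm (T_mat v *v x))\<^sup>2 \<le> (norm x)\<^sup>2"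
    using cmod_combination_le[OF unit_vector_2[OF assms], of "x $ 2" "x $ 3"]
      cmod_multiples[OF unit_vector_2[OF assms], of "x $ 4"]
      zero_le_power2[of "cmod (x $ 1)"]
    unfolding norm_power2_vec T_mat_mult sum_4 vector_4 norm_zero zero_power2 by linarith
  then show ?thesis
    by simp
qed

lemma norm_T_mat_transpose_mult_le:
  assumes "norm v = 1"
  shows "norm (transpose (T_mat v) *v x) \<le> norm x"
proof -
  have "(norm (transpose (T_mat v) *v x))\<^sup>2 \<le> (norm x)\<^sup>2"
    using cmod_combination_le[OF unit_vector_2[OF assms], of "x $ 2" "x $ 3"]
      cmod_multiples[OF unit_vector_2[OF assms], of "x $ 1"]
      zero_le_power2[of "cmod (x $ 4)"]
    unfolding norm_power2_vec T_mat_transpose_mult sum_4 vector_4 norm_zero zero_power2 by linarith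
  then show ?thesis
    by simp
qed

text \<open>
  For a fourth root of unity \<open>\<omega>\<close> the vector \<open>(\<omega>\<^sup>2d\<^sup>2, \<omega>d, \<omega>\<^sup>-\<^sup>1d, 1)\<close> is a joint eigenvector of the commuting
  contractions \<open>shift_mat u d j\<close>, which converge to the transposes of the \<open>T_mat (u j)\<close> as \<open>d\<close> tends
  to \<open>0\<close>. The rows \<open>dual_vec d k\<close> are the dual basis of these four eigenvectors.
\<close>

definition root4 :: "4 \<Rightarrow> complex" where
  "root4 k = (if k = 1 then 1 else if k = 2 then \<i> else if k = 3 then -1 else - \<i>)"

definition node :: "(3 \<Rightarrow> real ^ 2) \<Rightarrow> real \<Rightarrow> 4 \<Rightarrow> complex ^ 3" where
  "node u d k = (\<chi> j. (of_real (u j $ 1) * root4 k + of_real (u j $ 2) * cnj (root4 k)) * of_real d / (1 + (of_real d)\<^sup>2))"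

definition eig_vec :: "real \<Rightarrow> 4 \<Rightarrow> complex ^ 4" where
  "eig_vec d k = vector [(root4 k)\<^sup>2 * (of_real d)\<^sup>2, root4 k * of_real d, cnj (root4 k) * of_real d, 1]"

definition dual_vec :: "real \<Rightarrow> 4 \<Rightarrow> complex ^ 4" where
  "dual_vec d k = vector [(root4 k)\<^sup>2 / (4 * (of_real d)\<^sup>2), cnj (root4 k) / (4 * of_real d), root4 k / (4 * of_real d), 1 / 4]"

definition shift_mat :: "(3 \<Rightarrow> real ^ 2) \<Rightarrow> real \<Rightarrow> 3 \<Rightarrow> complex ^ 4 ^ 4" where
  "shift_mat u d j = (\<chi> a b. (transpose (T_mat (u j)) $ a $ b
     + (of_real d)\<^sup>2 * T_mat (vector [u j $ 2, u j $ 1]) $ a $ b) / (1 + (of_real d)\<^sup>2))"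

definition diag_mat :: "(3 \<Rightarrow> real ^ 2) \<Rightarrow> real \<Rightarrow> (complex ^ 3 \<Rightarrow> complex) \<Rightarrow> complex ^ 4 ^ 4" where
  "diag_mat u d \<phi> = (\<chi> a b. \<Sum>k\<in>UNIV. \<phi> (node u d k) * eig_vec d k $ a * dual_vec d k $ b)"

lemma root4_values: "root4 1 = 1" "root4 2 = \<i>" "root4 3 = -1" "root4 4 = - \<i>"
  by (simp_all add: root4_def)

text \<open>Orthogonality of the characters of Z/4; the powers of d cancel.\<close>

lemma dual_eig:
  assumes "d \<noteq> 0"
  shows "(\<Sum>b\<in>UNIV. dual_vec d k $ b * eig_vec d l $ b) = (if k = l then 1 else 0)"
proof -
  have "(\<Sum>b\<in>UNIV. dual_vec d k $ b * eig_vec d l $ b) =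
      ((root4 k)\<^sup>2 * (root4 l)\<^sup>2 + cnj (root4 k) * root4 l + root4 k * cnj (root4 l) + 1) / 4"
    using assms unfolding sum_4 dual_vec_def eig_vec_def vector_4 by (simp add: field_simps)
  also have "\<dots> = (if k = l then 1 else 0)"
    using exhaust_4[of k] exhaust_4[of l] by (elim disjE; simp only: root4_values) simp_all
  finally show ?thesis .
qed

lemma eig_dual:
  assumes "d \<noteq> 0"
  shows "(\<Sum>k\<in>UNIV. eig_vec d k $ a * dual_vec d k $ b) = (if a = b then 1 else 0)"
  using exhaust_4[of a] exhaust_4[of b] assms
  by (elim disjE; simp only: sum_4 dual_vec_def eig_vec_def vector_4 root4_values) simp_all

lemma norm_one_plus_square: "cmod (1 + (complex_of_real d)\<^sup>2) = 1 + d\<^sup>2"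
proof -
  have "1 + (complex_of_real d)\<^sup>2 = of_real (1 + d\<^sup>2)"
    by simp
  then show ?thesis
    by (simp only: norm_of_real) (simp add: abs_of_nonneg)
qed

lemma shift_mat_mult:
  "shift_mat u d j *v x = (1 / (1 + (of_real d)\<^sup>2)) *s
     (transpose (T_mat (u j)) *v x + (of_real d)\<^sup>2 *s (T_mat (vector [u j $ 2, u j $ 1]) *v x))"
  unfolding vec_eq_iff shift_mat_def matrix_vector_mult_def
  by (simp add: sum_distrib_left flip: sum.distrib) (auto intro!: sum.cong simp: add_divide_distrib distrib_right)

text \<open>Componentwise this uses \<omega>^4 = 1: the square of \<omega> is its own conjugate, and
  its cube is the conjugate of \<omega>. The second summand of \<open>shift_mat\<close> has swapped
  entries for exactly this reason.\<close>

lemma shift_mat_eig: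
  "shift_mat u d j *v eig_vec d k = node u d k $ j *s eig_vec d k"
proof -
  have "transpose (T_mat (u j)) *v eig_vec d k + (of_real d)\<^sup>2 *s (T_mat (vector [u j $ 2, u j $ 1]) *v eig_vec d k) =
    ((of_real (u j $ 1) * root4 k + of_real (u j $ 2) * cnj (root4 k)) * of_real d) *s eig_vec d k"
    using exhaust_4[of k]
    unfolding T_mat_mult T_mat_transpose_mult vec_eq_iff forall_4 eig_vec_def vector_4 vector_2
      vector_add_component vector_smult_component
    by (elim disjE; simp only: root4_values) (simp_all add: algebra_simps power2_eq_square)
  moreover have "node u d k $ j = 1 / (1 + (of_real d)\<^sup>2) *
      ((of_real (u j $ 1) * root4 k + of_real (u j $ 2) * cnj (root4 k)) * of_real d)"
    by (simp add: node_def)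
  ultimately show ?thesis
    unfolding shift_mat_mult by (simp only: vector_smult_assoc)
qed

text \<open>A convex combination, with weights 1 and d^2 over 1 + d^2, of two contractions.\<close>

lemma norm_shift_mat_le:
  assumes "norm (u j) = 1"
  shows "norm (shift_mat u d j *v x) \<le> norm x"
proof -
  have swap: "norm (vector [u j $ 2, u j $ 1] :: real ^ 2) = 1"
    using unit_vector_2[OF assms] by (simp add: norm_vec_def L2_set_def sum_2 add.commute)
  have smult: "norm (c *s v) = cmod c * norm v" for c and v :: "complex ^ 4"
    by (simp add: norm_vec_def L2_set_right_distrib norm_mult)
  have r: "1 + d\<^sup>2 > 0"
    by (simp add: add_pos_nonneg)
  define w where "w = transpose (T_mat (u j)) *v x + (of_real d)\<^sup>2 *s (T_mat (vector [u j $ 2, u j $ 1]) *v x)"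
  have "norm w \<le> norm x + d\<^sup>2 * norm x"
    unfolding w_def using norm_T_mat_mult_le[OF swap] norm_T_mat_transpose_mult_le[OF assms]
    by (intro norm_triangle_mono) (auto simp: smult norm_power intro!: mult_left_mono simp del: transpose_matrix_vector)
  then have "norm w / (1 + d\<^sup>2) \<le> norm x"
    using r by (simp add: pos_divide_le_eq distrib_left mult.commute)
  then show ?thesis
    unfolding shift_mat_mult smult w_def[symmetric] by (simp add: norm_divide norm_one_plus_square)
qed

lemma node_in_tridisc:
  assumes "\<And>j. norm (u j) = 1" "0 < d" "d < 1 / 2"
  shows "node u d k \<in> tridisc"
proof -
  have "cmod (node u d k $ j) < 1" for j
  proof -
    have root: "cmod (root4 k) = 1"
      by (simp add: root4_def)
    have "\<bar>u j $ i\<bar> \<le> 1" for i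
      using component_le_norm_cart[of "u j" i] assms(1)[of j] by simp
    then have "cmod (of_real (u j $ 1) * root4 k + of_real (u j $ 2) * cnj (root4 k)) \<le> 1 + 1"
      by (intro norm_triangle_mono) (simp_all add: norm_mult root)
    moreover have "1 + d\<^sup>2 > 0"
      by (simp add: add_pos_nonneg)
    ultimately have "cmod (node u d k $ j) \<le> 2 * d / (1 + d\<^sup>2)"
      using assms(2) by (simp add: node_def norm_mult norm_divide norm_one_plus_square divide_right_mono mult_right_mono)
    also have "\<dots> < 1"
    proof -
      have "2 * d < 1 + d\<^sup>2"
        using assms(3) zero_le_power2[of d] by linarith
      then show ?thesis
        using \<open>1 + d\<^sup>2 > 0\<close> by (simp add: pos_divide_less_eq)
    qed
    finally show ?thesis .
  qed
  then show ?thesis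
    by (simp add: tridisc_def)
qed

lemma gram_quadratic_form:
  "(\<Sum>i\<in>I. \<Sum>k\<in>I. (\<Sum>b\<in>B. f i b * cnj (f k b)) * h k * cnj (h i)) =
   (\<Sum>b\<in>B. (\<Sum>i\<in>I. cnj (h i) * f i b) * cnj (\<Sum>i\<in>I. cnj (h i) * f i b))"
proof -
  have "(\<Sum>b\<in>B. (\<Sum>i\<in>I. cnj (h i) * f i b) * cnj (\<Sum>i\<in>I. cnj (h i) * f i b)) =
      (\<Sum>b\<in>B. \<Sum>i\<in>I. \<Sum>k\<in>I. f i b * cnj (f k b) * h k * cnj (h i))"
    unfolding cnj_sum sum_product by (simp add: mult_ac)
  also have "\<dots> = (\<Sum>i\<in>I. \<Sum>b\<in>B. \<Sum>k\<in>I. f i b * cnj (f k b) * h k * cnj (h i))"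
    by (rule sum.swap)
  also have "\<dots> = (\<Sum>i\<in>I. \<Sum>k\<in>I. \<Sum>b\<in>B. f i b * cnj (f k b) * h k * cnj (h i))"
    by (intro sum.cong refl sum.swap)
  finally show ?thesis
    by (simp add: sum_distrib_right)
qed

text \<open>For v the sum of the cnj (h i) *s eig_vec d i, the quadratic form in question is the
  squared norm of v minus that of \<open>shift_mat u d j *v v\<close>, since the eigenvalues are the
  coordinates of the nodes.\<close>

lemma node_gram_admissible:
  assumes "\<And>j. norm (u j) = 1" "0 < d" "d < 1 / 2"
  shows "admissible_gram UNIV (node u d) (\<lambda>i k. \<Sum>b\<in>UNIV. eig_vec d i $ b * cnj (eig_vec d k $ b))"
  unfolding admissible_gram_def
proof (intro conjI allI)
  show "range (node u d) \<subseteq> tridisc"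
    using node_in_tridisc[of u d] assms by auto
  show "psd UNIV (\<lambda>i k. \<Sum>b\<in>UNIV. eig_vec d i $ b * cnj (eig_vec d k $ b))"
    by (intro psd_sum psd_rank_one)
  fix j
  show "psd UNIV (\<lambda>i k. (1 - node u d i $ j * cnj (node u d k $ j)) *
      (\<Sum>b\<in>UNIV. eig_vec d i $ b * cnj (eig_vec d k $ b)))"
  proof (rule psdI)
    fix h :: "4 \<Rightarrow> complex"
    define v where "v = (\<Sum>i\<in>UNIV. cnj (h i) *s eig_vec d i)"
    have Sv: "shift_mat u d j *v v = (\<Sum>i\<in>UNIV. cnj (h i) *s (node u d i $ j *s eig_vec d i))"
      unfolding v_def shift_mat_eig[symmetric]
      by (simp add: sum_4 matrix_vector_right_distrib vector_scalar_commute)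
    have "(\<Sum>i\<in>UNIV. \<Sum>k\<in>UNIV. (1 - node u d i $ j * cnj (node u d k $ j)) *
        (\<Sum>b\<in>UNIV. eig_vec d i $ b * cnj (eig_vec d k $ b)) * h k * cnj (h i)) =
        (\<Sum>i\<in>UNIV. \<Sum>k\<in>UNIV. (\<Sum>b\<in>UNIV. eig_vec d i $ b * cnj (eig_vec d k $ b)) * h k * cnj (h i)) -
        (\<Sum>i\<in>UNIV. \<Sum>k\<in>UNIV. (\<Sum>b\<in>UNIV. (node u d i $ j * eig_vec d i $ b) * cnj (node u d k $ j * eig_vec d k $ b)) * h k * cnj (h i))"
      unfolding sum_subtractf[symmetric]
      by (intro sum.cong refl) (simp add: sum_distrib_left sum_distrib_right algebra_simps sum_subtractf)
    also have "\<dots> = (\<Sum>b\<in>UNIV. v $ b * cnj (v $ b)) - (\<Sum>b\<in>UNIV. (shift_mat u d j *v v) $ b * cnj ((shift_mat u d j *v v) $ b))"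
      unfolding gram_quadratic_form Sv unfolding v_def by (simp add: mult.assoc)
    also have "\<dots> = complex_of_real ((norm v)\<^sup>2 - (norm (shift_mat u d j *v v))\<^sup>2)"
      unfolding of_real_diff of_real_norm_power2_vec ..
    also have "\<dots> \<in> \<real>\<^sub>\<ge>\<^sub>0"
      unfolding nonneg_Reals_of_real_iff using norm_shift_mat_le[OF assms(1)] by (simp add: power_mono)
    finally show "(\<Sum>i\<in>UNIV. \<Sum>k\<in>UNIV. (1 - node u d i $ j * cnj (node u d k $ j)) *
        (\<Sum>b\<in>UNIV. eig_vec d i $ b * cnj (eig_vec d k $ b)) * h k * cnj (h i)) \<in> \<real>\<^sub>\<ge>\<^sub>0" .
  qed
qed

text \<open>Expand every Y p in the eigenbasis and use the conjugated coefficients as weights in the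
  Agler inequality at the nodes. The constant part gives the right-hand side, the \<phi> part the
  left-hand side. The sum runs over the row index p, as the kernel condition contracts the columns
  of \<phi>.\<close>

lemma diag_mat_contractive:
  assumes u: "\<And>j. norm (u j) = 1" "0 < d" "d < 1 / 2" and bound: "agler_bound n \<phi> c"
  shows "(\<Sum>l<n. (norm (\<Sum>p<n. diag_mat u d (\<lambda>z. \<phi> z p l) *v Y p))\<^sup>2) \<le> c\<^sup>2 * (\<Sum>p<n. (norm (Y p))\<^sup>2)"
proof -
  define \<alpha> where "\<alpha> = (\<lambda>i p. \<Sum>b\<in>UNIV. dual_vec d i $ b * Y p $ b)"
  define x where "x = node u d"
  define g where "g = eig_vec d"
  define Z where "Z = (\<lambda>l. \<Sum>p<n. diag_mat u d (\<lambda>z. \<phi> z p l) *v Y p)"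
  have Y: "Y p $ b = (\<Sum>i\<in>UNIV. g i $ b * \<alpha> i p)" for p b
  proof -
    have "(\<Sum>i\<in>UNIV. g i $ b * \<alpha> i p) = (\<Sum>i\<in>UNIV. \<Sum>c\<in>UNIV. (g i $ b * dual_vec d i $ c) * Y p $ c)"
      by (simp add: \<alpha>_def sum_distrib_left mult.assoc)
    also have "\<dots> = (\<Sum>c\<in>UNIV. (\<Sum>i\<in>UNIV. g i $ b * dual_vec d i $ c) * Y p $ c)"
      by (subst sum.swap) (simp add: sum_distrib_right)
    also have "\<dots> = Y p $ b"
      using u(2) by (simp add: g_def eig_dual if_distrib[of "\<lambda>t. t * _"] cong: if_cong)
    finally show ?thesis ..
  qed
  have Z: "Z l $ b = (\<Sum>i\<in>UNIV. \<Sum>p<n. \<phi> (x i) p l * g i $ b * \<alpha> i p)" for l b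
  proof -
    have "(diag_mat u d \<psi> *v Y p) $ b = (\<Sum>i\<in>UNIV. \<psi> (x i) * g i $ b * \<alpha> i p)" for \<psi> p
    proof -
      have "(diag_mat u d \<psi> *v Y p) $ b = (\<Sum>c\<in>UNIV. \<Sum>i\<in>UNIV. \<psi> (x i) * g i $ b * (dual_vec d i $ c * Y p $ c))"
        by (simp add: matrix_vector_mult_def diag_mat_def x_def g_def sum_distrib_right mult.assoc)
      then show ?thesis
        by (subst (asm) sum.swap) (simp add: \<alpha>_def sum_distrib_left)
    qed
    then show ?thesis
      unfolding Z_def by (subst sum.swap) (simp add: sum_component)
  qed
  define W where "W = (\<lambda>i k p q. (\<Sum>l<n. \<phi> (x i) p l * cnj (\<phi> (x k) q l)) *
    ((\<Sum>b\<in>UNIV. g i $ b * cnj (g k $ b)) * cnj (\<alpha> k q) * \<alpha> i p))"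
  have W_sum: "W i k p q = (\<Sum>l<n. \<phi> (x i) p l * cnj (\<phi> (x k) q l)) *
    (\<Sum>b\<in>UNIV. g i $ b * cnj (g k $ b) * cnj (\<alpha> k q) * \<alpha> i p)" for i k p q
    by (simp only: W_def sum_distrib_right[symmetric])
  have "(\<Sum>i\<in>UNIV. \<Sum>k\<in>UNIV. \<Sum>p<n. \<Sum>q<n. W i k p q) = (\<Sum>i\<in>UNIV. \<Sum>p<n. \<Sum>k\<in>UNIV. \<Sum>q<n. W i k p q)"
    by (intro sum.cong refl sum.swap)
  also have "\<dots> = (\<Sum>i\<in>UNIV. \<Sum>p<n. \<Sum>k\<in>UNIV. \<Sum>q<n. \<Sum>l<n. \<Sum>b\<in>UNIV.
      (\<phi> (x i) p l * g i $ b * \<alpha> i p) * cnj (\<phi> (x k) q l * g k $ b * \<alpha> k q))"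
    unfolding W_sum sum_product by (intro sum.cong refl) (simp add: mult_ac)
  also have "\<dots> = (\<Sum>i\<in>UNIV. \<Sum>p<n. \<Sum>l<n. \<Sum>b\<in>UNIV. \<Sum>k\<in>UNIV. \<Sum>q<n.
      (\<phi> (x i) p l * g i $ b * \<alpha> i p) * cnj (\<phi> (x k) q l * g k $ b * \<alpha> k q))"
    by (intro sum.cong refl sum_swap_pairs)
  also have "\<dots> = (\<Sum>l<n. \<Sum>b\<in>UNIV. \<Sum>i\<in>UNIV. \<Sum>p<n. \<Sum>k\<in>UNIV. \<Sum>q<n.
      (\<phi> (x i) p l * g i $ b * \<alpha> i p) * cnj (\<phi> (x k) q l * g k $ b * \<alpha> k q))"
    by (rule sum_swap_pairs)
  also have "\<dots> = (\<Sum>l<n. \<Sum>b\<in>UNIV. Z l $ b * cnj (Z l $ b))"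
    unfolding Z cnj_sum by (simp only: sum_distrib_left[symmetric] sum_distrib_right[symmetric])
  also have "\<dots> = complex_of_real (\<Sum>l<n. (norm (Z l))\<^sup>2)"
    by (simp only: of_real_sum of_real_norm_power2_vec)
  finally have W: "(\<Sum>i\<in>UNIV. \<Sum>k\<in>UNIV. \<Sum>p<n. \<Sum>q<n. W i k p q) = complex_of_real (\<Sum>l<n. (norm (Z l))\<^sup>2)" .
  have row: "(\<Sum>q<n. (if p = q then C else 0) * X q) = C * X p" if "p \<in> {..<n}" for p C and X :: "nat \<Rightarrow> complex"
    using that by (simp add: if_distrib[of "\<lambda>t. t * _"] cong: if_cong)
  have "(\<Sum>i\<in>UNIV. \<Sum>k\<in>UNIV. \<Sum>p<n. \<Sum>q<n. (if p = q then (complex_of_real c)\<^sup>2 else 0) *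
      ((\<Sum>b\<in>UNIV. g i $ b * cnj (g k $ b)) * cnj (\<alpha> k q) * \<alpha> i p)) =
    (\<Sum>i\<in>UNIV. \<Sum>k\<in>UNIV. \<Sum>p<n. \<Sum>b\<in>UNIV. (complex_of_real c)\<^sup>2 * ((g i $ b * \<alpha> i p) * cnj (g k $ b * \<alpha> k p)))"
    by (intro sum.cong refl, subst row) (simp_all add: sum_distrib_left sum_distrib_right mult_ac)
  also have "\<dots> = (\<Sum>p<n. \<Sum>b\<in>UNIV. \<Sum>i\<in>UNIV. \<Sum>k\<in>UNIV. (complex_of_real c)\<^sup>2 * ((g i $ b * \<alpha> i p) * cnj (g k $ b * \<alpha> k p)))"
    by (rule sum_swap_pairs)
  also have "\<dots> = (\<Sum>p<n. \<Sum>b\<in>UNIV. (complex_of_real c)\<^sup>2 * (Y p $ b * cnj (Y p $ b)))"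
    unfolding Y cnj_sum sum_product by (simp only: sum_distrib_left)
  also have "\<dots> = complex_of_real (c\<^sup>2 * (\<Sum>p<n. (norm (Y p))\<^sup>2))"
    by (simp only: of_real_mult of_real_sum of_real_norm_power2_vec of_real_power[of c] sum_distrib_left)
  finally have diagonal: "(\<Sum>i\<in>UNIV. \<Sum>k\<in>UNIV. \<Sum>p<n. \<Sum>q<n. (if p = q then (complex_of_real c)\<^sup>2 else 0) *
      ((\<Sum>b\<in>UNIV. g i $ b * cnj (g k $ b)) * cnj (\<alpha> k q) * \<alpha> i p)) =
    complex_of_real (c\<^sup>2 * (\<Sum>p<n. (norm (Y p))\<^sup>2))" .
  have "(\<Sum>i\<in>UNIV. \<Sum>k\<in>UNIV. \<Sum>p<n. \<Sum>q<n. ((if p = q then (complex_of_real c)\<^sup>2 else 0)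
      - (\<Sum>l<n. \<phi> (x i) p l * cnj (\<phi> (x k) q l))) *
      ((\<Sum>b\<in>UNIV. g i $ b * cnj (g k $ b)) * cnj (\<alpha> k q) * cnj (cnj (\<alpha> i p)))) \<in> \<real>\<^sub>\<ge>\<^sub>0"
    using agler_bound_finite_family[OF bound node_gram_admissible[of u d, OF u] finite, of "\<lambda>k q. cnj (\<alpha> k q)"]
    by (simp only: x_def g_def)
  then have "complex_of_real (c\<^sup>2 * (\<Sum>p<n. (norm (Y p))\<^sup>2)) - complex_of_real (\<Sum>l<n. (norm (Z l))\<^sup>2) \<in> \<real>\<^sub>\<ge>\<^sub>0"
    unfolding left_diff_distrib sum_subtractf complex_cnj_cnj diagonal
    by (simp only: W[symmetric] W_def)
  then show ?thesis
    unfolding of_real_diff[symmetric] nonneg_Reals_of_real_iff by (simp add: Z_def)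
qed

section \<open>The limit representation\<close>

lemma shift_mat_mult_diag_mat:
  "shift_mat u d j ** diag_mat u d \<psi> = diag_mat u d (\<lambda>z. z $ j * \<psi> z)"
proof -
  have eig: "(\<Sum>c\<in>UNIV. shift_mat u d j $ a $ c * eig_vec d k $ c) = node u d k $ j * eig_vec d k $ a" for a k
    using arg_cong[OF shift_mat_eig[of u d j k], of "\<lambda>v. v $ a"] by (simp add: matrix_vector_mult_def)
  have "(shift_mat u d j ** diag_mat u d \<psi>) $ a $ b = diag_mat u d (\<lambda>z. z $ j * \<psi> z) $ a $ b" for a b
  proof -
    have "(shift_mat u d j ** diag_mat u d \<psi>) $ a $ b = (\<Sum>c\<in>UNIV. \<Sum>k\<in>UNIV.
        (shift_mat u d j $ a $ c * eig_vec d k $ c) * (\<psi> (node u d k) * dual_vec d k $ b))"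
      by (simp add: matrix_matrix_mult_def diag_mat_def sum_distrib_left mult_ac)
    also have "\<dots> = (\<Sum>k\<in>UNIV. (\<Sum>c\<in>UNIV. shift_mat u d j $ a $ c * eig_vec d k $ c) * (\<psi> (node u d k) * dual_vec d k $ b))"
      unfolding sum_distrib_right by (rule sum.swap)
    finally show ?thesis
      unfolding eig by (simp add: diag_mat_def mult_ac)
  qed
  then show ?thesis
    by (simp add: vec_eq_iff)
qed

lemma diag_mat_const:
  assumes "d \<noteq> 0"
  shows "diag_mat u d (\<lambda>z. c) = mat c"
proof -
  have "diag_mat u d (\<lambda>z. c) $ a $ b = c * (\<Sum>k\<in>UNIV. eig_vec d k $ a * dual_vec d k $ b)" for a b
    by (simp add: diag_mat_def sum_distrib_left mult.assoc)
  then show ?thesis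
    by (simp add: eig_dual[OF assms] vec_eq_iff mat_def)
qed

lemma diag_mat_add: "diag_mat u d (\<lambda>z. \<phi> z + \<psi> z) = diag_mat u d \<phi> + diag_mat u d \<psi>"
  by (simp add: diag_mat_def vec_eq_iff distrib_right sum.distrib)

lemma diag_mat_recursion:
  assumes "d \<noteq> 0"
  shows "diag_mat u d \<phi> = mat (\<phi> 0) + (\<Sum>j\<in>UNIV. shift_mat u d j ** diag_mat u d (gleason j \<phi>))"
proof -
  have "\<phi> = (\<lambda>z. \<phi> 0 + (z $ 1 * gleason 1 \<phi> z + (z $ 2 * gleason 2 \<phi> z + z $ 3 * gleason 3 \<phi> z)))"
    by (rule ext) (rule gleason_decomposition[unfolded sum_3 add.assoc])
  then have "diag_mat u d \<phi> = diag_mat u d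
      (\<lambda>z. \<phi> 0 + (z $ 1 * gleason 1 \<phi> z + (z $ 2 * gleason 2 \<phi> z + z $ 3 * gleason 3 \<phi> z)))"
    by (rule arg_cong)
  also have "\<dots> = mat (\<phi> 0) + (\<Sum>j\<in>UNIV. shift_mat u d j ** diag_mat u d (gleason j \<phi>))"
    unfolding diag_mat_add diag_mat_const[OF assms] shift_mat_mult_diag_mat[symmetric] sum_3 add.assoc ..
  finally show ?thesis .
qed

lemma diag_mat_mult:
  assumes "d \<noteq> 0"
  shows "diag_mat u d (\<lambda>z. \<phi> z * \<psi> z) = diag_mat u d \<phi> ** diag_mat u d \<psi>"
proof -
  have "(diag_mat u d \<phi> ** diag_mat u d \<psi>) $ a $ b = diag_mat u d (\<lambda>z. \<phi> z * \<psi> z) $ a $ b" for a b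
  proof -
    have "(diag_mat u d \<phi> ** diag_mat u d \<psi>) $ a $ b = (\<Sum>c\<in>UNIV. \<Sum>k\<in>UNIV. \<Sum>l\<in>UNIV.
        (\<phi> (node u d k) * eig_vec d k $ a * dual_vec d k $ c) * (\<psi> (node u d l) * eig_vec d l $ c * dual_vec d l $ b))"
      unfolding matrix_matrix_mult_def diag_mat_def by (simp add: sum_product)
    also have "\<dots> = (\<Sum>k\<in>UNIV. \<Sum>c\<in>UNIV. \<Sum>l\<in>UNIV.
        (\<phi> (node u d k) * eig_vec d k $ a * dual_vec d k $ c) * (\<psi> (node u d l) * eig_vec d l $ c * dual_vec d l $ b))"
      by (rule sum.swap)
    also have "\<dots> = (\<Sum>k\<in>UNIV. \<Sum>l\<in>UNIV. \<Sum>c\<in>UNIV.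
        (\<phi> (node u d k) * eig_vec d k $ a * dual_vec d k $ c) * (\<psi> (node u d l) * eig_vec d l $ c * dual_vec d l $ b))"
      by (intro sum.cong refl sum.swap)
    also have "\<dots> = (\<Sum>k\<in>UNIV. \<Sum>l\<in>UNIV. \<phi> (node u d k) * eig_vec d k $ a * \<psi> (node u d l) * dual_vec d l $ b *
        (\<Sum>c\<in>UNIV. dual_vec d k $ c * eig_vec d l $ c))"
      by (simp add: sum_distrib_left mult_ac)
    also have "\<dots> = diag_mat u d (\<lambda>z. \<phi> z * \<psi> z) $ a $ b"
      by (simp add: dual_eig[OF assms] diag_mat_def if_distrib[of "\<lambda>t. _ * t"] mult_ac cong: if_cong)
    finally show ?thesis .
  qed
  then show ?thesis
    by (simp add: vec_eq_iff)
qed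

lemma diag_mat_cong:
  assumes "\<And>j. norm (u j) = 1" "0 < d" "d < 1 / 2" "\<And>z. z \<in> tridisc \<Longrightarrow> \<phi> z = \<psi> z"
  shows "diag_mat u d \<phi> = diag_mat u d \<psi>"
  using assms(4)[OF node_in_tridisc[of u d, OF assms(1-3)]] by (simp add: diag_mat_def)

text \<open>Not visible from the entries, since \<open>dual_vec\<close> contains 1 / d^2; the
  uniform bound comes from contractivity.\<close>

lemma diag_mat_bounded:
  assumes "\<And>j. norm (u j) = 1" "\<phi> \<in> H_inf"
  shows "\<exists>C. \<forall>d. 0 < d \<longrightarrow> d < 1 / 2 \<longrightarrow> (\<forall>a b. cmod (diag_mat u d \<phi> $ a $ b) \<le> C)"
proof -
  obtain c where c: "agler_bound 1 (\<lambda>z p q. \<phi> z) c"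
    using assms(2) by (auto simp: H_inf_def H_inf_mat_def)
  have "cmod (diag_mat u d \<phi> $ a $ b) \<le> c" if d: "0 < d" "d < 1 / 2" for d a b
  proof -
    have "(norm (diag_mat u d \<phi> *v axis b 1))\<^sup>2 \<le> c\<^sup>2 * (norm (axis b 1 :: complex ^ 4))\<^sup>2"
      using diag_mat_contractive[of u d 1 "\<lambda>z p q. \<phi> z" c "\<lambda>p. axis b 1", OF assms(1) d c] by simp
    then have "norm (diag_mat u d \<phi> *v axis b 1) \<le> c"
      using c by (simp add: agler_bound_def power2_le_iff_abs_le)
    moreover have "(diag_mat u d \<phi> *v axis b 1) $ a = diag_mat u d \<phi> $ a $ b"
      by (simp add: matrix_vector_mult_def axis_def if_distrib[of "\<lambda>t. _ * t"] cong: if_cong)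
    ultimately show ?thesis
      using Finite_Cartesian_Product.norm_nth_le[of "diag_mat u d \<phi> *v axis b 1" a] by simp
  qed
  then show ?thesis
    by blast
qed

text \<open>The Taylor polynomial of degree two at the transposed tuple, its coefficients written as
  iterated Gleason components.\<close>

definition limit_mat :: "(3 \<Rightarrow> real ^ 2) \<Rightarrow> (complex ^ 3 \<Rightarrow> complex) \<Rightarrow> complex ^ 4 ^ 4" where
  "limit_mat u \<phi> = mat (\<phi> 0) + (\<Sum>j\<in>UNIV. transpose (T_mat (u j)) ** mat (gleason j \<phi> 0) +
     (\<Sum>i\<in>UNIV. transpose (T_mat (u j)) ** (transpose (T_mat (u i)) ** mat (gleason i (gleason j \<phi>) 0))))"

lemma tendsto_shift_mat: "((\<lambda>d. shift_mat u d j) \<longlongrightarrow> transpose (T_mat (u j))) (at_right 0)"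
proof (rule vec_tendstoI, rule vec_tendstoI)
  fix a b
  let ?A = "transpose (T_mat (u j)) $ a $ b" and ?B = "T_mat (vector [u j $ 2, u j $ 1]) $ a $ b"
  have "((\<lambda>d. (?A + (of_real d)\<^sup>2 * ?B) / (1 + (of_real d)\<^sup>2)) \<longlongrightarrow>
      (?A + (of_real 0)\<^sup>2 * ?B) / (1 + (of_real 0)\<^sup>2)) (at_right 0)"
    by (intro tendsto_intros) auto
  then show "((\<lambda>d. shift_mat u d j $ a $ b) \<longlongrightarrow> ?A) (at_right 0)"
    by (simp add: shift_mat_def)
qed

lemma transpose_T_mat_nilpotent:
  "transpose (T_mat v) ** (transpose (T_mat w) ** transpose (T_mat t)) = 0"
proof -
  have "transpose (T_mat v) *v (transpose (T_mat w) *v (transpose (T_mat t) *v x)) = 0" for x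
    unfolding T_mat_transpose_mult vector_4 vec_eq_iff forall_4 by simp
  then show ?thesis
    unfolding matrix_eq by (simp add: matrix_vector_mul_assoc del: transpose_matrix_vector)
qed

lemma eventually_small_positive: "\<forall>\<^sub>F d in at_right (0::real). 0 < d \<and> d < 1 / 2"
  unfolding eventually_at_right_field by (rule exI[of _ "1 / 2"]) auto

text \<open>Divide three times. The terms of order at most two converge; the rest is a product of
  three matrices that tends to a vanishing triple product, times a bounded factor.\<close>

lemma tendsto_diag_mat:
  assumes u: "\<And>j. norm (u j) = 1" and \<phi>: "\<phi> \<in> H_inf"
  shows "((\<lambda>d. diag_mat u d \<phi>) \<longlongrightarrow> limit_mat u \<phi>) (at_right 0)"
proof -
  have remainder: "((\<lambda>d. shift_mat u d j ** (shift_mat u d i ** (shift_mat u d k ** diag_mat u d \<psi>))) \<longlongrightarrow> 0) (at_right 0)"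
    if "\<psi> \<in> H_inf" for i j k \<psi>
  proof -
    obtain C where C: "\<forall>d. 0 < d \<longrightarrow> d < 1 / 2 \<longrightarrow> (\<forall>a b. cmod (diag_mat u d \<psi> $ a $ b) \<le> C)"
      using diag_mat_bounded[of u, OF u \<open>\<psi> \<in> H_inf\<close>] by blast
    have "((\<lambda>d. shift_mat u d j ** (shift_mat u d i ** shift_mat u d k)) \<longlongrightarrow> transpose (T_mat (u j)) ** (transpose (T_mat (u i)) ** transpose (T_mat (u k)))) (at_right 0)"
      by (intro tendsto_matrix_mult tendsto_shift_mat)
    then have "((\<lambda>d. shift_mat u d j ** (shift_mat u d i ** shift_mat u d k)) \<longlongrightarrow> 0) (at_right 0)"
      by (simp only: transpose_T_mat_nilpotent)
    moreover have "\<forall>\<^sub>F d in at_right 0. \<forall>a b. cmod (diag_mat u d \<psi> $ a $ b) \<le> C"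
      using eventually_small_positive by eventually_elim (use C in blast)
    ultimately have "((\<lambda>d. shift_mat u d j ** (shift_mat u d i ** shift_mat u d k) ** diag_mat u d \<psi>) \<longlongrightarrow> 0) (at_right 0)"
      by (rule tendsto_zero_matrix_mult_bounded)
    then show ?thesis
      by (simp only: matrix_mul_assoc)
  qed
  have "((\<lambda>d. mat (\<phi> 0) + (\<Sum>j\<in>UNIV. shift_mat u d j ** mat (gleason j \<phi> 0) +
      (\<Sum>i\<in>UNIV. shift_mat u d j ** (shift_mat u d i ** mat (gleason i (gleason j \<phi>) 0)) +
      (\<Sum>k\<in>UNIV. shift_mat u d j ** (shift_mat u d i ** (shift_mat u d k ** diag_mat u d (gleason k (gleason i (gleason j \<phi>)))))))))
    \<longlongrightarrow> mat (\<phi> 0) + (\<Sum>j\<in>UNIV. transpose (T_mat (u j)) ** mat (gleason j \<phi> 0) +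
      (\<Sum>i\<in>UNIV. transpose (T_mat (u j)) ** (transpose (T_mat (u i)) ** mat (gleason i (gleason j \<phi>) 0)) + (\<Sum>k\<in>(UNIV :: 3 set). 0)))) (at_right 0)"
    by (intro tendsto_add tendsto_sum tendsto_const tendsto_matrix_mult tendsto_shift_mat remainder H_inf_gleason \<phi>)
  then have "((\<lambda>d. mat (\<phi> 0) + (\<Sum>j\<in>UNIV. shift_mat u d j ** mat (gleason j \<phi> 0) +
      (\<Sum>i\<in>UNIV. shift_mat u d j ** (shift_mat u d i ** mat (gleason i (gleason j \<phi>) 0)) +
      (\<Sum>k\<in>UNIV. shift_mat u d j ** (shift_mat u d i ** (shift_mat u d k ** diag_mat u d (gleason k (gleason i (gleason j \<phi>)))))))))
    \<longlongrightarrow> limit_mat u \<phi>) (at_right 0)"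
    by (simp add: limit_mat_def)
  then show ?thesis
  proof (rule Lim_transform_eventually)
    show "\<forall>\<^sub>F d in at_right 0. mat (\<phi> 0) + (\<Sum>j\<in>UNIV. shift_mat u d j ** mat (gleason j \<phi> 0) +
      (\<Sum>i\<in>UNIV. shift_mat u d j ** (shift_mat u d i ** mat (gleason i (gleason j \<phi>) 0)) +
      (\<Sum>k\<in>UNIV. shift_mat u d j ** (shift_mat u d i ** (shift_mat u d k ** diag_mat u d (gleason k (gleason i (gleason j \<phi>)))))))) = diag_mat u d \<phi>"
      using eventually_small_positive
    proof eventually_elim
      case (elim d)
      then have rec: "diag_mat u d \<psi> = mat (\<psi> 0) + (\<Sum>j\<in>UNIV. shift_mat u d j ** diag_mat u d (gleason j \<psi>))" for \<psi>
        by (intro diag_mat_recursion) simp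
      \<comment> \<open>The first occurrence is the remainder on the left, which has to stay; each
        rewriting of the second performs one division on the right.\<close>
      show ?case
        by (subst (2) rec, subst (2) rec, subst (2) rec) (simp only: matrix_add_ldistrib matrix_mult_sum_right sum.distrib add.assoc)
    qed
  qed
qed

lemma mat_vector_mult: "mat c *v (x :: complex ^ 'n) = c *s x"
  by (simp add: vec_eq_iff matrix_vector_mult_def mat_def if_distrib[of "\<lambda>t. t * _"] cong: if_cong)

lemma transpose_add: "transpose (A + B) = transpose A + transpose (B :: complex ^ 'n ^ 'm)"
  by (simp add: transpose_def vec_eq_iff)

lemma transpose_sum: "transpose (\<Sum>i\<in>I. A i) = (\<Sum>i\<in>I. transpose (A i :: complex ^ 'n ^ 'm))"
  by (simp add: transpose_def vec_eq_iff)

lemma sum_matrix_vector_mult: "(\<Sum>i\<in>I. A i) *v x = (\<Sum>i\<in>I. (A i :: complex ^ 'n ^ 'm) *v x)"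
  by (simp add: matrix_vector_mult_def vec_eq_iff sum_distrib_right) (auto intro: sum.swap)

lemma limit_mat_transpose_mult:
  "transpose (limit_mat u \<phi>) *v x = \<phi> 0 *s x + (\<Sum>j\<in>UNIV. gleason j \<phi> 0 *s (T_mat (u j) *v x) +
     (\<Sum>i\<in>UNIV. gleason i (gleason j \<phi>) 0 *s (T_mat (u i) *v (T_mat (u j) *v x))))"
  unfolding limit_mat_def transpose_add transpose_sum matrix_transpose_mul transpose_transpose transpose_mat
    matrix_vector_mult_add_rdistrib sum_matrix_vector_mult matrix_vector_mul_assoc[symmetric] mat_vector_mult ..

lemma T_mat_nilpotent: "T_mat v *v (T_mat w *v (T_mat t *v x)) = 0"
  unfolding T_mat_mult vector_4 vec_eq_iff forall_4 by simp

lemma op_monomial_T_mat_zero: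
  assumes "a + b + c \<ge> 3"
  shows "op_monomial (\<lambda>j. (*v) (T_mat (u j))) (a, b, c) = (\<lambda>_. 0)"
proof
  fix x :: "complex ^ 4"
  \<comment> \<open>The filtration by nilpotency: each application moves the fourth component to the
    middle ones and these to the first.\<close>
  define level :: "nat \<Rightarrow> complex ^ 4 \<Rightarrow> bool" where
    "level n y \<longleftrightarrow> (1 \<le> n \<longrightarrow> y $ 4 = 0) \<and> (2 \<le> n \<longrightarrow> y $ 2 = 0 \<and> y $ 3 = 0) \<and> (3 \<le> n \<longrightarrow> y $ 1 = 0)" for n y
  have step: "level (Suc n) (T_mat (u j) *v y)" if "level n y" for n y j
    using that unfolding level_def T_mat_mult vector_4 by auto
  have iterate: "level (m + n) (((*v) (T_mat (u j)) ^^ m) y)" if "level n y" for m n y j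
    using that by (induction m) (auto intro: step)
  have "level 0 x"
    by (simp add: level_def)
  then have "level (a + (b + (c + 0))) (op_monomial (\<lambda>j. (*v) (T_mat (u j))) (a, b, c) x)"
    by (simp only: op_monomial_def split comp_apply iterate)
  then show "op_monomial (\<lambda>j. (*v) (T_mat (u j))) (a, b, c) x = 0"
    using assms unfolding level_def vec_eq_iff forall_4 by simp
qed

lemma eval_tuple_T_mat:
  assumes \<phi>: "\<phi> \<in> H_inf"
  shows "eval_tuple (\<lambda>j. (*v) (T_mat (u j))) \<phi> x = transpose (limit_mat u \<phi>) *v x"
proof -
  let ?S = "\<lambda>j. (*v) (T_mat (u j))"
  \<comment> \<open>All exponents of degree at most two. A monomial among them may still vanish; its
    summand is then 0.\<close>
  define A :: "(nat \<times> nat \<times> nat) set" where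
    "A = {(0,0,0), (1,0,0), (0,1,0), (0,0,1), (2,0,0), (0,2,0), (0,0,2), (1,1,0), (1,0,1), (0,1,1)}"
  have "{\<alpha>. op_monomial ?S \<alpha> \<noteq> (\<lambda>_. 0)} \<subseteq> A"
  proof
    fix \<alpha> assume nz: "\<alpha> \<in> {\<alpha>. op_monomial ?S \<alpha> \<noteq> (\<lambda>_. 0)}"
    obtain a b c where \<alpha>: "\<alpha> = (a, b, c)"
      by (rule prod_cases3)
    have "a + b + c < 3"
    proof (rule ccontr)
      assume "\<not> a + b + c < 3"
      then have "op_monomial ?S \<alpha> = (\<lambda>_. 0)"
        unfolding \<alpha> by (intro op_monomial_T_mat_zero) simp
      then show False
        using nz by blast
    qed
    then have "a = 0 \<or> a = 1 \<or> a = 2" "b = 0 \<or> b = 1 \<or> b = 2" "c = 0 \<or> c = 1 \<or> c = 2" "a + b + c < 3"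
      by arith+
    then show "\<alpha> \<in> A"
      unfolding \<alpha> A_def by (elim disjE) simp_all
  qed
  moreover have "finite A"
    by (simp add: A_def)
  moreover have zero: "cscale (taylor_coeff \<phi> \<alpha>) (op_monomial ?S \<alpha> x) = 0"
    if "op_monomial ?S \<alpha> = (\<lambda>_. 0)" for \<alpha>
    unfolding that by (simp add: cscale_vec_def cscale_complex_def vec_eq_iff)
  ultimately have "eval_tuple ?S \<phi> x = (\<Sum>\<alpha>\<in>A. cscale (taylor_coeff \<phi> \<alpha>) (op_monomial ?S \<alpha> x))"
    unfolding eval_tuple_def by (intro sum.mono_neutral_left ballI zero) simp_all
  also have "\<dots> = (\<Sum>\<alpha>\<in>A. taylor_coeff \<phi> \<alpha> *s op_monomial ?S \<alpha> x)"
    unfolding cscale_vec_def cscale_complex_def vector_scalar_mult_def ..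
  also have "\<dots> = transpose (limit_mat u \<phi>) *v x"
  proof -
    have two: "(f ^^ 2) y = f (f y)" for f :: "complex ^ 4 \<Rightarrow> complex ^ 4" and y
      by (simp add: numeral_2_eq_2)
    have one: "(f ^^ 1) y = f y" and zero: "(f ^^ 0) y = y" for f :: "complex ^ 4 \<Rightarrow> complex ^ 4" and y
      by simp_all
    have "(\<Sum>\<alpha>\<in>A. taylor_coeff \<phi> \<alpha> *s op_monomial ?S \<alpha> x) =
        taylor_coeff \<phi> (0,0,0) *s op_monomial ?S (0,0,0) x
      + taylor_coeff \<phi> (1,0,0) *s op_monomial ?S (1,0,0) x
      + taylor_coeff \<phi> (0,1,0) *s op_monomial ?S (0,1,0) x
      + taylor_coeff \<phi> (0,0,1) *s op_monomial ?S (0,0,1) x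
      + taylor_coeff \<phi> (2,0,0) *s op_monomial ?S (2,0,0) x
      + taylor_coeff \<phi> (0,2,0) *s op_monomial ?S (0,2,0) x
      + taylor_coeff \<phi> (0,0,2) *s op_monomial ?S (0,0,2) x
      + taylor_coeff \<phi> (1,1,0) *s op_monomial ?S (1,1,0) x
      + taylor_coeff \<phi> (1,0,1) *s op_monomial ?S (1,0,1) x
      + taylor_coeff \<phi> (0,1,1) *s op_monomial ?S (0,1,1) x"
      unfolding A_def by (simp add: add.assoc)
    \<comment> \<open>Three of the nine second-order terms vanish by
      \<open>gleason_gleason_zero\<close>; the other six match the exponents of degree two.\<close>
    then show ?thesis
      unfolding limit_mat_transpose_mult sum_3 gleason_gleason_zero taylor_coeff_gleason[OF \<phi>] op_monomial_def
        split comp_apply two one zero vector_smult_lzero add_0_left add_0_right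
      by (simp only: add_ac)
  qed
  finally show ?thesis .
qed

text \<open>The device that carries each algebraic identity of \<open>diag_mat\<close> at small d
  over to \<open>limit_mat\<close>.\<close>

lemma limit_mat_unique:
  assumes "\<And>j. norm (u j) = 1" "\<phi> \<in> H_inf"
    and "\<And>d. 0 < d \<Longrightarrow> d < 1 / 2 \<Longrightarrow> diag_mat u d \<phi> = F d" "(F \<longlongrightarrow> L) (at_right 0)"
  shows "limit_mat u \<phi> = L"
proof (rule tendsto_unique)
  show "((\<lambda>d. diag_mat u d \<phi>) \<longlongrightarrow> limit_mat u \<phi>) (at_right 0)"
    by (rule tendsto_diag_mat[of u, OF assms(1,2)])
  have "\<forall>\<^sub>F d in at_right 0. F d = diag_mat u d \<phi>"
    using eventually_small_positive by eventually_elim (simp add: assms(3))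
  with assms(4) show "((\<lambda>d. diag_mat u d \<phi>) \<longlongrightarrow> L) (at_right 0)"
    by (rule Lim_transform_eventually)
qed simp

lemma limit_mat_const:
  assumes "\<And>j. norm (u j) = 1"
  shows "limit_mat u (\<lambda>z. c) = mat c"
  by (rule limit_mat_unique[of u, OF assms H_inf_const, where F = "\<lambda>d. mat c"]) (simp_all add: diag_mat_const)

lemma limit_mat_coord:
  assumes "\<And>j. norm (u j) = 1"
  shows "limit_mat u (\<lambda>z. z $ j) = transpose (T_mat (u j))"
proof (rule limit_mat_unique[of u, OF assms H_inf_coord, where F = "\<lambda>d. shift_mat u d j"])
  fix d :: real assume "0 < d"
  then show "diag_mat u d (\<lambda>z. z $ j) = shift_mat u d j"
    using shift_mat_mult_diag_mat[of u d j "\<lambda>z. 1"] by (simp add: diag_mat_const)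
qed (rule tendsto_shift_mat)

lemma limit_mat_cong:
  assumes "\<And>j. norm (u j) = 1" "\<phi> \<in> H_inf" "\<psi> \<in> H_inf" "\<And>z. z \<in> tridisc \<Longrightarrow> \<phi> z = \<psi> z"
  shows "limit_mat u \<phi> = limit_mat u \<psi>"
  by (rule limit_mat_unique[of u, OF assms(1,2) _ tendsto_diag_mat[of u, OF assms(1,3)]])
    (rule diag_mat_cong[of u, OF assms(1) _ _ assms(4)])

lemma limit_mat_add:
  assumes "\<And>j. norm (u j) = 1" "\<phi> \<in> H_inf" "\<psi> \<in> H_inf"
  shows "limit_mat u (\<lambda>z. \<phi> z + \<psi> z) = limit_mat u \<phi> + limit_mat u \<psi>"
  by (rule limit_mat_unique[of u, OF assms(1) H_inf_add[OF assms(2,3)] diag_mat_add])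
    (intro tendsto_add tendsto_diag_mat assms)

lemma limit_mat_mult:
  assumes "\<And>j. norm (u j) = 1" "\<phi> \<in> H_inf" "\<psi> \<in> H_inf"
  shows "limit_mat u (\<lambda>z. \<phi> z * \<psi> z) = limit_mat u \<phi> ** limit_mat u \<psi>"
  by (rule limit_mat_unique[of u, OF assms(1) H_inf_mult[OF assms(2,3)] diag_mat_mult])
    (auto intro!: tendsto_matrix_mult tendsto_diag_mat assms)

lemma limit_mat_contractive:
  assumes u: "\<And>j. norm (u j) = 1" and bound: "agler_bound n \<phi> c"
  shows "(\<Sum>l<n. (norm (\<Sum>p<n. limit_mat u (\<lambda>z. \<phi> z p l) *v Y p))\<^sup>2) \<le> c\<^sup>2 * (\<Sum>p<n. (norm (Y p))\<^sup>2)"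
proof (rule tendsto_upperbound)
  have entry: "(\<lambda>z. \<phi> z p l) \<in> H_inf" if "p < n" "l < n" for p l
    using agler_ineq_entry[OF bound that] by (auto simp: H_inf_iff)
  show "((\<lambda>d. \<Sum>l<n. (norm (\<Sum>p<n. diag_mat u d (\<lambda>z. \<phi> z p l) *v Y p))\<^sup>2) \<longlongrightarrow>
      (\<Sum>l<n. (norm (\<Sum>p<n. limit_mat u (\<lambda>z. \<phi> z p l) *v Y p))\<^sup>2)) (at_right 0)"
    by (intro tendsto_sum tendsto_power tendsto_norm tendsto_matrix_vector tendsto_diag_mat u entry) auto
  show "\<forall>\<^sub>F d in at_right 0. (\<Sum>l<n. (norm (\<Sum>p<n. diag_mat u d (\<lambda>z. \<phi> z p l) *v Y p))\<^sup>2)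
      \<le> c\<^sup>2 * (\<Sum>p<n. (norm (Y p))\<^sup>2)"
    using eventually_small_positive by eventually_elim (intro diag_mat_contractive u bound; simp)
qed simp

text \<open>
  \<open>limit_mat\<close> is the transpose of the matrix of the representation, and the block indices of \<open>\<phi>\<close> are
  swapped too. The bound carries over by duality for the bilinear form \<open>\<Sum>b. v $ b * w $ b\<close>.
\<close>

lemma limit_mat_transpose_contractive:
  assumes u: "\<And>j. norm (u j) = 1" and bound: "agler_bound n \<phi> c"
  shows "L2_set (\<lambda>p. norm (\<Sum>l<n. transpose (limit_mat u (\<lambda>z. \<phi> z p l)) *v h l)) {..<n}
    \<le> c * L2_set (\<lambda>l. norm (h l)) {..<n}"
proof -
  define M where "M = (\<lambda>p l. limit_mat u (\<lambda>z. \<phi> z p l))"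
  define Z where "Z = (\<lambda>p. \<Sum>l<n. transpose (M p l) *v h l)"
  \<comment> \<open>The conjugate makes the bilinear pairing of \<open>Z\<close> with
    \<open>Y\<close> equal to the squared norm of \<open>Z\<close>.\<close>
  define Y where "Y = (\<lambda>p. \<chi> b. cnj (Z p $ b))"
  define X where "X = (\<lambda>l. \<Sum>p<n. M p l *v Y p)"
  have normY: "norm (Y p) = norm (Z p)" for p
    by (simp add: Y_def norm_vec_def)
  have "c \<ge> 0"
    using bound by (simp add: agler_bound_def)
  have "(L2_set (\<lambda>l. norm (X l)) {..<n})\<^sup>2 \<le> (c * L2_set (\<lambda>p. norm (Z p)) {..<n})\<^sup>2"
    using limit_mat_contractive[of u, OF u bound, of Y]
    by (simp add: L2_set_def sum_nonneg power_mult_distrib X_def M_def normY)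
  then have X: "L2_set (\<lambda>l. norm (X l)) {..<n} \<le> c * L2_set (\<lambda>p. norm (Z p)) {..<n}"
    using \<open>c \<ge> 0\<close> by (simp add: power2_le_iff_abs_le)
  have adjoint: "(\<Sum>b\<in>UNIV. (transpose A *v v) $ b * w $ b) = (\<Sum>a\<in>UNIV. v $ a * (A *v w) $ a)"
    for A :: "complex ^ 4 ^ 4" and v w
    unfolding matrix_vector_mult_def transpose_def
    by (simp add: sum_distrib_left sum_distrib_right mult_ac) (rule sum.swap)
  have "complex_of_real (\<Sum>p<n. (norm (Z p))\<^sup>2) = (\<Sum>p<n. \<Sum>b\<in>UNIV. Z p $ b * Y p $ b)"
    unfolding of_real_sum of_real_norm_power2_vec by (simp add: Y_def)
  also have "\<dots> = (\<Sum>p<n. \<Sum>l<n. \<Sum>b\<in>UNIV. (transpose (M p l) *v h l) $ b * Y p $ b)"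
    unfolding Z_def sum_component sum_distrib_right by (intro sum.cong refl sum.swap)
  also have "\<dots> = (\<Sum>p<n. \<Sum>l<n. \<Sum>a\<in>UNIV. h l $ a * (M p l *v Y p) $ a)"
    by (simp only: adjoint)
  also have "\<dots> = (\<Sum>l<n. \<Sum>p<n. \<Sum>a\<in>UNIV. h l $ a * (M p l *v Y p) $ a)"
    by (rule sum.swap)
  also have "\<dots> = (\<Sum>l<n. \<Sum>a\<in>UNIV. h l $ a * X l $ a)"
    unfolding X_def sum_component sum_distrib_left by (intro sum.cong refl sum.swap)
  finally have "cmod (complex_of_real (\<Sum>p<n. (norm (Z p))\<^sup>2)) = cmod (\<Sum>l<n. \<Sum>a\<in>UNIV. h l $ a * X l $ a)"
    by (rule arg_cong)
  then have "(\<Sum>p<n. (norm (Z p))\<^sup>2) = cmod (\<Sum>l<n. \<Sum>a\<in>UNIV. h l $ a * X l $ a)"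
    by (simp only: norm_of_real abs_of_nonneg[OF sum_nonneg] zero_le_power2)
  also have "\<dots> \<le> (\<Sum>l<n. \<bar>norm (h l)\<bar> * \<bar>norm (X l)\<bar>)"
    by (rule sum_norm_le) (simp add: cmod_bilinear_le)
  also have "\<dots> \<le> L2_set (\<lambda>l. norm (h l)) {..<n} * L2_set (\<lambda>l. norm (X l)) {..<n}"
    by (rule L2_set_mult_ineq)
  also have "\<dots> \<le> L2_set (\<lambda>l. norm (h l)) {..<n} * (c * L2_set (\<lambda>p. norm (Z p)) {..<n})"
    by (intro mult_left_mono X L2_set_nonneg)
  finally have "L2_set (\<lambda>p. norm (Z p)) {..<n} * L2_set (\<lambda>p. norm (Z p)) {..<n} \<le>
      (c * L2_set (\<lambda>l. norm (h l)) {..<n}) * L2_set (\<lambda>p. norm (Z p)) {..<n}"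
    by (simp add: L2_set_def sum_nonneg mult_ac)
  then have "L2_set (\<lambda>p. norm (Z p)) {..<n} \<le> c * L2_set (\<lambda>l. norm (h l)) {..<n}"
    using \<open>c \<ge> 0\<close> by (cases "L2_set (\<lambda>p. norm (Z p)) {..<n} = 0")
      (simp_all add: mult_le_cancel_right L2_set_nonneg less_le)
  then show ?thesis
    by (simp add: Z_def M_def)
qed

section \<open>The representation\<close>

lemma cscale_vec_complex: "cscale c (x :: complex ^ 'n) = c *s x"
  by (simp add: cscale_vec_def cscale_complex_def vec_eq_iff)

lemma bounded_clinear_matrix: "bounded_clinear (\<lambda>x. (M :: complex ^ 'n ^ 'm) *v x)"
proof -
  have "linear ((*v) M)"
    by (intro linearI)
      (simp_all add: matrix_vector_right_distrib scaleR_cscale cscale_vec_complex vector_scalar_commute)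
  then show ?thesis
    by (simp add: bounded_clinear_def linear_conv_bounded_linear cscale_vec_complex vector_scalar_commute)
qed

lemma eval_tuple_T_mat_fun:
  assumes "\<phi> \<in> H_inf"
  shows "eval_tuple (\<lambda>j. (*v) (T_mat (u j))) \<phi> = (\<lambda>x. transpose (limit_mat u \<phi>) *v x)"
  by (rule ext) (rule eval_tuple_T_mat[OF assms])

lemma representation_eval_tuple:
  assumes u: "\<And>j. norm (u j) = 1"
  shows "representation (eval_tuple (\<lambda>j. (*v) (T_mat (u j))))"
  unfolding representation_def
proof (intro conjI ballI allI impI)
  let ?\<pi> = "eval_tuple (\<lambda>j. (*v) (T_mat (u j)))"
  fix \<phi> assume \<phi>: "\<phi> \<in> H_inf"
  show "bounded_clinear (?\<pi> \<phi>)"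
    unfolding eval_tuple_T_mat_fun[OF \<phi>] by (rule bounded_clinear_matrix)
  fix c
  show "?\<pi> (\<lambda>z. c * \<phi> z) = (\<lambda>x. cscale c (?\<pi> \<phi> x))"
    unfolding eval_tuple_T_mat_fun[OF \<phi>] eval_tuple_T_mat_fun[OF H_inf_mult[OF H_inf_const \<phi>]]
      limit_mat_mult[of u, OF u H_inf_const \<phi>] limit_mat_const[of u, OF u]
      matrix_transpose_mul transpose_mat matrix_vector_mul_assoc[symmetric] mat_vector_mult
    by (simp add: cscale_vec_complex vector_scalar_commute del: transpose_matrix_vector)
next
  let ?\<pi> = "eval_tuple (\<lambda>j. (*v) (T_mat (u j)))"
  fix \<phi> \<psi> assume \<phi>: "\<phi> \<in> H_inf" and \<psi>: "\<psi> \<in> H_inf"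
  note \<pi> = eval_tuple_T_mat_fun[OF \<phi>] eval_tuple_T_mat_fun[OF \<psi>]
  show "?\<pi> \<phi> = ?\<pi> \<psi>" if "\<forall>z\<in>tridisc. \<phi> z = \<psi> z"
    unfolding \<pi> using limit_mat_cong[of u, OF u \<phi> \<psi>] that by simp
  show "?\<pi> (\<lambda>z. \<phi> z + \<psi> z) = (\<lambda>x. ?\<pi> \<phi> x + ?\<pi> \<psi> x)"
    unfolding \<pi> eval_tuple_T_mat_fun[OF H_inf_add[OF \<phi> \<psi>]] limit_mat_add[of u, OF u \<phi> \<psi>] transpose_add
      matrix_vector_mult_add_rdistrib ..
  \<comment> \<open>Transposition reverses products, so the factors are exchanged first.\<close>
  have "(\<lambda>z. \<phi> z * \<psi> z) = (\<lambda>z. \<psi> z * \<phi> z)"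
    by (simp add: mult.commute)
  then show "?\<pi> (\<lambda>z. \<phi> z * \<psi> z) = ?\<pi> \<phi> \<circ> ?\<pi> \<psi>"
    unfolding \<pi> comp_def
    by (simp only: eval_tuple_T_mat_fun[OF H_inf_mult[OF \<psi> \<phi>]] limit_mat_mult[of u, OF u \<psi> \<phi>]
        matrix_transpose_mul matrix_vector_mul_assoc)
qed

lemma unital_eval_tuple:
  assumes "\<And>j. norm (u j) = 1"
  shows "unital (eval_tuple (\<lambda>j. (*v) (T_mat (u j))))"
  unfolding unital_def eval_tuple_T_mat_fun[OF H_inf_const] limit_mat_const[of u, OF assms] transpose_mat
  by (simp add: mat_vector_mult fun_eq_iff)

lemma eval_tuple_coord:
  assumes "\<And>j. norm (u j) = 1"
  shows "eval_tuple (\<lambda>j. (*v) (T_mat (u j))) (\<lambda>z. z $ j) = (*v) (T_mat (u j))"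
  unfolding eval_tuple_T_mat_fun[OF H_inf_coord] limit_mat_coord[of u, OF assms] transpose_transpose ..

lemma completely_contractive_eval_tuple:
  assumes u: "\<And>j. norm (u j) = 1"
  shows "completely_contractive (eval_tuple (\<lambda>j. (*v) (T_mat (u j))))"
  unfolding completely_contractive_def
proof (intro allI impI ballI)
  fix n :: nat and \<phi> and h :: "nat \<Rightarrow> complex ^ 4"
  assume "\<phi> \<in> H_inf_mat n"
  then have ne: "{c. agler_bound n \<phi> c} \<noteq> {}"
    by (auto simp: H_inf_mat_def)
  then obtain c where c: "agler_bound n \<phi> c"
    by auto
  define N where "N = L2_set (\<lambda>i. norm (\<Sum>j<n. eval_tuple (\<lambda>j. (*v) (T_mat (u j))) (\<lambda>z. \<phi> z i j) (h j))) {..<n}"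
  define D where "D = L2_set (\<lambda>j. norm (h j)) {..<n}"
  have "(\<lambda>z. \<phi> z i j) \<in> H_inf" if "i < n" "j < n" for i j
    using agler_ineq_entry[OF c that] by (auto simp: H_inf_iff)
  then have N: "N = L2_set (\<lambda>i. norm (\<Sum>j<n. transpose (limit_mat u (\<lambda>z. \<phi> z i j)) *v h j)) {..<n}"
    unfolding N_def by (intro L2_set_cong refl arg_cong[where f = norm] sum.cong eval_tuple_T_mat) auto
  have le: "N \<le> c * D" if "agler_bound n \<phi> c" for c
    unfolding N D_def by (rule limit_mat_transpose_contractive[of u, OF u that])
  show "N \<le> agler_norm n \<phi> * D"
  \<comment> \<open>For D > 0 the bounds \<open>le\<close> can be divided by D and then pass to the
    infimum over c.\<close>
  proof (cases "D = 0")
    case True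
    then show ?thesis
      using le[OF c] by simp
  next
    case False
    then have "D > 0"
      by (simp add: D_def L2_set_nonneg less_le)
    then have "N / D \<le> agler_norm n \<phi>"
      unfolding agler_norm_def by (intro cInf_greatest ne) (simp add: le pos_divide_le_eq)
    then show ?thesis
      using \<open>D > 0\<close> by (simp add: pos_divide_le_eq)
  qed
qed

section \<open>Elementary Hilbert space facts\<close>

lemma cinner_add_right: "cinner (x :: 'a::chilbert_space) (y + z) = cinner x y + cinner x z"
  by (subst (1 2 3) cinner_commute) (simp add: cinner_add_left)

lemma cinner_cscale_right: "cinner (x :: 'a::chilbert_space) (cscale c y) = cnj c * cinner x y"
  by (subst (1 2) cinner_commute) (simp add: cinner_cscale_left)

lemma cinner_scaleR_left: "cinner (r *\<^sub>R x) (y :: 'a::chilbert_space) = of_real r * cinner x y"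
  by (simp add: scaleR_cscale cinner_cscale_left)

lemma cinner_scaleR_right: "cinner (x :: 'a::chilbert_space) (r *\<^sub>R y) = of_real r * cinner x y"
  by (simp add: scaleR_cscale cinner_cscale_right)

lemma cinner_zero [simp]: "cinner 0 (x :: 'a::chilbert_space) = 0" "cinner (x :: 'a::chilbert_space) 0 = 0"
  using cinner_scaleR_left[of 0 0 x] cinner_scaleR_right[of x 0 0] by simp_all

lemma cinner_self: "cinner x (x :: 'a::chilbert_space) = of_real ((norm x)\<^sup>2)"
proof -
  have "Im (cinner x x) = 0"
    using arg_cong[OF cinner_commute[of x x], of Im] by simp
  moreover have "Re (cinner x x) \<ge> 0"
    using norm_ge_zero[of x] unfolding norm_eq_sqrt_cinner by simp
  ultimately show ?thesis
    by (simp add: complex_eq_iff norm_eq_sqrt_cinner)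
qed

lemma norm_add_power2:
  "(norm (x + y :: 'a::chilbert_space))\<^sup>2 = (norm x)\<^sup>2 + 2 * Re (cinner x y) + (norm y)\<^sup>2"
proof -
  have "complex_of_real ((norm (x + y))\<^sup>2) = cinner x x + cinner x y + cinner y x + cinner y y"
    unfolding cinner_self[symmetric] by (simp add: cinner_add_left cinner_add_right)
  then have "(norm (x + y))\<^sup>2 = Re (cinner x x + cinner x y + cinner y x + cinner y y)"
    by (metis Re_complex_of_real)
  moreover have "Re (cinner y x) = Re (cinner x y)"
    by (subst cinner_commute) simp
  ultimately show ?thesis
    by (simp add: cinner_self)
qed

lemma eq_if_cinner_norm:
  fixes x y :: "'a::chilbert_space"
  assumes "norm x \<le> norm y" "cinner x y = of_real ((norm y)\<^sup>2)"
  shows "x = y"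
proof -
  have "(norm (x + (- 1) *\<^sub>R y))\<^sup>2 = (norm x)\<^sup>2 - (norm y)\<^sup>2"
    unfolding norm_add_power2 cinner_scaleR_right assms(2) by simp
  also have "\<dots> \<le> 0"
    using assms(1) by (simp add: power_mono)
  finally show ?thesis
    by simp
qed

text \<open>In operator language R^* R a = a, here phrased without adjoints. It is the first-order
  condition for the squared norm of y minus that of R y, non-negative everywhere, to be 0 at
  a.\<close>

lemma contraction_attained:
  fixes R :: "'a::chilbert_space \<Rightarrow> 'b::chilbert_space"
  assumes add: "\<And>x y. R (x + y) = R x + R y" and cscale: "\<And>c x. R (cscale c x) = cscale c (R x)"
    and le: "\<And>x. norm (R x) \<le> norm x" and eq: "norm (R a) = norm a"
  shows "cinner (R x) (R a) = cinner x a"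
proof -
  define w where "w = cinner x a - cinner (R x) (R a)"
  \<comment> \<open>The vector a is perturbed by t x. With these choices the first-order term is -2
    s |w|^2, and the second-order term is at most s |w|^2.\<close>
  define s where "s = 1 / ((norm x)\<^sup>2 + 1)"
  define t where "t = - of_real s * cnj w"
  have pos: "(norm x)\<^sup>2 + 1 > 0"
    by (simp add: add_nonneg_pos)
  then have s: "s > 0" "s * (norm x)\<^sup>2 \<le> 1"
    by (simp_all add: s_def)
  have "(norm (R (cscale t x + a)))\<^sup>2 \<le> (norm (cscale t x + a))\<^sup>2"
    by (intro power_mono le) simp
  then have "(norm (R (cscale t x)))\<^sup>2 + 2 * Re (t * cinner (R x) (R a)) \<le> (norm (cscale t x))\<^sup>2 + 2 * Re (t * cinner x a)"
    by (simp add: add norm_add_power2 eq cscale cinner_cscale_left)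
  moreover have "(norm (cscale t x))\<^sup>2 = (cmod t)\<^sup>2 * (norm x)\<^sup>2"
  proof -
    have "complex_of_real ((norm (cscale t x))\<^sup>2) = t * cnj t * of_real ((norm x)\<^sup>2)"
      unfolding cinner_self[symmetric] by (simp add: cinner_cscale_left cinner_cscale_right)
    then show ?thesis
      by (metis complex_norm_square of_real_eq_iff of_real_mult)
  qed
  moreover have "(norm (R (cscale t x)))\<^sup>2 \<ge> 0"
    by simp
  ultimately have "0 \<le> (cmod t)\<^sup>2 * (norm x)\<^sup>2 + 2 * Re (t * w)"
    unfolding w_def right_diff_distrib minus_complex.sel by linarith
  moreover have "Re (t * w) = - s * (cmod w)\<^sup>2"
  proof -
    have "t * w = - (of_real s * (w * cnj w))"
      by (simp add: t_def)
    also have "\<dots> = of_real (- s * (cmod w)\<^sup>2)"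
      unfolding complex_norm_square[symmetric] by simp
    finally show ?thesis
      by (simp only: Re_complex_of_real)
  qed
  moreover have "(cmod t)\<^sup>2 * (norm x)\<^sup>2 = s * (s * (norm x)\<^sup>2) * (cmod w)\<^sup>2"
    using s(1) by (simp add: t_def norm_mult power_mult_distrib power2_eq_square)
  moreover have "s * (s * (norm x)\<^sup>2) * (cmod w)\<^sup>2 \<le> s * 1 * (cmod w)\<^sup>2"
    using s by (intro mult_right_mono mult_left_mono) auto
  ultimately have "s * (cmod w)\<^sup>2 \<le> 0"
    by simp
  then have "w = 0"
    using s(1) by (simp add: mult_le_0_iff)
  then show ?thesis
    by (simp add: w_def)
qed

lemma closed_ortho_compl: "closed (ortho_compl (M :: 'a::chilbert_space set))"
proof -
  \<comment> \<open>Polarization: the inner product becomes an expression in norms, whose continuity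
    is known.\<close>
  have Re: "Re (cinner x y) = ((norm (x + y))\<^sup>2 - (norm x)\<^sup>2 - (norm y)\<^sup>2) / 2" for x y :: 'a
    by (simp add: norm_add_power2)
  have Im: "Im (cinner x y) = Re (cinner x (cscale \<i> y))" for x y :: 'a
    by (simp add: cinner_cscale_right)
  have "closed {x. cinner x y = 0}" for y :: 'a
    unfolding complex_eq_iff Im Re zero_complex.sel
    by (intro closed_Collect_conj closed_Collect_eq continuous_intros) auto
  then have "closed (\<Inter>y\<in>M. {x. cinner x y = 0})"
    by blast
  moreover have "ortho_compl M = (\<Inter>y\<in>M. {x. cinner x y = 0})"
    by (auto simp: ortho_compl_def)
  ultimately show ?thesis
    by simp
qed

lemma closed_csubspace_ortho_compl: "closed_csubspace (ortho_compl (M :: 'a::chilbert_space set))"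
  using closed_ortho_compl[of M]
  by (auto simp: closed_csubspace_def ortho_compl_def cinner_add_left cinner_cscale_left)

lemma closed_csubspace_range:
  fixes V :: "'a::chilbert_space \<Rightarrow> 'b::chilbert_space"
  assumes "isometric_embedding V"
  shows "closed_csubspace (range V)"
proof -
  have V: "bounded_linear V" "\<And>c x. V (cscale c x) = cscale c (V x)" "\<And>x. norm (V x) = norm x"
    using assms by (auto simp: isometric_embedding_def bounded_clinear_def)
  interpret V: bounded_linear V
    by (rule V(1))
  have "complete (V ` UNIV)"
    by (rule complete_isometric_image[of 1]) (simp_all add: V complete_UNIV)
  then have "closed (range V)"
    by (rule complete_imp_closed)
  moreover have "V x + V y \<in> range V" "cscale c (V x) \<in> range V" "0 \<in> range V" for c x y
    unfolding V.add[symmetric] V(2)[symmetric] V.zero[symmetric] by blast+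
  ultimately show ?thesis
    by (auto simp: closed_csubspace_def)
qed

section \<open>Irreducibility\<close>

text \<open>Expand the squared norm of u 1 + u 2, which equals that of u 3.\<close>

lemma three_unit_vectors_inner:
  fixes u :: "3 \<Rightarrow> real ^ 2"
  assumes u: "\<And>j. norm (u j) = 1" and sum_zero: "u 1 + u 2 + u 3 = 0"
  shows "u 1 $ 1 * u 2 $ 1 + u 1 $ 2 * u 2 $ 2 = - 1 / 2"
proof -
  have "u 3 = - (u 1 + u 2)"
    using sum_zero by (simp only: add_eq_0_iff)
  then have "(- (u 1 $ 1 + u 2 $ 1))\<^sup>2 + (- (u 1 $ 2 + u 2 $ 2))\<^sup>2 = 1"
    using unit_vector_2[OF u[of 3]] by (simp only: vector_uminus_component vector_add_component)
  then show ?thesis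
    using unit_vector_2[OF u[of 1]] unit_vector_2[OF u[of 2]]
    unfolding power2_minus power2_sum by linarith
qed

text \<open>Lagrange's identity: the squared inner product is 1/4, so 3/4 remains for the squared
  determinant.\<close>

lemma three_unit_vectors_det:
  fixes u :: "3 \<Rightarrow> real ^ 2"
  assumes u: "\<And>j. norm (u j) = 1" and sum_zero: "u 1 + u 2 + u 3 = 0"
  shows "u 1 $ 1 * u 2 $ 2 - u 1 $ 2 * u 2 $ 1 \<noteq> 0"
proof
  assume zero: "u 1 $ 1 * u 2 $ 2 - u 1 $ 2 * u 2 $ 1 = 0"
  have "(u 1 $ 1 * u 2 $ 1 + u 1 $ 2 * u 2 $ 2)\<^sup>2 + (u 1 $ 1 * u 2 $ 2 - u 1 $ 2 * u 2 $ 1)\<^sup>2 =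
      ((u 1 $ 1)\<^sup>2 + (u 1 $ 2)\<^sup>2) * ((u 2 $ 1)\<^sup>2 + (u 2 $ 2)\<^sup>2)"
    by (simp add: power2_eq_square algebra_simps)
  then show False
    unfolding three_unit_vectors_inner[of u, OF u sum_zero] zero unit_vector_2[OF u]
    by (simp add: power2_eq_square)
qed

text \<open>Every non-zero invariant subspace contains the first basis vector, so a subspace and its
  orthogonal complement cannot both be non-zero and invariant.\<close>

lemma irreducible_eval_tuple:
  assumes u: "\<And>j. norm (u j) = 1" and sum_zero: "u 1 + u 2 + u 3 = 0"
  shows "irreducible_rep (eval_tuple (\<lambda>j. (*v) (T_mat (u j))))"
  unfolding irreducible_rep_def
proof (intro conjI allI impI)
  let ?\<pi> = "eval_tuple (\<lambda>j. (*v) (T_mat (u j)))"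
  define e :: "complex ^ 4" where "e = vector [1, 0, 0, 0]"
  have "e $ 1 \<noteq> 0 $ 1"
    unfolding e_def vector_4 by simp
  then have e: "e \<noteq> 0"
    by auto
  then show "(UNIV :: (complex ^ 4) set) \<noteq> {0}"
    by auto
  have mem: "e \<in> M" if inv: "invariant_subspace ?\<pi> M" and "x \<in> M" "x \<noteq> 0" for M x
  proof -
    have T: "T_mat (u j) *v y \<in> M" if "y \<in> M" for j y
      using inv that H_inf_coord eval_tuple_coord[of u, OF u] unfolding invariant_subspace_def by metis
    have scale: "e \<in> M" if "y \<in> M" "y = a *s e" "a \<noteq> 0" for y a
    proof -
      have "cscale (1 / a) y \<in> M"
        using inv that(1) by (auto simp: invariant_subspace_def closed_csubspace_def)
      moreover have "cscale (1 / a) y = e"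
        using that(2,3) by (simp add: cscale_vec_complex)
      ultimately show ?thesis
        by simp
    qed
    have norm1: "complex_of_real (u j $ 1) * of_real (u j $ 1) + of_real (u j $ 2) * of_real (u j $ 2) = 1" for j
      using arg_cong[OF unit_vector_2[OF u[of j]], of complex_of_real] by (simp add: power2_eq_square)
    show ?thesis
    proof (cases "x $ 4 = 0")
      case False
      have "T_mat (u 1) *v (T_mat (u 1) *v x) =
          ((of_real (u 1 $ 1) * of_real (u 1 $ 1) + of_real (u 1 $ 2) * of_real (u 1 $ 2)) * x $ 4) *s e"
        unfolding T_mat_mult vec_eq_iff forall_4 e_def vector_smult_component vector_4 by (simp add: algebra_simps)
      then show ?thesis
        using scale[OF T[OF T[OF \<open>x \<in> M\<close>]] _ False] unfolding norm1 mult_1 by blast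
    next
      case x4: True
      show ?thesis
      proof (cases "\<exists>j. of_real (u j $ 1) * x $ 2 + of_real (u j $ 2) * x $ 3 \<noteq> 0")
        case True
        then obtain j where j: "of_real (u j $ 1) * x $ 2 + of_real (u j $ 2) * x $ 3 \<noteq> 0"
          by blast
        have "T_mat (u j) *v x = (of_real (u j $ 1) * x $ 2 + of_real (u j $ 2) * x $ 3) *s e"
          unfolding T_mat_mult vec_eq_iff forall_4 e_def vector_smult_component vector_4 using x4 by simp
        then show ?thesis
          using scale[OF T[OF \<open>x \<in> M\<close>] _ j] by simp
      next
        case False
        then have z: "complex_of_real (u j $ 1) * x $ 2 + of_real (u j $ 2) * x $ 3 = 0" for j
          by blast
        \<comment> \<open>Cramer's rule: two independent vectors annihilate the middle components,
          which leaves a multiple of e.\<close>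
        define D where "D = complex_of_real (u 1 $ 1) * of_real (u 2 $ 2) - of_real (u 1 $ 2) * of_real (u 2 $ 1)"
        have "D \<noteq> 0"
          using three_unit_vectors_det[of u, OF u sum_zero] by (simp add: D_def flip: of_real_mult of_real_diff)
        moreover have "D * x $ 2 = of_real (u 2 $ 2) * (of_real (u 1 $ 1) * x $ 2 + of_real (u 1 $ 2) * x $ 3)
            - of_real (u 1 $ 2) * (of_real (u 2 $ 1) * x $ 2 + of_real (u 2 $ 2) * x $ 3)"
          by (simp add: D_def algebra_simps)
        moreover have "D * x $ 3 = of_real (u 1 $ 1) * (of_real (u 2 $ 1) * x $ 2 + of_real (u 2 $ 2) * x $ 3)
            - of_real (u 2 $ 1) * (of_real (u 1 $ 1) * x $ 2 + of_real (u 1 $ 2) * x $ 3)"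
          by (simp add: D_def algebra_simps)
        ultimately have x23: "x $ 2 = 0" "x $ 3 = 0"
          unfolding z by simp_all
        then have "x = x $ 1 *s e"
          unfolding vec_eq_iff forall_4 e_def vector_smult_component vector_4 using x4 by simp
        moreover have "x $ 1 \<noteq> 0"
          using calculation \<open>x \<noteq> 0\<close> by auto
        ultimately show ?thesis
          using scale[OF \<open>x \<in> M\<close>] by blast
      qed
    qed
  qed
  fix M :: "(complex ^ 4) set" assume "reducing_subspace ?\<pi> M"
  then have inv: "invariant_subspace ?\<pi> M" "invariant_subspace ?\<pi> (ortho_compl M)"
    by (auto simp: reducing_subspace_def)
  then have M: "closed_csubspace M"
    by (simp add: invariant_subspace_def)
  show "M = {0} \<or> M = UNIV"
  proof (cases "ortho_compl M = {0}")
    case False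
    moreover have "0 \<in> ortho_compl M"
      by (simp add: ortho_compl_def)
    ultimately have e': "e \<in> ortho_compl M"
      using mem[OF inv(2)] by blast
    have "e \<notin> M"
    proof
      assume "e \<in> M"
      then have "cinner e e = 0"
        using e' by (auto simp: ortho_compl_def)
      then show False
        using e by (simp add: cinner_self)
    qed
    then have "M = {0}"
      using mem[OF inv(1)] M by (auto simp: closed_csubspace_def)
    then show ?thesis ..
  next
    case True
    \<comment> \<open>The real orthogonal projection suffices: M contains \<i> w along with w, so
      real orthogonality to M is complex orthogonality.\<close>
    have "subspace M"
      using M unfolding subspace_def closed_csubspace_def scaleR_cscale by blast
    have "x \<in> M" for x
    proof -
      obtain y z where y: "y \<in> span M" and z: "\<And>w. w \<in> span M \<Longrightarrow> orthogonal z w" and x: "x = y + z"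
        by (rule orthogonal_subspace_decomp_exists[of M x]) blast
      have inner: "inner v w = Re (cinner v w)" for v w :: "complex ^ 4"
        by (simp add: inner_vec_def cinner_vec_def cinner_complex_def inner_complex_def)
      have "cinner z w = 0" if "w \<in> M" for w
      proof -
        have "cscale \<i> w \<in> M"
          using M that by (simp add: closed_csubspace_def)
        then have "Re (cinner z w) = 0" "Re (cinner z (cscale \<i> w)) = 0"
          using z that by (auto simp: orthogonal_def inner span_base)
        then show ?thesis
          by (simp add: complex_eq_iff cinner_cscale_right)
      qed
      then have "z = 0"
        using True by (auto simp: ortho_compl_def)
      then show "x \<in> M"
        using x y \<open>subspace M\<close> by (metis add_0_right span_eq_iff)
    qed
    then show ?thesis
      by auto
  qed
qed

section \<open>Dilations are trivial\<close>

text \<open>Three off-diagonal unknowns and three row equations. The entries range over any real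
  vector space because they will be vectors of the dilation space, vectors of C^4 and complex
  numbers.\<close>

lemma symmetric_3x3_solution:
  fixes X :: "3 \<Rightarrow> 3 \<Rightarrow> 'v::real_vector"
  assumes sym: "\<And>i j. X i j = X j i" and diag: "\<And>i. X i i = E" and row: "\<And>i. X i 1 + X i 2 + X i 3 = 0"
  shows "X i j = (if i = j then E else (- 1 / 2) *\<^sub>R E)"
proof -
  define a b c where "a = X 1 2" "b = X 1 3" "c = X 2 3"
  have rows: "E + a + b = 0" "a + E + c = 0" "b + c + E = 0"
    using row[of 1] row[of 2] row[of 3] sym[of 2 1] sym[of 3 1] sym[of 3 2] diag by (simp_all add: a_b_c_def)
  have half: "x = (- 1 / 2) *\<^sub>R E" if "x + x = - E" for x
    using arg_cong[OF that, of "\<lambda>y. (1 / 2) *\<^sub>R y"] by (simp add: scaleR_half_double)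
  \<comment> \<open>Adding two rows and subtracting the third isolates one unknown.\<close>
  have "a + a = (E + a + b) + (a + E + c) - (b + c + E) - E" by simp
  then have a: "a = (- 1 / 2) *\<^sub>R E"
    unfolding rows by (intro half) simp
  have "b + b = (E + a + b) + (b + c + E) - (a + E + c) - E" by simp
  then have b: "b = (- 1 / 2) *\<^sub>R E"
    unfolding rows by (intro half) simp
  have "c + c = (a + E + c) + (b + c + E) - (E + a + b) - E" by simp
  then have c: "c = (- 1 / 2) *\<^sub>R E"
    unfolding rows by (intro half) simp
  then show ?thesis
    using a b c diag exhaust_3[of i] exhaust_3[of j] sym[of 2 1] sym[of 3 1] sym[of 3 2]
    by (auto simp: a_b_c_def)
qed

section \<open>Vectors adapted to the three levels of C^4\<close>

definition vec_e1 :: "complex ^ 4" where "vec_e1 = vector [1, 0, 0, 0]"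

definition vec_mid :: "real ^ 2 \<Rightarrow> complex ^ 4" where
  "vec_mid v = vector [0, of_real (v $ 1), of_real (v $ 2), 0]"

definition vec_e4 :: "complex ^ 4" where "vec_e4 = vector [0, 0, 0, 1]"

lemma T_mat_vec_e1: "T_mat v *v vec_e1 = 0"
  unfolding T_mat_mult vec_e1_def vector_4 vec_eq_iff forall_4 by simp

lemma T_mat_vec_mid: "T_mat v *v vec_mid w = (v $ 1 * w $ 1 + v $ 2 * w $ 2) *\<^sub>R vec_e1"
  unfolding T_mat_mult vec_e1_def vec_mid_def vector_4 vec_eq_iff forall_4 vector_scaleR_component
  by (simp add: scaleR_conv_of_real)

lemma T_mat_vec_e4: "T_mat v *v vec_e4 = vec_mid v"
  unfolding T_mat_mult vec_e4_def vec_mid_def vector_4 vec_eq_iff forall_4 by simp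

lemma vec_mid_add: "vec_mid (v + w) = vec_mid v + vec_mid w"
  unfolding vec_mid_def vec_eq_iff forall_4 vector_add_component vector_4 by simp

lemma norm_vec_e1: "norm vec_e1 = 1"
  unfolding norm_vec_def L2_set_def sum_4 vec_e1_def vector_4 by simp

lemma norm_vec_e4: "norm vec_e4 = 1"
  unfolding norm_vec_def L2_set_def sum_4 vec_e4_def vector_4 by simp

lemma norm_vec_mid: "norm (vec_mid v) = norm v"
  unfolding norm_vec_def L2_set_def sum_4 sum_2 vec_mid_def vector_4 by simp

text \<open>Cramer's rule in the middle plane, where u 1 and u 2 are independent.\<close>

lemma vec_span:
  fixes u :: "3 \<Rightarrow> real ^ 2"
  assumes u: "\<And>j. norm (u j) = 1" and sum_zero: "u 1 + u 2 + u 3 = 0"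
  shows "\<exists>a b. x = x $ 1 *s vec_e1 + (a *s vec_mid (u 1) + b *s vec_mid (u 2)) + x $ 4 *s vec_e4"
proof -
  define D where "D = complex_of_real (u 1 $ 1) * of_real (u 2 $ 2) - of_real (u 1 $ 2) * of_real (u 2 $ 1)"
  have D: "D \<noteq> 0"
    using three_unit_vectors_det[of u, OF u sum_zero] by (simp add: D_def flip: of_real_mult of_real_diff)
  define a b where "a = (x $ 2 * of_real (u 2 $ 2) - x $ 3 * of_real (u 2 $ 1)) / D"
    "b = (x $ 3 * of_real (u 1 $ 1) - x $ 2 * of_real (u 1 $ 2)) / D"
  have "(x $ 2 * of_real (u 2 $ 2) - x $ 3 * of_real (u 2 $ 1)) * of_real (u 1 $ 1)
      + (x $ 3 * of_real (u 1 $ 1) - x $ 2 * of_real (u 1 $ 2)) * of_real (u 2 $ 1) = x $ 2 * D"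
    by (simp add: D_def algebra_simps)
  then have "a * of_real (u 1 $ 1) + b * of_real (u 2 $ 1) = x $ 2"
    unfolding a_b_def times_divide_eq_left add_divide_distrib[symmetric] using D by simp
  moreover have "(x $ 2 * of_real (u 2 $ 2) - x $ 3 * of_real (u 2 $ 1)) * of_real (u 1 $ 2)
      + (x $ 3 * of_real (u 1 $ 1) - x $ 2 * of_real (u 1 $ 2)) * of_real (u 2 $ 2) = x $ 3 * D"
    by (simp add: D_def algebra_simps)
  then have "a * of_real (u 1 $ 2) + b * of_real (u 2 $ 2) = x $ 3"
    unfolding a_b_def times_divide_eq_left add_divide_distrib[symmetric] using D by simp
  ultimately have "x = x $ 1 *s vec_e1 + (a *s vec_mid (u 1) + b *s vec_mid (u 2)) + x $ 4 *s vec_e4"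
    unfolding vec_eq_iff forall_4 vector_add_component vector_smult_component vec_e1_def vec_mid_def vec_e4_def vector_4
    by simp
  then show ?thesis
    by blast
qed

locale T_dilation =
  fixes u :: "3 \<Rightarrow> real ^ 2"
    and \<rho> :: "(complex ^ 3 \<Rightarrow> complex) \<Rightarrow> 'h::chilbert_space \<Rightarrow> 'h"
    and V :: "complex ^ 4 \<Rightarrow> 'h"
  assumes unit: "\<And>j. norm (u j) = 1"
    and sum_zero: "u 1 + u 2 + u 3 = 0"
    and rep: "representation \<rho>"
    and contractive: "completely_contractive \<rho>"
    and dilates: "dilates \<rho> V (eval_tuple (\<lambda>j. (*v) (T_mat (u j))))"
begin

abbreviation T :: "3 \<Rightarrow> complex ^ 4 \<Rightarrow> complex ^ 4" where "T j \<equiv> (*v) (T_mat (u j))"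

definition R :: "3 \<Rightarrow> 'h \<Rightarrow> 'h" where "R j = \<rho> (\<lambda>z. z $ j)"

lemma rho_linear:
  assumes "\<phi> \<in> H_inf"
  shows "\<rho> \<phi> (x + y) = \<rho> \<phi> x + \<rho> \<phi> y" "\<rho> \<phi> (cscale c x) = cscale c (\<rho> \<phi> x)" "\<rho> \<phi> 0 = 0" "\<rho> \<phi> (r *\<^sub>R x) = r *\<^sub>R \<rho> \<phi> x"
proof -
  have "bounded_clinear (\<rho> \<phi>)"
    using rep assms unfolding representation_def by blast
  then interpret bounded_linear "\<rho> \<phi>"
    by (simp add: bounded_clinear_def)
  show "\<rho> \<phi> (x + y) = \<rho> \<phi> x + \<rho> \<phi> y" "\<rho> \<phi> 0 = 0" "\<rho> \<phi> (r *\<^sub>R x) = r *\<^sub>R \<rho> \<phi> x"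
    by (simp_all add: add zero scaleR)
  show "\<rho> \<phi> (cscale c x) = cscale c (\<rho> \<phi> x)"
    using \<open>bounded_clinear (\<rho> \<phi>)\<close> by (simp add: bounded_clinear_def)
qed

lemmas rep_add = rep[unfolded representation_def, THEN conjunct2, THEN conjunct2, THEN conjunct1, rule_format]
lemmas rep_scale = rep[unfolded representation_def, THEN conjunct2, THEN conjunct2, THEN conjunct2, THEN conjunct1, rule_format]
lemmas rep_mult = rep[unfolded representation_def, THEN conjunct2, THEN conjunct2, THEN conjunct2, THEN conjunct2, rule_format]

lemmas R_linear = rho_linear[OF H_inf_coord, folded R_def]

lemma V_linear: "V (x + y) = V x + V y" "V (c *s x) = cscale c (V x)" "V 0 = 0" "V (r *\<^sub>R x) = r *\<^sub>R V x"
  and V_norm: "norm (V x) = norm x"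
proof -
  have V: "bounded_clinear V" "norm (V x) = norm x"
    using dilates by (auto simp: dilates_def isometric_embedding_def)
  then interpret bounded_linear V
    by (simp add: bounded_clinear_def)
  show "V (x + y) = V x + V y" "V 0 = 0" "V (r *\<^sub>R x) = r *\<^sub>R V x" "norm (V x) = norm x"
    by (simp_all add: add zero scaleR V)
  show "V (c *s x) = cscale c (V x)"
    using V(1) by (simp add: bounded_clinear_def flip: cscale_vec_complex)
qed

lemma V_sum: "V (\<Sum>i\<in>I. f i) = (\<Sum>i\<in>I. V (f i))"
  by (induction I rule: infinite_finite_induct) (simp_all add: V_linear)

lemma rho_norm_le:
  assumes "agler_ineq tridisc \<phi> c"
  shows "norm (\<rho> \<phi> x) \<le> c * norm x"
proof -
  have b: "agler_bound 1 (\<lambda>z p q. \<phi> z) c"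
    by (rule agler_bound_oneI[OF assms])
  then have mem: "(\<lambda>z p q. \<phi> z) \<in> H_inf_mat 1"
    by (auto simp: H_inf_mat_def)
  have "L2_set (\<lambda>i. norm (\<Sum>j<1::nat. \<rho> \<phi> x)) {..<1::nat}
      \<le> agler_norm 1 (\<lambda>z p q. \<phi> z) * L2_set (\<lambda>j. norm x) {..<1::nat}"
    using contractive[unfolded completely_contractive_def, rule_format, OF order_refl mem, of "\<lambda>j. x"] .
  then have "norm (\<rho> \<phi> x) \<le> agler_norm 1 (\<lambda>z p q. \<phi> z) * norm x"
    by (simp add: L2_set_def)
  also have "agler_norm 1 (\<lambda>z p q. \<phi> z) \<le> c"
    unfolding agler_norm_def using b
    by (intro cInf_lower) (auto simp: bdd_below_def agler_bound_def)
  finally show ?thesis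
    by (simp add: mult_right_mono)
qed

lemma R_norm_le: "norm (R j x) \<le> norm x"
  using rho_norm_le[OF agler_ineq_coord, of j x] by (simp add: R_def)

lemma compression:
  assumes "\<phi> \<in> H_inf"
  shows "cinner (\<rho> \<phi> (V x)) (V y) = cinner (transpose (limit_mat u \<phi>) *v x) y"
proof -
  have "cinner (eval_tuple (\<lambda>j. (*v) (T_mat (u j))) \<phi> x) y = cinner (\<rho> \<phi> (V x)) (V y)"
    using dilates[unfolded dilates_def, THEN conjunct2, THEN conjunct2] assms by blast
  then show ?thesis
    by (simp only: eval_tuple_T_mat[OF assms])
qed

lemma R_compression: "cinner (R j (V x)) (V y) = cinner (T j x) y"
  unfolding R_def compression[OF H_inf_coord] limit_mat_coord[of u, OF unit] transpose_transpose ..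

lemma R_commute: "R i (R j x) = R j (R i x)"
proof -
  have prod: "R i (R j x) = \<rho> (\<lambda>z. z $ i * z $ j) x" for i j
    unfolding rep_mult[OF H_inf_coord H_inf_coord] R_def comp_apply ..
  have "(\<lambda>z :: complex ^ 3. z $ i * z $ j) = (\<lambda>z. z $ j * z $ i)"
    by (simp add: mult.commute)
  then show ?thesis
    unfolding prod by (rule arg_cong[where f = "\<lambda>f. \<rho> f x"])
qed

text \<open>\<rho> maps 1 to a contraction whose compression is the identity, so the norm leaves no
  room for a component outside the range of V.\<close>

lemma rho_one_V: "\<rho> (\<lambda>z. 1) (V x) = V x"
proof (rule eq_if_cinner_norm)
  show "norm (\<rho> (\<lambda>z. 1) (V x)) \<le> norm (V x)"
    using rho_norm_le[OF agler_ineq_const, of 1 "V x"] by simp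
  show "cinner (\<rho> (\<lambda>z. 1) (V x)) (V x) = of_real ((norm (V x))\<^sup>2)"
    unfolding compression[OF H_inf_const] limit_mat_const[of u, OF unit] transpose_mat mat_vector_mult V_norm
    by (simp add: cinner_self)
qed

lemma cinner_rho_one_V: "cinner (\<rho> (\<lambda>z. 1) x) (V y) = cinner x (V y)"
  using contraction_attained[of "\<rho> (\<lambda>z. 1)" "V y" x, OF rho_linear(1,2)[OF H_inf_const]]
    rho_norm_le[OF agler_ineq_const, of 1] by (simp add: rho_one_V)

text \<open>The compression already has the full norm of x, so the contraction R j cannot add
  anything orthogonal to it.\<close>

lemma R_V_isometric:
  assumes "norm (T j x) = norm x"
  shows "R j (V x) = V (T j x)"
proof (rule eq_if_cinner_norm)
  show "norm (R j (V x)) \<le> norm (V (T j x))"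
    using R_norm_le[of j "V x"] by (simp add: V_norm assms)
  show "cinner (R j (V x)) (V (T j x)) = of_real ((norm (V (T j x)))\<^sup>2)"
    unfolding R_compression V_norm cinner_self ..
qed

text \<open>In adjoint form R_j^* V y = V w: a vector at which a contraction attains its norm is
  recovered by the adjoint.\<close>

lemma cinner_R_isometric:
  assumes "T j w = y" "norm w = norm y"
  shows "cinner (R j x) (V y) = cinner x (V w)"
proof -
  have "R j (V w) = V y"
    using R_V_isometric[of j w] assms by simp
  then show ?thesis
    using contraction_attained[of "R j" "V w" x] by (simp add: R_linear R_norm_le V_norm assms)
qed

section \<open>The action of the dilated coordinates on the range of V\<close>

lemma u_norm: "u j $ 1 * u j $ 1 + u j $ 2 * u j $ 2 = 1"
  using unit_vector_2[OF unit[of j]] by (simp add: power2_eq_square)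

lemma mid_sum_zero: "vec_mid (u 1) + vec_mid (u 2) + vec_mid (u 3) = 0"
  unfolding vec_mid_add[symmetric] sum_zero by (simp add: vec_mid_def vec_eq_iff forall_4)

lemma exists_other_index: "\<exists>i. i \<noteq> (j :: 3)"
  by (rule exI[of _ "j + 1"]) simp

lemma R_V_e4: "R j (V vec_e4) = V (vec_mid (u j))"
  using R_V_isometric[of j vec_e4] by (simp add: T_mat_vec_e4 norm_vec_e4 norm_vec_mid unit)

lemma R_V_mid: "R i (V (vec_mid (u j))) = V (T i (vec_mid (u j)))"
proof -
  have "R i (V (vec_mid (u j))) = (if i = j then V vec_e1 else (- 1 / 2) *\<^sub>R V vec_e1)"
  proof (rule symmetric_3x3_solution)
    show "R i (V (vec_mid (u j))) = R j (V (vec_mid (u i)))" for i j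
      unfolding R_V_e4[symmetric] by (rule R_commute)
    show "R i (V (vec_mid (u i))) = V vec_e1" for i
      using R_V_isometric[of i "vec_mid (u i)"]
      by (simp add: T_mat_vec_mid u_norm norm_vec_e1 norm_vec_mid unit)
    show "R i (V (vec_mid (u 1))) + R i (V (vec_mid (u 2))) + R i (V (vec_mid (u 3))) = 0" for i
      unfolding R_linear(1)[symmetric] V_linear(1)[symmetric] mid_sum_zero by (simp add: V_linear R_linear)
  qed
  \<comment> \<open>The compressed matrix satisfies the same three conditions and hence has the same
    entries.\<close>
  moreover have "V (T i (vec_mid (u j))) = (if i = j then V vec_e1 else (- 1 / 2) *\<^sub>R V vec_e1)"
  proof (rule symmetric_3x3_solution)
    show "V (T i (vec_mid (u j))) = V (T j (vec_mid (u i)))" for i j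
      by (simp add: T_mat_vec_mid mult.commute)
    show "V (T i (vec_mid (u i))) = V vec_e1" for i
      by (simp add: T_mat_vec_mid u_norm)
    show "V (T i (vec_mid (u 1))) + V (T i (vec_mid (u 2))) + V (T i (vec_mid (u 3))) = 0" for i
      unfolding V_linear(1)[symmetric] matrix_vector_right_distrib[symmetric] mid_sum_zero by (simp add: V_linear)
  qed
  ultimately show ?thesis
    by simp
qed

lemma T_mid: "T i (vec_mid (u j)) = (if i = j then 1 else - 1 / 2) *\<^sub>R vec_e1"
proof -
  have "T i (vec_mid (u j)) = (if i = j then vec_e1 else (- 1 / 2) *\<^sub>R vec_e1)"
  proof (rule symmetric_3x3_solution)
    show "T i (vec_mid (u j)) = T j (vec_mid (u i))" for i j
      by (simp add: T_mat_vec_mid mult.commute)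
    show "T i (vec_mid (u i)) = vec_e1" for i
      by (simp add: T_mat_vec_mid u_norm)
    show "T i (vec_mid (u 1)) + T i (vec_mid (u 2)) + T i (vec_mid (u 3)) = 0" for i
      unfolding matrix_vector_right_distrib[symmetric] mid_sum_zero by simp
  qed
  then show ?thesis
    by simp
qed

lemma fixed_by_quarter: "x = (- 1 / 2) *\<^sub>R y \<Longrightarrow> y = (- 1 / 2) *\<^sub>R x \<Longrightarrow> x = (0 :: 'v::real_vector)"
proof -
  assume xy: "x = (- 1 / 2) *\<^sub>R y" "y = (- 1 / 2) *\<^sub>R x"
  then have "x = (1 / 4) *\<^sub>R x"
    using arg_cong[OF xy(2), of "(*\<^sub>R) (- 1 / 2)"] by simp
  from this[symmetric] have "(1 - 1 / 4 :: real) *\<^sub>R x = 0"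
    by (simp only: scaleR_left_diff_distrib scaleR_one diff_self)
  then show "x = 0"
    by simp
qed

lemma R_V_e1: "R j (V vec_e1) = 0"
proof -
  obtain i where "i \<noteq> j"
    using exists_other_index by blast
  have "R a (V vec_e1) = (- 1 / 2) *\<^sub>R R b (V vec_e1)" if "a \<noteq> b" for a b
  proof -
    have "R a (V vec_e1) = R a (R b (V (vec_mid (u b))))"
      by (simp add: R_V_mid T_mid)
    also have "\<dots> = R b (R a (V (vec_mid (u b))))"
      by (rule R_commute)
    also have "\<dots> = R b ((- 1 / 2) *\<^sub>R V vec_e1)"
      by (simp only: R_V_mid T_mid V_linear that if_False)
    finally show ?thesis
      by (simp only: R_linear)
  qed
  then show ?thesis
    using fixed_by_quarter[of "R j (V vec_e1)" "R i (V vec_e1)"] \<open>i \<noteq> j\<close> by metis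
qed

lemma R_V: "R j (V x) = V (T j x)"
proof -
  obtain a b where x: "x = x $ 1 *s vec_e1 + (a *s vec_mid (u 1) + b *s vec_mid (u 2)) + x $ 4 *s vec_e4"
    using vec_span[of u, OF unit sum_zero] by blast
  show ?thesis
    by (subst (1 2) x)
      (simp only: V_linear R_linear R_V_e1 R_V_e4 R_V_mid matrix_vector_right_distrib
        vector_scalar_commute T_mat_vec_e1 T_mat_vec_e4)
qed

section \<open>The adjoints of the dilated coordinates on the range of V\<close>

lemma cinner_R_V_e1: "cinner (R j x) (V vec_e1) = cinner x (V (vec_mid (u j)))"
  by (rule cinner_R_isometric) (simp_all add: T_mid norm_vec_e1 norm_vec_mid unit)

text \<open>The mirrored matrix R_i^* V m_j = R_i^* R_j^* V e_1 is symmetric, its rows sum to 0, and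
  its diagonal is V e_4, as T_j takes e_4 to m_j isometrically.\<close>

lemma cinner_R_V_mid:
  "cinner (R i x) (V (vec_mid (u j))) = (if i = j then 1 else - 1 / 2) *\<^sub>R cinner x (V vec_e4)"
proof -
  have "cinner (R i x) (V (vec_mid (u j))) = (if i = j then cinner x (V vec_e4) else (- 1 / 2) *\<^sub>R cinner x (V vec_e4))"
  proof (rule symmetric_3x3_solution)
    show "cinner (R i x) (V (vec_mid (u j))) = cinner (R j x) (V (vec_mid (u i)))" for i j
      unfolding cinner_R_V_e1[symmetric] R_commute[of i j] ..
    show "cinner (R i x) (V (vec_mid (u i))) = cinner x (V vec_e4)" for i
      by (rule cinner_R_isometric) (simp_all add: T_mat_vec_e4 norm_vec_e4 norm_vec_mid unit)
    show "cinner (R i x) (V (vec_mid (u 1))) + cinner (R i x) (V (vec_mid (u 2))) + cinner (R i x) (V (vec_mid (u 3))) = 0" for i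
      unfolding cinner_add_right[symmetric] V_linear(1)[symmetric] mid_sum_zero by (simp add: V_linear)
  qed
  then show ?thesis
    by simp
qed

text \<open>Write V e_4 as R_b^* V m_b and commute the adjoints. Two different indices give a
  relation with factor -1/2 in both directions, so the value equals a quarter of itself.\<close>

lemma cinner_R_V_e4: "cinner (R j x) (V vec_e4) = 0"
proof -
  obtain i where "i \<noteq> j"
    using exists_other_index by blast
  have "cinner (R a x) (V vec_e4) = (- 1 / 2) *\<^sub>R cinner (R b x) (V vec_e4)" if "a \<noteq> b" for a b
  proof -
    have "cinner (R a x) (V vec_e4) = cinner (R b (R a x)) (V (vec_mid (u b)))"
      by (simp add: cinner_R_V_mid)
    also have "\<dots> = cinner (R a (R b x)) (V (vec_mid (u b)))"
      by (simp only: R_commute[of a b])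
    also have "\<dots> = (- 1 / 2) *\<^sub>R cinner (R b x) (V vec_e4)"
      using that by (simp add: cinner_R_V_mid)
    finally show ?thesis .
  qed
  then show ?thesis
    using fixed_by_quarter[of "cinner (R j x) (V vec_e4)" "cinner (R i x) (V vec_e4)"] \<open>i \<noteq> j\<close> by metis
qed

text \<open>Two orders of the same product: the coordinate acts first for vectors V x, and last when
  the result is paired with V y, so that the adjoint of R j reaches V y.\<close>

lemma rho_gleason:
  assumes \<phi>: "\<phi> \<in> H_inf"
  shows "\<rho> \<phi> x = cscale (\<phi> 0) (\<rho> (\<lambda>z. 1) x) + (\<Sum>j\<in>UNIV. \<rho> (gleason j \<phi>) (R j x))"
    and "\<rho> \<phi> x = cscale (\<phi> 0) (\<rho> (\<lambda>z. 1) x) + (\<Sum>j\<in>UNIV. R j (\<rho> (gleason j \<phi>) x))"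
proof -
  have scale: "\<rho> (\<lambda>z. c) = (\<lambda>x. cscale c (\<rho> (\<lambda>z. 1) x))" for c
  proof -
    have "\<rho> (\<lambda>z. c * 1) = (\<lambda>x. cscale c (\<rho> (\<lambda>z. 1) x))"
      by (rule rep_scale[OF H_inf_const])
    then show ?thesis
      by simp
  qed
  have G: "(\<lambda>z. z $ j * gleason j \<phi> z) \<in> H_inf" for j
    by (intro H_inf_mult H_inf_coord H_inf_gleason \<phi>)
  have "\<phi> = (\<lambda>z. \<phi> 0 + (z $ 1 * gleason 1 \<phi> z + (z $ 2 * gleason 2 \<phi> z + z $ 3 * gleason 3 \<phi> z)))"
    by (rule ext) (rule gleason_decomposition[unfolded sum_3 add.assoc])
  then have "\<rho> \<phi> x = \<rho> (\<lambda>z. \<phi> 0 + (z $ 1 * gleason 1 \<phi> z + (z $ 2 * gleason 2 \<phi> z + z $ 3 * gleason 3 \<phi> z))) x"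
    by (rule arg_cong)
  also have "\<dots> = cscale (\<phi> 0) (\<rho> (\<lambda>z. 1) x) + (\<Sum>j\<in>UNIV. \<rho> (\<lambda>z. z $ j * gleason j \<phi> z) x)"
    by (simp only: rep_add[OF H_inf_const H_inf_add[OF G H_inf_add[OF G G]]] rep_add[OF G H_inf_add[OF G G]] rep_add[OF G G]
        scale[of "\<phi> 0"] sum_3 add.assoc)
  finally have *: "\<rho> \<phi> x = cscale (\<phi> 0) (\<rho> (\<lambda>z. 1) x) + (\<Sum>j\<in>UNIV. \<rho> (\<lambda>z. z $ j * gleason j \<phi> z) x)" .
  show "\<rho> \<phi> x = cscale (\<phi> 0) (\<rho> (\<lambda>z. 1) x) + (\<Sum>j\<in>UNIV. R j (\<rho> (gleason j \<phi>) x))"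
    unfolding * rep_mult[OF H_inf_coord H_inf_gleason[OF \<phi>]] R_def comp_apply ..
  show "\<rho> \<phi> x = cscale (\<phi> 0) (\<rho> (\<lambda>z. 1) x) + (\<Sum>j\<in>UNIV. \<rho> (gleason j \<phi>) (R j x))"
    unfolding * mult.commute[of "_ $ _" "gleason _ _ _"] rep_mult[OF H_inf_gleason[OF \<phi>] H_inf_coord] R_def comp_apply ..
qed

lemma rho_V:
  assumes \<phi>: "\<phi> \<in> H_inf"
  shows "\<rho> \<phi> (V x) = V (transpose (limit_mat u \<phi>) *v x)"
proof -
  have step: "\<rho> \<psi> (V y) = V (\<psi> 0 *s y) + (\<Sum>j\<in>UNIV. \<rho> (gleason j \<psi>) (V (T j y)))" if "\<psi> \<in> H_inf" for \<psi> y
    using rho_gleason(1)[OF that, of "V y"] by (simp add: rho_one_V R_V V_linear)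
  \<comment> \<open>After two applications of T the next division contributes nothing more, by
    nilpotency.\<close>
  have last: "\<rho> \<psi> (V (T i (T j x))) = V (\<psi> 0 *s T i (T j x))" if "\<psi> \<in> H_inf" for \<psi> i j
    unfolding step[OF that] T_mat_nilpotent by (simp add: V_linear rho_linear H_inf_gleason that)
  have "\<rho> \<phi> (V x) = V (\<phi> 0 *s x) + (\<Sum>j\<in>UNIV. V (gleason j \<phi> 0 *s T j x) +
      (\<Sum>i\<in>UNIV. V (gleason i (gleason j \<phi>) 0 *s T i (T j x))))"
    by (simp only: step[OF \<phi>] step[OF H_inf_gleason[OF \<phi>]] last[OF H_inf_gleason[OF H_inf_gleason[OF \<phi>]]])
  then show ?thesis
    unfolding limit_mat_transpose_mult by (simp add: V_linear V_sum)
qed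

text \<open>One division moves an adjoint onto V y. Adjoints annihilate V e_4, send the middle
  vectors to multiples of V e_4 and V e_1 to middle vectors, so the three cases are settled in this
  order. Each holds for all \<psi> because the next one applies it to Gleason components.\<close>

lemma rho_ortho_compl:
  assumes x: "x \<in> ortho_compl (range V)" and \<phi>: "\<phi> \<in> H_inf"
  shows "\<rho> \<phi> x \<in> ortho_compl (range V)"
proof -
  have one: "cinner (\<rho> (\<lambda>z. 1) x) (V y) = 0" for y
    using x by (simp add: cinner_rho_one_V ortho_compl_def)
  have decomp: "cinner (\<rho> \<psi> x) (V y) = (\<Sum>j\<in>UNIV. cinner (R j (\<rho> (gleason j \<psi>) x)) (V y))" if "\<psi> \<in> H_inf" for \<psi> y
    unfolding rho_gleason(2)[OF that, of x] sum_3 by (simp add: cinner_add_left cinner_cscale_left one)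
  have e4: "cinner (\<rho> \<psi> x) (V vec_e4) = 0" if "\<psi> \<in> H_inf" for \<psi>
    unfolding decomp[OF that] by (simp add: cinner_R_V_e4)
  have mid: "cinner (\<rho> \<psi> x) (V (vec_mid (u i))) = 0" if "\<psi> \<in> H_inf" for \<psi> i
    unfolding decomp[OF that] cinner_R_V_mid by (simp add: e4 H_inf_gleason that)
  have e1: "cinner (\<rho> \<psi> x) (V vec_e1) = 0" if "\<psi> \<in> H_inf" for \<psi>
    unfolding decomp[OF that] cinner_R_V_e1 by (simp add: mid H_inf_gleason that)
  have "cinner (\<rho> \<phi> x) (V y) = 0" for y
  proof -
    obtain a b where y: "y = y $ 1 *s vec_e1 + (a *s vec_mid (u 1) + b *s vec_mid (u 2)) + y $ 4 *s vec_e4"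
      using vec_span[of u, OF unit sum_zero] by blast
    show ?thesis
      by (subst y) (simp only: V_linear cinner_add_right cinner_cscale_right e1[OF \<phi>] mid[OF \<phi>] e4[OF \<phi>]
        mult_zero_right add_0_left)
  qed
  then show ?thesis
    by (auto simp: ortho_compl_def)
qed

lemma direct_summand: "direct_summand \<rho> V (eval_tuple (\<lambda>j. (*v) (T_mat (u j))))"
  unfolding direct_summand_def
proof (intro conjI ballI allI)
  show V: "isometric_embedding V"
    using dilates by (simp add: dilates_def)
  show "\<rho> \<phi> (V x) = V (eval_tuple (\<lambda>j. (*v) (T_mat (u j))) \<phi> x)" if "\<phi> \<in> H_inf" for \<phi> x
    by (simp only: rho_V[OF that] eval_tuple_T_mat[OF that])
  show "reducing_subspace \<rho> (range V)"
    unfolding reducing_subspace_def invariant_subspace_def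
    using closed_csubspace_range[OF V] closed_csubspace_ortho_compl rho_ortho_compl rho_V by auto
qed

end

theorem theorem3p13:
  fixes u :: "3 \<Rightarrow> real ^ 2"
    and \<pi> :: "(complex ^ 3 \<Rightarrow> complex) \<Rightarrow> complex ^ 4 \<Rightarrow> complex ^ 4"
  assumes unit: "\<And>j. norm (u j) = 1"
    and sum_zero: "u 1 + u 2 + u 3 = 0"
  defines "\<pi> \<equiv> eval_tuple (\<lambda>j. (*v) (T_mat (u j)))"
  shows "(\<forall>j. \<pi> (\<lambda>z. z $ j) = (*v) (T_mat (u j))) \<and>
         boundary_representation TYPE('h::chilbert_space) \<pi>"
  unfolding boundary_representation_def \<pi>_def
proof (intro conjI allI impI)
  show "eval_tuple (\<lambda>j. (*v) (T_mat (u j))) (\<lambda>z. z $ j) = (*v) (T_mat (u j))" for j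
    by (rule eval_tuple_coord[of u, OF unit])
  show "representation (eval_tuple (\<lambda>j. (*v) (T_mat (u j))))"
    by (rule representation_eval_tuple[of u, OF unit])
  show "unital (eval_tuple (\<lambda>j. (*v) (T_mat (u j))))"
    by (rule unital_eval_tuple[of u, OF unit])
  show "completely_contractive (eval_tuple (\<lambda>j. (*v) (T_mat (u j))))"
    by (rule completely_contractive_eval_tuple[of u, OF unit])
  show "irreducible_rep (eval_tuple (\<lambda>j. (*v) (T_mat (u j))))"
    by (rule irreducible_eval_tuple[of u, OF unit sum_zero])
  fix \<rho> :: "(complex ^ 3 \<Rightarrow> complex) \<Rightarrow> 'h \<Rightarrow> 'h" and V :: "complex ^ 4 \<Rightarrow> 'h"
  assume "representation \<rho> \<and> completely_contractive \<rho> \<and> dilates \<rho> V (eval_tuple (\<lambda>j. (*v) (T_mat (u j))))"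
  then interpret T_dilation u \<rho> V
    using unit sum_zero by unfold_locales auto
  show "direct_summand \<rho> V (eval_tuple (\<lambda>j. (*v) (T_mat (u j))))"
    by (rule direct_summand)
qed

end
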